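(* After regrouping sites, the evolution of a one-dimensional quantum cellular automaton can be written as a product of on-site unitaries and partial shifts.
   Context: A one-dimensional quantum cellular automaton consists of a line of sites (infinite, or finite with periodic boundary conditions), each with an identical finite-dimensional quantum system. It evolves over discrete timesteps by a unitary $U$ that is translationally invariant in space and time (for infinite lattices, by an automorphism of the algebra of observables). The evolution is causal: there is an $L\ge0$ such that, for any site $n$ and any operator $A$ localized on $n$ (acting as the identity on all other sites), the evolved operator $U^\dagger AU$ acts as the identity on all sites $m$ with $|n-m|>L$. Regrouping sites means combining neighbouring sites together into single sites with higher-dimensional quantum systems. On-site unitaries are unitaries each acting on a single (regrouped) site. A partial shift is an evolution for which the algebra of each (regrouped) site is, in a translationally invariant way, a tensor product of two subsystem algebras; one of the two families of subsystem algebras is shifted by one site along the line while the other family is left where it is. *)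

theory Defs
  imports "HOL-Analysis.Analysis"
begin

section \<open>Unital C*-algebras\<close>

class cstar_algebra = real_normed_algebra_1 + banach +
  fixes scaleC :: "complex \<Rightarrow> 'a \<Rightarrow> 'a"  (infixr "*\<^sub>C" 75)
    and adj :: "'a \<Rightarrow> 'a"
  assumes scaleC_add_right: "c *\<^sub>C (a + b) = c *\<^sub>C a + c *\<^sub>C b"
    and scaleC_add_left: "(c + d) *\<^sub>C a = c *\<^sub>C a + d *\<^sub>C a"
    and scaleC_scaleC: "c *\<^sub>C d *\<^sub>C a = (c * d) *\<^sub>C a"
    and scaleC_of_real: "complex_of_real r *\<^sub>C a = r *\<^sub>R a"
    and mult_scaleC_left: "(c *\<^sub>C a) * b = c *\<^sub>C (a * b)"
    and mult_scaleC_right: "a * (c *\<^sub>C b) = c *\<^sub>C (a * b)"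
    and norm_scaleC: "norm (c *\<^sub>C a) = cmod c * norm a"
    and adj_adj: "adj (adj a) = a"
    and adj_add: "adj (a + b) = adj a + adj b"
    and adj_scaleC: "adj (c *\<^sub>C a) = cnj c *\<^sub>C adj a"
    and adj_mult: "adj (a * b) = adj b * adj a"
    and cstar_identity: "norm (adj a * a) = (norm a)\<^sup>2"

definition is_unitary :: "'a::cstar_algebra \<Rightarrow> bool" where
  "is_unitary u \<longleftrightarrow> adj u * u = 1 \<and> u * adj u = 1"

definition conj_by :: "'a::cstar_algebra \<Rightarrow> 'a \<Rightarrow> 'a" where
  "conj_by u a = adj u * a * u"

definition star_automorphism :: "('a::cstar_algebra \<Rightarrow> 'a) \<Rightarrow> bool" where
  "star_automorphism \<alpha> \<longleftrightarrow> bij \<alpha> \<and> \<alpha> 1 = 1 \<and>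
     (\<forall>a b. \<alpha> (a + b) = \<alpha> a + \<alpha> b) \<and> (\<forall>a b. \<alpha> (a * b) = \<alpha> a * \<alpha> b) \<and>
     (\<forall>c a. \<alpha> (c *\<^sub>C a) = c *\<^sub>C \<alpha> a) \<and> (\<forall>a. \<alpha> (adj a) = adj (\<alpha> a))"

definition star_subalgebra :: "'a::cstar_algebra set \<Rightarrow> bool" where
  "star_subalgebra B \<longleftrightarrow> 1 \<in> B \<and> (\<forall>a\<in>B. \<forall>b\<in>B. a + b \<in> B \<and> a * b \<in> B) \<and>
     (\<forall>c. \<forall>a\<in>B. c *\<^sub>C a \<in> B) \<and> (\<forall>a\<in>B. adj a \<in> B)"

text \<open>The internal tensor product \<open>B = P \<otimes> Q\<close>: the last conjunct says that the
  multiplication map from the algebraic tensor product of \<open>P\<close> and \<open>Q\<close> is injective.\<close>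

definition tensor_factors :: "'a::cstar_algebra set \<Rightarrow> 'a set \<Rightarrow> 'a set \<Rightarrow> bool" where
  "tensor_factors B P Q \<longleftrightarrow> star_subalgebra P \<and> star_subalgebra Q \<and>
     (\<forall>p\<in>P. \<forall>q\<in>Q. p * q = q * p) \<and>
     star_subalgebra hull (P \<union> Q) = B \<and>
     (\<forall>(n::nat) p q. (\<forall>i<n. p i \<in> P \<and> q i \<in> Q) \<and>
        (\<forall>c. (\<Sum>i<n. c i *\<^sub>C q i) = 0 \<longrightarrow> (\<forall>i<n. c i = 0)) \<and>
        (\<Sum>i<n. p i * q i) = 0 \<longrightarrow> (\<forall>i<n. p i = 0))"

definition matrix_star_hom :: "(complex^'d^'d \<Rightarrow> 'a::cstar_algebra) \<Rightarrow> bool" where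
  "matrix_star_hom \<phi> \<longleftrightarrow> \<phi> (mat 1) = 1 \<and>
     (\<forall>A B. \<phi> (A + B) = \<phi> A + \<phi> B) \<and> (\<forall>A B. \<phi> (A ** B) = \<phi> A * \<phi> B) \<and>
     (\<forall>c A. \<phi> (map_matrix ((*) c) A) = c *\<^sub>C \<phi> A) \<and>
     (\<forall>A. \<phi> (map_matrix cnj (transpose A)) = adj (\<phi> A))"


section \<open>The line of sites and its algebra of observables\<close>

text \<open>\<open>\<iota> n A\<close> is the operator \<open>A\<close> of a single system of dimension \<open>CARD('d)\<close>, acting on site
  \<open>n\<close>. The sites are the integers modulo \<open>N\<close>, so \<open>N = 0\<close> is the infinite line and \<open>N > 0\<close> is
  the ring of \<open>N\<close> sites. The type \<open>'a\<close> is the whole algebra of observables: for \<open>N = 0\<close> it is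
  the quasi-local algebra, and for \<open>N > 0\<close> it is the algebra of all operators on the \<open>N\<close>-fold
  tensor power of the single-site space (both are determined up to isomorphism by
  \<open>CARD('d)\<close> and \<open>N\<close>). \<open>\<tau>\<close> is the translation by one site.\<close>

definition loc_alg ::
    "(int \<Rightarrow> complex^'d^'d \<Rightarrow> 'a::cstar_algebra) \<Rightarrow> int set \<Rightarrow> 'a set" where
  "loc_alg \<iota> X = star_subalgebra hull (\<Union>n\<in>X. range (\<iota> n))"

definition spin_chain ::
    "nat \<Rightarrow> (int \<Rightarrow> complex^'d^'d \<Rightarrow> 'a::cstar_algebra) \<Rightarrow> ('a \<Rightarrow> 'a) \<Rightarrow> bool" where
  "spin_chain N \<iota> \<tau> \<longleftrightarrow>
     (\<forall>n. matrix_star_hom (\<iota> n)) \<and>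
     (\<forall>n. \<iota> (n + int N) = \<iota> n) \<and>
     (\<forall>m n A B. m mod int N \<noteq> n mod int N \<longrightarrow> \<iota> m A * \<iota> n B = \<iota> n B * \<iota> m A) \<and>
     closure (loc_alg \<iota> UNIV) = UNIV \<and>
     star_automorphism \<tau> \<and> (\<forall>n A. \<tau> (\<iota> n A) = \<iota> (n + 1) A)"


section \<open>Quantum cellular automata\<close>

text \<open>Acting as the identity on every site farther than \<open>L\<close> from \<open>n\<close> means belonging to
  \<open>loc_alg \<iota> {n - L..n + L}\<close>. As \<open>\<iota>\<close> is \<open>N\<close>-periodic, on a ring this window consists of the
  sites at ring distance at most \<open>L\<close> from \<open>n\<close>.\<close>

definition causal ::
    "(int \<Rightarrow> complex^'d^'d \<Rightarrow> 'a::cstar_algebra) \<Rightarrow> nat \<Rightarrow> ('a \<Rightarrow> 'a) \<Rightarrow> bool" where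
  "causal \<iota> L \<alpha> \<longleftrightarrow> (\<forall>n A. \<alpha> (\<iota> n A) \<in> loc_alg \<iota> {n - int L..n + int L})"

definition infinite_qca ::
    "(int \<Rightarrow> complex^'d^'d \<Rightarrow> 'a::cstar_algebra) \<Rightarrow> ('a \<Rightarrow> 'a) \<Rightarrow> nat \<Rightarrow> ('a \<Rightarrow> 'a) \<Rightarrow> bool" where
  "infinite_qca \<iota> \<tau> L \<alpha> \<longleftrightarrow>
     spin_chain 0 \<iota> \<tau> \<and> star_automorphism \<alpha> \<and> \<alpha> \<circ> \<tau> = \<tau> \<circ> \<alpha> \<and> causal \<iota> L \<alpha>"

definition ring_qca ::
    "nat \<Rightarrow> (int \<Rightarrow> complex^'d^'d \<Rightarrow> 'a::cstar_algebra) \<Rightarrow> ('a \<Rightarrow> 'a) \<Rightarrow> nat \<Rightarrow> 'a \<Rightarrow> bool" where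
  "ring_qca N \<iota> \<tau> L U \<longleftrightarrow> N \<ge> 1 \<and>
     spin_chain N \<iota> \<tau> \<and> is_unitary U \<and> \<tau> U = U \<and> causal \<iota> L (conj_by U)"


section \<open>Regrouped sites, on-site unitaries and partial shifts\<close>

definition block_alg ::
    "(int \<Rightarrow> complex^'d^'d \<Rightarrow> 'a::cstar_algebra) \<Rightarrow> nat \<Rightarrow> int \<Rightarrow> 'a set" where
  "block_alg \<iota> k x = loc_alg \<iota> {int k * x ..< int k * (x + 1)}"

text \<open>The same unitary on each regrouped site, so that the product is translationally
  invariant.\<close>

definition onsite_unitaries ::
    "(int \<Rightarrow> complex^'d^'d \<Rightarrow> 'a::cstar_algebra) \<Rightarrow> ('a \<Rightarrow> 'a) \<Rightarrow> nat \<Rightarrow> (int \<Rightarrow> 'a) \<Rightarrow> bool" where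
  "onsite_unitaries \<iota> \<tau> k u \<longleftrightarrow>
     (\<forall>x. u x \<in> block_alg \<iota> k x \<and> is_unitary (u x) \<and> (\<tau> ^^ k) (u x) = u (x + 1))"

text \<open>On the infinite line the product of the \<open>u x\<close> over all \<open>x\<close> does not exist in the algebra
  of observables, but conjugation by it is a well-defined automorphism.\<close>

definition onsite_automorphism ::
    "(int \<Rightarrow> complex^'d^'d \<Rightarrow> 'a::cstar_algebra) \<Rightarrow> ('a \<Rightarrow> 'a) \<Rightarrow> nat \<Rightarrow> ('a \<Rightarrow> 'a) \<Rightarrow> bool" where
  "onsite_automorphism \<iota> \<tau> k \<beta> \<longleftrightarrow> star_automorphism \<beta> \<and>
     (\<exists>u. onsite_unitaries \<iota> \<tau> k u \<and> (\<forall>x. \<forall>a\<in>block_alg \<iota> k x. \<beta> a = conj_by (u x) a))"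

definition onsite_layer_unitary ::
    "nat \<Rightarrow> (int \<Rightarrow> complex^'d^'d \<Rightarrow> 'a::cstar_algebra) \<Rightarrow> ('a \<Rightarrow> 'a) \<Rightarrow> nat \<Rightarrow> 'a \<Rightarrow> bool" where
  "onsite_layer_unitary N \<iota> \<tau> k V \<longleftrightarrow>
     (\<exists>u. onsite_unitaries \<iota> \<tau> k u \<and> V = prod_list (map u [0..int (N div k) - 1]))"

text \<open>The two cases of the last conjunct are a shift of the family \<open>P\<close> to the right and to the
  left; \<open>\<tau> ^^ k\<close> is the translation by one regrouped site.\<close>

definition partial_shift ::
    "(int \<Rightarrow> complex^'d^'d \<Rightarrow> 'a::cstar_algebra) \<Rightarrow> ('a \<Rightarrow> 'a) \<Rightarrow> nat \<Rightarrow> ('a \<Rightarrow> 'a) \<Rightarrow> bool" where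
  "partial_shift \<iota> \<tau> k \<sigma> \<longleftrightarrow> star_automorphism \<sigma> \<and>
     (\<exists>P Q. (\<forall>x. tensor_factors (block_alg \<iota> k x) (P x) (Q x) \<and>
                 (\<tau> ^^ k) ` P x = P (x + 1) \<and> (\<tau> ^^ k) ` Q x = Q (x + 1)) \<and>
            (\<forall>x. \<forall>b\<in>Q x. \<sigma> b = b) \<and>
            ((\<forall>x. \<forall>a\<in>P x. \<sigma> a = (\<tau> ^^ k) a) \<or> (\<forall>x. \<forall>a\<in>P x. (\<tau> ^^ k) (\<sigma> a) = a)))"

definition infinite_decomposition ::
    "(int \<Rightarrow> complex^'d^'d \<Rightarrow> 'a::cstar_algebra) \<Rightarrow> ('a \<Rightarrow> 'a) \<Rightarrow> nat \<Rightarrow> ('a \<Rightarrow> 'a) \<Rightarrow> bool" where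
  "infinite_decomposition \<iota> \<tau> k \<alpha> \<longleftrightarrow>
     (\<exists>\<beta>s. (\<forall>\<beta>\<in>set \<beta>s. onsite_automorphism \<iota> \<tau> k \<beta> \<or> partial_shift \<iota> \<tau> k \<beta>) \<and>
           \<alpha> = foldr (\<circ>) \<beta>s id)"

definition ring_decomposition ::
    "nat \<Rightarrow> (int \<Rightarrow> complex^'d^'d \<Rightarrow> 'a::cstar_algebra) \<Rightarrow> ('a \<Rightarrow> 'a) \<Rightarrow> nat \<Rightarrow> 'a \<Rightarrow> bool" where
  "ring_decomposition N \<iota> \<tau> k U \<longleftrightarrow>
     (\<exists>Vs. (\<forall>V\<in>set Vs. onsite_layer_unitary N \<iota> \<tau> k V \<or>
                       is_unitary V \<and> partial_shift \<iota> \<tau> k (conj_by V)) \<and>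
           U = prod_list Vs)"

text \<open>Some regrouping of a ring always works for a trivial reason: \<open>k = N\<close>, where the whole ring
  is a single site and the evolution is itself an on-site unitary. The other sizes are those for
  which a block splits into two parts of at least \<open>L\<close> sites each, and the evolved algebras of two
  distinct blocks overlap on at most one side (at least three blocks).\<close>

definition ring_block_size :: "nat \<Rightarrow> nat \<Rightarrow> nat \<Rightarrow> bool" where
  "ring_block_size N L k \<longleftrightarrow> k \<ge> 1 \<and> k dvd N \<and> (k = N \<or> 2 * L \<le> k \<and> 3 * k \<le> N)"

end

theory Submission
  imports Defs "HOL-Computational_Algebra.Fundamental_Theorem_Algebra"
begin

text \<open>With \<open>T = \<tau>\<^sup>k\<close> the translation by one block, write \<open>\<alpha> = \<tau>\<^sup>L \<gamma>\<close>; both \<open>\<tau>\<^sup>L\<close> and \<open>\<gamma>\<close> map the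
  algebra \<open>A x\<close> of a block into \<open>A x \<otimes> A (x + s)\<close> for a fixed \<open>s = \<plusminus>1\<close>. For such a \<open>\<gamma>\<close> the matrix algebra
  \<open>B x = \<gamma> (A x)\<close> commutes with all other \<open>B y\<close>. Taking coefficients with respect to matrix units of
  \<open>A (x + s)\<close> one finds that \<open>B x\<close> is the tensor product of \<open>B x \<inter> A x\<close> and \<open>B x \<inter> A (x + s)\<close>, both of
  which have trivial centre and hence are matrix algebras. Pulling back gives \<open>A x = P x \<otimes> Q x\<close>, where \<open>\<gamma>\<close>
  moves \<open>P x\<close> to the neighbouring block and keeps \<open>Q x\<close> in place. By the Skolem--Noether theorem there is a
  unitary on each block which agrees with \<open>T\<^sup>-\<^sup>s \<gamma>\<close> on \<open>P x\<close> and with \<open>\<gamma>\<close> on \<open>Q x\<close>; dividing \<open>\<gamma>\<close> by the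
  product of these unitaries leaves the partial shift of the family \<open>P\<close>. On a ring every automorphism is inner,
  and the remaining phase is absorbed in one of the shifts.\<close>

section \<open>Unital star algebras\<close>

text \<open>Causality is two-sided, but the splitting works only for automorphisms that reach a
  single neighbour. Undoing \<open>\<tau> ^^ L\<close> turns the window of radius \<open>L\<close>
  into one that reaches \<open>2 * L\<close> sites to the left, whence the bound
  \<open>2 * L \<le> k\<close>; the compensating translation is itself one-sided and goes through
  the same argument, which gives four layers. One-sidedness matters because a coefficient of an
  element of \<open>B x\<close> with respect to units of \<open>A (x + s)\<close> lies in
  \<open>A x\<close>, and so commutes with \<open>B (x + s)\<close>, which lives on
  \<open>x + s\<close> and \<open>x + 2 s\<close>. For this the blocks \<open>x\<close>,
  \<open>x + s\<close>, \<open>x + 2 s\<close> must be distinct, so a ring needs three of them.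
  Membership is decided by duality: what commutes with all other blocks belongs to the remaining
  one. Limits enter only there, in the triviality of the centre of the quasi-local algebra, and in
  the infinite product of on-site unitaries. Everything else is algebra with matrix units inside one
  fixed algebra.\<close>

lemma scaleC_one [simp]: "1 *\<^sub>C (a::'a::cstar_algebra) = a"
  using scaleC_of_real[of 1 a] by simp

lemma scaleC_zero_left [simp]: "0 *\<^sub>C (a::'a::cstar_algebra) = 0"
  using scaleC_of_real[of 0 a] by simp

lemma scaleC_zero_right [simp]: "c *\<^sub>C (0::'a::cstar_algebra) = 0"
  using scaleC_add_right[of c 0 "0::'a"] by simp

lemma scaleC_minus_one: "(- 1) *\<^sub>C (a::'a::cstar_algebra) = - a"
  using scaleC_of_real[of "-1" a] by simp

lemma scaleC_minus_left: "(- c) *\<^sub>C (a::'a::cstar_algebra) = - (c *\<^sub>C a)"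
  using scaleC_scaleC[of "-1" c a] by (simp add: scaleC_minus_one)

lemma scaleC_minus_right: "c *\<^sub>C (- a) = - (c *\<^sub>C (a::'a::cstar_algebra))"
  by (metis add.right_inverse minus_unique scaleC_add_right scaleC_zero_right)

lemma scaleC_diff_right: "c *\<^sub>C (a - b) = c *\<^sub>C a - c *\<^sub>C (b::'a::cstar_algebra)"
  using scaleC_add_right[of c a "- b"] by (simp add: scaleC_minus_right)

lemma scaleC_diff_left: "(c - d) *\<^sub>C a = c *\<^sub>C a - d *\<^sub>C (a::'a::cstar_algebra)"
  using scaleC_add_left[of c "- d" a] by (simp add: scaleC_minus_left)

lemma scaleC_sum_right: "c *\<^sub>C (\<Sum>i\<in>I. f i) = (\<Sum>i\<in>I. c *\<^sub>C (f i::'a::cstar_algebra))"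
  by (induction I rule: infinite_finite_induct) (auto simp: scaleC_add_right)

lemma scaleC_sum_left: "(\<Sum>i\<in>I. f i) *\<^sub>C (a::'a::cstar_algebra) = (\<Sum>i\<in>I. f i *\<^sub>C a)"
  by (induction I rule: infinite_finite_induct) (auto simp: scaleC_add_left)

lemma scaleC_eq_0_iff: "c *\<^sub>C (a::'a::cstar_algebra) = 0 \<longleftrightarrow> c = 0 \<or> a = 0"
  by (metis mult_eq_0_iff norm_eq_zero norm_scaleC)

lemma adj_zero [simp]: "adj (0::'a::cstar_algebra) = 0"
  using adj_add[of 0 "0::'a"] by simp

lemma adj_one [simp]: "adj (1::'a::cstar_algebra) = 1"
  by (metis adj_adj adj_mult mult_1_right)

lemma adj_minus: "adj (- a) = - adj (a::'a::cstar_algebra)"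
  by (metis add.right_inverse adj_add adj_zero minus_unique)

lemma adj_diff: "adj (a - b) = adj a - adj (b::'a::cstar_algebra)"
  using adj_add[of a "- b"] by (simp add: adj_minus)

lemma adj_sum: "adj (\<Sum>i\<in>I. f i) = (\<Sum>i\<in>I. adj (f i::'a::cstar_algebra))"
  by (induction I rule: infinite_finite_induct) (auto simp: adj_add)

lemma adj_mult_self_eq_0: "adj a * a = 0 \<Longrightarrow> a = (0::'a::cstar_algebra)"
  using cstar_identity[of a] by simp

text \<open>The C*-identity for \<open>adj a\<close> bounds its squared norm by
  \<open>norm a * norm (adj a)\<close>, and one factor cancels.\<close>

lemma norm_adj_le: "norm (adj a) \<le> norm (a::'a::cstar_algebra)"
proof (rule ccontr)
  assume less: "\<not> ?thesis"
  have "norm (adj a) * norm (adj a) \<le> norm a * norm (adj a)"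
    using cstar_identity[of "adj a"] norm_mult_ineq[of a "adj a"]
    by (simp add: adj_adj power2_eq_square)
  then have "norm (adj a) \<le> norm a \<or> norm (adj a) \<le> 0" by (auto simp: mult_le_cancel_right)
  then show False using less norm_ge_zero[of a] by linarith
qed

lemma norm_adj [simp]: "norm (adj a) = norm (a::'a::cstar_algebra)"
  by (metis adj_adj norm_adj_le order_antisym)

lemma norm_isometry:
  assumes "adj u * u = (1::'a::cstar_algebra)"
  shows "norm u = 1"
proof -
  have "(norm u)\<^sup>2 = 1\<^sup>2" using cstar_identity[of u] assms by simp
  then show ?thesis by (simp only: power2_eq_iff_nonneg norm_ge_zero zero_le_one)
qed

text \<open>Assuming only an isometry means that a single product has to be computed for each
  clock-and-shift element in the averaging argument below.\<close>

lemma norm_conj_isometry_le: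
  assumes "adj u * u = (1::'a::cstar_algebra)"
  shows "norm (u * a * adj u) \<le> norm a"
proof -
  have "norm (u * a * adj u) \<le> norm u * norm a * norm (adj u)"
    by (meson norm_mult_ineq order_trans mult_right_mono norm_ge_zero)
  then show ?thesis using norm_isometry[OF assms] by simp
qed

section \<open>Star subalgebras and commutants\<close>

lemma star_subalgebraD:
  assumes "star_subalgebra B"
  shows "1 \<in> B" "a \<in> B \<Longrightarrow> b \<in> B \<Longrightarrow> a + b \<in> B" "a \<in> B \<Longrightarrow> b \<in> B \<Longrightarrow> a * b \<in> B"
    "a \<in> B \<Longrightarrow> c *\<^sub>C a \<in> B" "a \<in> B \<Longrightarrow> adj a \<in> B"
  using assms unfolding star_subalgebra_def by auto

lemma star_subalgebra_zero: "star_subalgebra B \<Longrightarrow> 0 \<in> B"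
  using star_subalgebraD(1)[of B] star_subalgebraD(4)[of B 1 0] by simp

lemma star_subalgebra_sum:
  "star_subalgebra B \<Longrightarrow> (\<And>i. i \<in> I \<Longrightarrow> f i \<in> B) \<Longrightarrow> (\<Sum>i\<in>I. f i) \<in> B"
  by (induction I rule: infinite_finite_induct)
    (auto simp: star_subalgebra_zero star_subalgebraD)

lemma star_subalgebra_Int: "star_subalgebra B \<Longrightarrow> star_subalgebra C \<Longrightarrow> star_subalgebra (B \<inter> C)"
  by (auto simp: star_subalgebra_def)

lemma star_subalgebra_hull [simp]: "star_subalgebra (star_subalgebra hull S)"
  by (rule hull_in) (auto simp: star_subalgebra_def)

definition commutant :: "'a::cstar_algebra set \<Rightarrow> 'a set" where
  "commutant S = {a. \<forall>b\<in>S. a * b = b * a}"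

lemma commutantD: "a \<in> commutant S \<Longrightarrow> b \<in> S \<Longrightarrow> a * b = b * a"
  by (simp add: commutant_def)

lemma star_subalgebra_commutant:
  assumes "\<And>b. b \<in> S \<Longrightarrow> adj b \<in> S"
  shows "star_subalgebra (commutant S)"
proof -
  have "adj a * b = b * adj a" if "\<forall>b\<in>S. a * b = b * a" "b \<in> S" for a b
    using that assms by (metis adj_adj adj_mult)
  moreover have "a * c * b = b * (a * c)" if "\<forall>b\<in>S. a * b = b * a" "\<forall>b\<in>S. c * b = b * c" "b \<in> S" for a b c
    using that by (metis mult.assoc)
  ultimately show ?thesis
    unfolding star_subalgebra_def commutant_def
    by (auto simp: algebra_simps mult_scaleC_left mult_scaleC_right)
qed

lemma hull_subset_commutant:
  assumes "S \<subseteq> commutant X" "\<And>b. b \<in> X \<Longrightarrow> adj b \<in> X"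
  shows "star_subalgebra hull S \<subseteq> commutant X"
  using assms by (intro hull_minimal star_subalgebra_commutant) auto

section \<open>Star automorphisms and conjugation by unitaries\<close>

lemma star_automorphismD:
  assumes "star_automorphism \<alpha>"
  shows "bij \<alpha>" "\<alpha> 1 = 1" "\<alpha> (a + b) = \<alpha> a + \<alpha> b" "\<alpha> (a * b) = \<alpha> a * \<alpha> b"
    "\<alpha> (c *\<^sub>C a) = c *\<^sub>C \<alpha> a" "\<alpha> (adj a) = adj (\<alpha> a)"
  using assms by (auto simp: star_automorphism_def)

lemma star_automorphism_zero: "star_automorphism \<alpha> \<Longrightarrow> \<alpha> 0 = 0"
  using star_automorphismD(3)[of \<alpha> 0 0] by simp

lemma star_automorphism_sum:
  "star_automorphism \<alpha> \<Longrightarrow> \<alpha> (\<Sum>i\<in>I. f i) = (\<Sum>i\<in>I. \<alpha> (f i))"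
  by (induction I rule: infinite_finite_induct)
    (auto simp: star_automorphism_zero star_automorphismD)

lemma star_automorphism_id: "star_automorphism id"
  by (simp add: star_automorphism_def)

lemma star_automorphism_comp:
  "star_automorphism \<alpha> \<Longrightarrow> star_automorphism \<beta> \<Longrightarrow> star_automorphism (\<alpha> \<circ> \<beta>)"
  by (simp add: star_automorphism_def bij_comp)

lemma star_automorphism_inv:
  assumes "star_automorphism \<alpha>"
  shows "star_automorphism (inv \<alpha>)"
proof -
  have b: "bij \<alpha>" using star_automorphismD(1)[OF assms] .
  then have i: "\<alpha> (inv \<alpha> a) = a" "inv \<alpha> (\<alpha> a) = a" for a
    by (auto simp: bij_is_inj bij_is_surj surj_f_inv_f)
  have e: "inv \<alpha> a = b" if "a = \<alpha> b" for a b using that i by simp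
  show ?thesis
    unfolding star_automorphism_def
    by (auto intro!: e bij_imp_bij_inv[OF b] simp: star_automorphismD[OF assms] i)
qed

lemma star_automorphism_funpow: "star_automorphism \<alpha> \<Longrightarrow> star_automorphism (\<alpha> ^^ n)"
  by (induction n) (auto simp: star_automorphism_id star_automorphism_comp)

lemma star_subalgebra_vimage:
  assumes "star_automorphism \<alpha>" "star_subalgebra B"
  shows "star_subalgebra (\<alpha> -` B)"
  using assms(2) by (auto simp: star_automorphismD[OF assms(1)] star_subalgebra_def)

lemma star_subalgebra_image:
  assumes "star_automorphism \<alpha>" "star_subalgebra B"
  shows "star_subalgebra (\<alpha> ` B)"
proof -
  have "\<alpha> ` B = inv \<alpha> -` B"
    using bij_vimage_eq_inv_image[of "inv \<alpha>" B] star_automorphismD(1)[OF assms(1)]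
    by (simp add: bij_imp_bij_inv inv_inv_eq)
  then show ?thesis
    using star_subalgebra_vimage[OF star_automorphism_inv[OF assms(1)] assms(2)] by simp
qed

lemma hull_image:
  assumes "star_automorphism \<alpha>"
  shows "\<alpha> ` (star_subalgebra hull S) = star_subalgebra hull (\<alpha> ` S)"
proof
  have "star_subalgebra hull S \<subseteq> \<alpha> -` (star_subalgebra hull (\<alpha> ` S))"
    by (intro hull_minimal star_subalgebra_vimage assms star_subalgebra_hull)
      (auto intro: hull_inc)
  then show "\<alpha> ` (star_subalgebra hull S) \<subseteq> star_subalgebra hull (\<alpha> ` S)" by blast
  show "star_subalgebra hull (\<alpha> ` S) \<subseteq> \<alpha> ` (star_subalgebra hull S)"
    by (intro hull_minimal star_subalgebra_image assms star_subalgebra_hull image_mono hull_subset)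
qed

lemma conj_by_star_automorphism:
  assumes "is_unitary u"
  shows "star_automorphism (conj_by u)"
proof -
  have u: "adj u * u = 1" "u * adj u = 1" using assms by (auto simp: is_unitary_def)
  then have u': "adj u * (u * a) = a" "u * (adj u * a) = a" for a
    by (metis mult.assoc mult_1_left)+
  have "bij (conj_by u)"
    by (rule bij_betw_byWitness[where f' = "conj_by (adj u)"])
      (auto simp: conj_by_def adj_adj mult.assoc u u')
  then show ?thesis
    unfolding star_automorphism_def
    by (auto simp: conj_by_def adj_adj adj_mult mult.assoc u u' algebra_simps mult_scaleC_left mult_scaleC_right)
qed

text \<open>In the Heisenberg picture the order of the factors reverses; this fixes the order of the
  unitaries in the ring decomposition.\<close>

lemma conj_by_mult: "conj_by (u * v) = conj_by v \<circ> conj_by u"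
  by (auto simp: conj_by_def adj_mult mult.assoc fun_eq_iff)

lemma is_unitary_mult: "is_unitary u \<Longrightarrow> is_unitary v \<Longrightarrow> is_unitary (u * v)"
  unfolding is_unitary_def adj_mult by (metis mult.assoc mult_1_left)

lemma is_unitary_one [simp]: "is_unitary 1" by (simp add: is_unitary_def)

lemma is_unitary_adj: "is_unitary u \<Longrightarrow> is_unitary (adj u)"
  by (simp add: is_unitary_def adj_adj)

lemma norm_conj_by:
  assumes "is_unitary u"
  shows "norm (conj_by u a) = norm a"
proof (rule antisym)
  have u: "adj u * u = 1" "u * adj u = 1" using assms by (auto simp: is_unitary_def)
  show "norm (conj_by u a) \<le> norm a"
    using norm_conj_isometry_le[of "adj u" a] u by (simp add: conj_by_def adj_adj)
  have "u * conj_by u a * adj u = a"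
    using u by (metis conj_by_def mult.assoc mult_1_left mult_1_right)
  then show "norm a \<le> norm (conj_by u a)"
    using norm_conj_isometry_le[of u "conj_by u a"] u by simp
qed

section \<open>Matrix units\<close>

text \<open>The units add up to the unit of the ambient algebra, so they span a unital copy of a
  full matrix algebra. The index type is free because pairs index product systems and algebra
  elements index orthonormal bases later on.\<close>

locale matrix_units =
  fixes I :: "'i set" and e :: "'i \<Rightarrow> 'i \<Rightarrow> 'a::cstar_algebra"
  assumes finite: "finite I"
    and mult: "\<And>i j k l. i \<in> I \<Longrightarrow> j \<in> I \<Longrightarrow> k \<in> I \<Longrightarrow> l \<in> I \<Longrightarrow>
      e i j * e k l = (if j = k then e i l else 0)"
    and adjoint: "\<And>i j. i \<in> I \<Longrightarrow> j \<in> I \<Longrightarrow> adj (e i j) = e j i"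
    and sum_diag: "(\<Sum>i\<in>I. e i i) = 1"
begin

definition combo :: "('i \<Rightarrow> 'i \<Rightarrow> complex) \<Rightarrow> 'a" where
  "combo c = (\<Sum>i\<in>I. \<Sum>j\<in>I. c i j *\<^sub>C e i j)"

definition units_span :: "'a set" where "units_span = range combo"

text \<open>View the ambient algebra as matrices with entries in the commutant of the units: this is
  the \<open>(i, j)\<close> entry of \<open>a\<close>. It commutes with all units, and
  \<open>expansion\<close> rebuilds \<open>a\<close> from its entries.\<close>

definition component :: "'a \<Rightarrow> 'i \<Rightarrow> 'i \<Rightarrow> 'a" where
  "component a i j = (\<Sum>k\<in>I. e k i * a * e j k)"

lemma mult_assoc: "i \<in> I \<Longrightarrow> j \<in> I \<Longrightarrow> k \<in> I \<Longrightarrow> l \<in> I \<Longrightarrow>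
    e i j * (e k l * a) = (if j = k then e i l * a else 0)"
  by (simp add: mult mult.assoc[symmetric])

lemma nonempty: "I \<noteq> {}"
  using sum_diag by auto

lemma unit_mult_combo:
  assumes "i \<in> I" "j \<in> I"
  shows "e i j * combo d = (\<Sum>l\<in>I. d j l *\<^sub>C e i l)"
proof -
  have "e i j * combo d = (\<Sum>k\<in>I. if j = k then \<Sum>l\<in>I. d k l *\<^sub>C e i l else 0)"
    using assms unfolding combo_def sum_distrib_left mult_scaleC_right
    by (intro sum.cong refl) (auto simp: mult)
  then show ?thesis using assms finite by (simp add: sum.delta')
qed

lemma combo_mult: "combo c * combo d = combo (\<lambda>i l. \<Sum>k\<in>I. c i k * d k l)"
proof -
  have "combo c * combo d = (\<Sum>i\<in>I. \<Sum>j\<in>I. c i j *\<^sub>C (e i j * combo d))"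
    by (simp add: combo_def[of c] sum_distrib_right mult_scaleC_left)
  also have "\<dots> = (\<Sum>i\<in>I. \<Sum>j\<in>I. \<Sum>l\<in>I. (c i j * d j l) *\<^sub>C e i l)"
    by (intro sum.cong refl) (simp add: unit_mult_combo scaleC_sum_right scaleC_scaleC)
  also have "\<dots> = (\<Sum>i\<in>I. \<Sum>l\<in>I. \<Sum>j\<in>I. (c i j * d j l) *\<^sub>C e i l)"
    by (intro sum.cong refl sum.swap)
  finally show ?thesis by (simp add: combo_def scaleC_sum_left)
qed

lemma combo_add: "combo c + combo d = combo (\<lambda>i j. c i j + d i j)"
  by (simp add: combo_def scaleC_add_left sum.distrib)

lemma combo_diff: "combo c - combo d = combo (\<lambda>i j. c i j - d i j)"
  by (simp add: combo_def scaleC_diff_left sum_subtractf)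

lemma combo_scaleC: "x *\<^sub>C combo c = combo (\<lambda>i j. x * c i j)"
  by (simp add: combo_def scaleC_sum_right scaleC_scaleC)

lemma combo_adj: "adj (combo c) = combo (\<lambda>i j. cnj (c j i))"
proof -
  have "adj (combo c) = (\<Sum>i\<in>I. \<Sum>j\<in>I. cnj (c i j) *\<^sub>C e j i)"
    by (simp add: combo_def adj_sum adj_scaleC adjoint)
  also have "\<dots> = (\<Sum>j\<in>I. \<Sum>i\<in>I. cnj (c i j) *\<^sub>C e j i)"
    by (rule sum.swap)
  finally show ?thesis by (simp add: combo_def)
qed

lemma combo_one: "combo (\<lambda>i j. of_bool (i = j)) = 1"
proof -
  have "(\<Sum>j\<in>I. of_bool (i = j) *\<^sub>C e i j) = e i i" if "i \<in> I" for i
  proof -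
    have "(\<Sum>j\<in>I. of_bool (i = j) *\<^sub>C e i j) = (\<Sum>j\<in>I. if i = j then e i j else 0)"
      by (intro sum.cong) auto
    then show ?thesis using that finite by simp
  qed
  then show ?thesis by (simp add: combo_def sum_diag)
qed

lemma combo_unit:
  assumes "k \<in> I" "l \<in> I"
  shows "combo (\<lambda>i j. of_bool (i = k \<and> j = l)) = e k l"
proof -
  have "combo (\<lambda>i j. of_bool (i = k \<and> j = l)) = (\<Sum>i\<in>I. \<Sum>j\<in>I. if j = l then if i = k then e i j else 0 else 0)"
    unfolding combo_def by (intro sum.cong) auto
  then show ?thesis using assms finite by simp
qed

lemma component_combo:
  assumes "i \<in> I" "j \<in> I"
  shows "component (combo c) i j = c i j *\<^sub>C 1"
proof -
  have "e k i * combo c * e j k = c i j *\<^sub>C e k k" if "k \<in> I" for k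
  proof -
    have "e k i * combo c * e j k = (\<Sum>l\<in>I. if l = j then c i l *\<^sub>C e k k else 0)"
      using that assms by (auto simp: unit_mult_combo sum_distrib_right mult_scaleC_left mult intro!: sum.cong)
    then show ?thesis using assms finite by simp
  qed
  then show ?thesis
    by (simp add: component_def sum_diag flip: scaleC_sum_right)
qed

lemma combo_eqD: "combo c = combo d \<Longrightarrow> i \<in> I \<Longrightarrow> j \<in> I \<Longrightarrow> c i j = d i j"
  using component_combo[of i j c] component_combo[of i j d]
  by (metis eq_iff_diff_eq_0 scaleC_diff_left scaleC_eq_0_iff zero_neq_one)

lemma component_commutes:
  assumes "i \<in> I" "j \<in> I" "k \<in> I" "l \<in> I"
  shows "e k l * component a i j = component a i j * e k l"
proof -
  have "e k l * component a i j = (\<Sum>m\<in>I. if l = m then e k i * a * e j l else 0)"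
    unfolding component_def sum_distrib_left mult.assoc[symmetric]
    using assms by (intro sum.cong) (auto simp: mult)
  moreover have "component a i j * e k l = (\<Sum>m\<in>I. if m = k then e k i * a * e j l else 0)"
    unfolding component_def sum_distrib_right mult.assoc
    using assms by (intro sum.cong) (auto simp: mult)
  ultimately show ?thesis using assms finite by simp
qed

lemma expansion: "(\<Sum>i\<in>I. \<Sum>j\<in>I. e i j * component a i j) = a"
proof -
  have "e i j * component a i j = e i i * a * e j j" if "i \<in> I" "j \<in> I" for i j
  proof -
    have "e i j * component a i j = (\<Sum>m\<in>I. if j = m then e i i * a * e j j else 0)"
      unfolding component_def sum_distrib_left mult.assoc[symmetric]
      using that by (intro sum.cong) (auto simp: mult)
    then show ?thesis using that finite by simp
  qed
  then have "(\<Sum>i\<in>I. \<Sum>j\<in>I. e i j * component a i j) = (\<Sum>i\<in>I. \<Sum>j\<in>I. e i i * a * e j j)"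
    by simp
  also have "\<dots> = (\<Sum>i\<in>I. e i i) * a * (\<Sum>j\<in>I. e j j)"
    by (subst sum.swap) (simp only: sum_distrib_right sum_distrib_left)
  finally show ?thesis by (simp add: sum_diag)
qed

lemma star_subalgebra_units_span: "star_subalgebra units_span"
  unfolding star_subalgebra_def units_span_def
  by (auto simp: combo_add combo_mult combo_adj combo_scaleC) (metis combo_one rangeI)

lemma unit_in_span: "k \<in> I \<Longrightarrow> l \<in> I \<Longrightarrow> e k l \<in> units_span"
  unfolding units_span_def by (metis combo_unit rangeI)

lemma combo_in: "star_subalgebra B \<Longrightarrow> (\<And>i j. i \<in> I \<Longrightarrow> j \<in> I \<Longrightarrow> e i j \<in> B) \<Longrightarrow> combo c \<in> B"
  unfolding combo_def by (intro star_subalgebra_sum star_subalgebraD(4)) auto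

lemma units_span_subset:
  "star_subalgebra B \<Longrightarrow> (\<And>i j. i \<in> I \<Longrightarrow> j \<in> I \<Longrightarrow> e i j \<in> B) \<Longrightarrow> units_span \<subseteq> B"
  unfolding units_span_def using combo_in by blast

lemma units_span_eq_hull:
  "units_span = star_subalgebra hull {e i j | i j. i \<in> I \<and> j \<in> I}"
proof
  show "units_span \<subseteq> star_subalgebra hull {e i j | i j. i \<in> I \<and> j \<in> I}"
    by (rule units_span_subset) (auto intro: hull_inc)
  show "star_subalgebra hull {e i j | i j. i \<in> I \<and> j \<in> I} \<subseteq> units_span"
    by (intro hull_minimal star_subalgebra_units_span) (auto intro: unit_in_span)
qed

lemma component_in:
  "star_subalgebra B \<Longrightarrow> (\<And>i j. i \<in> I \<Longrightarrow> j \<in> I \<Longrightarrow> e i j \<in> B) \<Longrightarrow> a \<in> B \<Longrightarrow> i \<in> I \<Longrightarrow> j \<in> I \<Longrightarrow>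
    component a i j \<in> B"
  unfolding component_def by (intro star_subalgebra_sum star_subalgebraD(3)) auto

lemma component_commutant_units:
  assumes "i \<in> I" "j \<in> I"
  shows "component a i j \<in> commutant units_span"
proof -
  have "star_subalgebra (commutant {component a i j, adj (component a i j)})"
    by (rule star_subalgebra_commutant) (auto simp: adj_adj)
  moreover have "e k l \<in> commutant {component a i j, adj (component a i j)}" if "k \<in> I" "l \<in> I" for k l
  proof -
    have "adj (e l k * component a i j) = adj (component a i j * e l k)"
      using component_commutes[OF assms that(2,1)] by simp
    then show ?thesis
      using component_commutes[OF assms that] that by (auto simp: commutant_def adj_mult adjoint)
  qed
  ultimately have "units_span \<subseteq> commutant {component a i j, adj (component a i j)}"
    using units_span_subset by blast
  then show ?thesis by (auto simp: commutant_def)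
qed

text \<open>An entry is built from \<open>a\<close> and the units alone, so it commutes with
  whatever they all commute with. This is how entries are later located in particular
  blocks.\<close>

lemma component_commutant:
  assumes "a \<in> commutant S" "units_span \<subseteq> commutant S" "i \<in> I" "j \<in> I"
  shows "component a i j \<in> commutant S"
proof -
  have "component a i j * b = b * component a i j" if "b \<in> S" for b
  proof -
    have "e k i * a * e j k * b = b * (e k i * a * e j k)" if "k \<in> I" for k
    proof -
      have "e k i * b = b * e k i" "e j k * b = b * e j k" "a * b = b * a"
        using assms unit_in_span that \<open>b \<in> S\<close> by (meson commutantD subsetD)+
      then show ?thesis by (metis mult.assoc)
    qed
    then show ?thesis by (simp add: component_def sum_distrib_left sum_distrib_right)
  qed
  then show ?thesis by (simp add: commutant_def)
qed

lemma reindex: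
  assumes "bij_betw f J I"
  shows "matrix_units J (\<lambda>i j. e (f i) (f j))"
proof
  show "finite J" using assms finite by (simp add: bij_betw_finite)
  show "(\<Sum>i\<in>J. e (f i) (f i)) = 1"
    using sum.reindex_bij_betw[OF assms, of "\<lambda>i. e i i"] sum_diag by simp
qed (use assms in \<open>auto simp: mult adjoint bij_betwE bij_betw_def inj_on_def\<close>)

lemma image:
  assumes "star_automorphism \<alpha>"
  shows "matrix_units I (\<lambda>i j. \<alpha> (e i j))"
  using star_automorphismD[OF assms] 
  by unfold_locales (simp_all add: finite adjoint mult star_automorphism_zero[OF assms] sum_diag
      flip: star_automorphismD(4,6)[OF assms] star_automorphism_sum[OF assms])

end

text \<open>A unital copy of a full matrix algebra, that is, a finite-dimensional factor. Indexing
  by an initial segment of the naturals keeps index types out of the predicate.\<close>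

definition factor :: "'a::cstar_algebra set \<Rightarrow> bool" where
  "factor B \<longleftrightarrow> (\<exists>(n::nat) e. matrix_units {..<n} e \<and> B = matrix_units.units_span {..<n} e)"

lemma (in matrix_units) factor: "factor units_span"
proof -
  obtain f where f: "bij_betw f {..<card I} I"
    using ex_bij_betw_nat_finite[OF finite] by (auto simp: lessThan_atLeast0)
  interpret J: matrix_units "{..<card I}" "\<lambda>i j. e (f i) (f j)" by (rule reindex[OF f])
  have "{e i j | i j. i \<in> I \<and> j \<in> I} = (\<lambda>(i, j). e i j) ` (I \<times> I)"
    by auto
  also have "\<dots> = (\<lambda>(i, j). e i j) ` map_prod f f ` ({..<card I} \<times> {..<card I})"
    by (simp only: map_prod_surj_on[OF bij_betw_imp_surj_on[OF f] bij_betw_imp_surj_on[OF f]])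
  also have "\<dots> = {e (f i) (f j) | i j. i \<in> {..<card I} \<and> j \<in> {..<card I}}"
    by (auto simp: image_iff)
  finally have eq: "units_span = J.units_span"
    by (simp only: units_span_eq_hull J.units_span_eq_hull)
  show ?thesis
    unfolding factor_def using eq J.matrix_units_axioms by blast
qed

lemma factorE:
  assumes "factor B"
  obtains n :: nat and e where "matrix_units {..<n} e" "B = matrix_units.units_span {..<n} e"
  using assms unfolding factor_def by blast

lemma factor_star_subalgebra: "factor B \<Longrightarrow> star_subalgebra B"
  unfolding factor_def by (auto simp: matrix_units.star_subalgebra_units_span)

lemma matrix_units_prod:
  assumes "matrix_units I e" "matrix_units J f"
    and comm: "\<And>i j k l. i \<in> I \<Longrightarrow> j \<in> I \<Longrightarrow> k \<in> J \<Longrightarrow> l \<in> J \<Longrightarrow> e i j * f k l = f k l * e i j"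
  shows "matrix_units (I \<times> J) (\<lambda>p q. e (fst p) (fst q) * f (snd p) (snd q))"
proof -
  interpret E: matrix_units I e by fact
  interpret F: matrix_units J f by fact
  show ?thesis
  proof
    show "finite (I \<times> J)" using E.finite F.finite by simp
    have "(\<Sum>p\<in>I \<times> J. e (fst p) (fst p) * f (snd p) (snd p)) = (\<Sum>i\<in>I. e i i) * (\<Sum>j\<in>J. f j j)"
      by (simp add: sum_product sum.cartesian_product case_prod_unfold)
    then show "(\<Sum>p\<in>I \<times> J. e (fst p) (fst p) * f (snd p) (snd p)) = 1"
      by (simp add: E.sum_diag F.sum_diag)
  next
    fix p q assume "p \<in> I \<times> J" "q \<in> I \<times> J"
    then show "adj (e (fst p) (fst q) * f (snd p) (snd q)) = e (fst q) (fst p) * f (snd q) (snd p)"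
      by (auto simp: adj_mult E.adjoint F.adjoint comm)
  next
    fix p q r s assume *: "p \<in> I \<times> J" "q \<in> I \<times> J" "r \<in> I \<times> J" "s \<in> I \<times> J"
    have "e (fst p) (fst q) * f (snd p) (snd q) * (e (fst r) (fst s) * f (snd r) (snd s))
        = (e (fst p) (fst q) * e (fst r) (fst s)) * (f (snd p) (snd q) * f (snd r) (snd s))"
      using comm[of "fst r" "fst s" "snd p" "snd q"] * by (metis mem_Times_iff mult.assoc)
    then show "e (fst p) (fst q) * f (snd p) (snd q) * (e (fst r) (fst s) * f (snd r) (snd s))
        = (if q = r then e (fst p) (fst s) * f (snd p) (snd s) else 0)"
      using * by (auto simp: E.mult F.mult prod_eq_iff)
  qed
qed

lemma units_span_prod:
  assumes "matrix_units I e" "matrix_units J f"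
    and comm: "\<And>i j k l. i \<in> I \<Longrightarrow> j \<in> I \<Longrightarrow> k \<in> J \<Longrightarrow> l \<in> J \<Longrightarrow> e i j * f k l = f k l * e i j"
  shows "matrix_units.units_span (I \<times> J) (\<lambda>p q. e (fst p) (fst q) * f (snd p) (snd q)) =
    star_subalgebra hull (matrix_units.units_span I e \<union> matrix_units.units_span J f)" (is "?L = ?R")
proof
  interpret E: matrix_units I e by fact
  interpret F: matrix_units J f by fact
  interpret P: matrix_units "I \<times> J" "\<lambda>p q. e (fst p) (fst q) * f (snd p) (snd q)"
    by (rule matrix_units_prod) fact+
  show "?L \<subseteq> ?R"
  proof (rule P.units_span_subset)
    fix p q assume "p \<in> I \<times> J" "q \<in> I \<times> J"
    then show "e (fst p) (fst q) * f (snd p) (snd q) \<in> ?R"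
      using E.unit_in_span F.unit_in_span
      by (intro star_subalgebraD(3)[OF star_subalgebra_hull]) (auto intro: hull_inc)
  qed simp
  have "e i j \<in> ?L" if "i \<in> I" "j \<in> I" for i j
  proof -
    \<comment> \<open>The diagonal units of the other system add up to 1, so each unit is a sum of
      product units.\<close>
    have "e i j = (\<Sum>k\<in>J. e i j * f k k)"
      by (simp add: F.sum_diag flip: sum_distrib_left)
    also have "\<dots> \<in> ?L"
      using P.unit_in_span[of "(i, k)" "(j, k)" for k] that
      by (intro star_subalgebra_sum P.star_subalgebra_units_span) auto
    finally show ?thesis .
  qed
  moreover have "f k l \<in> ?L" if "k \<in> J" "l \<in> J" for k l
  proof -
    have "f k l = (\<Sum>i\<in>I. e i i * f k l)"
      by (simp add: E.sum_diag flip: sum_distrib_right)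
    also have "\<dots> \<in> ?L"
      using P.unit_in_span[of "(i, k)" "(i, l)" for i] that
      by (intro star_subalgebra_sum P.star_subalgebra_units_span) auto
    finally show ?thesis .
  qed
  ultimately show "?R \<subseteq> ?L"
    by (intro hull_minimal P.star_subalgebra_units_span Un_least
        E.units_span_subset F.units_span_subset)
qed

lemma factor_hull_Un:
  assumes "factor B" "factor C" "B \<subseteq> commutant C"
  shows "factor (star_subalgebra hull (B \<union> C))"
proof -
  obtain m e where e: "matrix_units {..<m::nat} e" "B = matrix_units.units_span {..<m} e"
    using assms(1) by (rule factorE)
  obtain n f where f: "matrix_units {..<n::nat} f" "C = matrix_units.units_span {..<n} f"
    using assms(2) by (rule factorE)
  have comm: "e i j * f k l = f k l * e i j" if "i \<in> {..<m}" "j \<in> {..<m}" "k \<in> {..<n}" "l \<in> {..<n}" for i j k l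
    using assms(3) that matrix_units.unit_in_span[OF e(1), of i j] matrix_units.unit_in_span[OF f(1), of k l]
    unfolding e(2)[symmetric] f(2)[symmetric] by (auto intro: commutantD)
  show ?thesis
    using matrix_units.factor[OF matrix_units_prod[OF e(1) f(1) comm]]
      units_span_prod[OF e(1) f(1) comm] e(2) f(2) by simp
qed

lemma factor_image:
  assumes "star_automorphism \<alpha>" "factor B"
  shows "factor (\<alpha> ` B)"
proof -
  obtain n e where e: "matrix_units {..<n::nat} e" and B: "B = matrix_units.units_span {..<n} e"
    using assms(2) by (rule factorE)
  interpret E: matrix_units "{..<n}" e by fact
  interpret F: matrix_units "{..<n}" "\<lambda>i j. \<alpha> (e i j)" by (rule E.image) fact
  have "\<alpha> ` {e i j | i j. i \<in> {..<n} \<and> j \<in> {..<n}} = {\<alpha> (e i j) | i j. i \<in> {..<n} \<and> j \<in> {..<n}}"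
    by blast
  then have "\<alpha> ` B = F.units_span"
    unfolding B E.units_span_eq_hull F.units_span_eq_hull by (simp only: hull_image[OF assms(1)])
  then show ?thesis using F.factor by simp
qed

section \<open>Trace, positivity and the Skolem-Noether theorem\<close>

context matrix_units
begin

text \<open>The squared Hilbert-Schmidt norm, that is, the unnormalised trace of
  \<open>adj (combo c) * combo c\<close>.\<close>

definition coeff_norm :: "('i \<Rightarrow> 'i \<Rightarrow> complex) \<Rightarrow> real" where
  "coeff_norm c = (\<Sum>i\<in>I. \<Sum>k\<in>I. (cmod (c k i))\<^sup>2)"

lemma coeff_norm_complex: "(\<Sum>i\<in>I. \<Sum>k\<in>I. cnj (c k i) * c k i) = of_real (coeff_norm c)"
  by (simp add: coeff_norm_def complex_norm_square mult.commute del: of_real_power)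

lemma coeff_norm_nonneg: "coeff_norm c \<ge> 0"
  by (simp add: coeff_norm_def sum_nonneg)

lemma coeff_norm_eq_0: "coeff_norm c = 0 \<Longrightarrow> combo c = 0"
  using finite by (simp add: coeff_norm_def combo_def sum_nonneg_eq_0_iff sum_nonneg)

text \<open>Comparing the traces of both sides makes \<open>x\<close> a quotient of two squared
  Hilbert-Schmidt norms. Its square root then serves to normalise partial isometries and
  vectors.\<close>

lemma positive_scalar:
  assumes "y \<in> units_span" "g \<in> units_span" "adj y * y = x *\<^sub>C (adj g * g)" "y \<noteq> 0"
  obtains r where "r > 0" "x = complex_of_real r"
proof -
  obtain c d where y: "y = combo c" and g: "g = combo d"
    using assms(1,2) by (auto simp: units_span_def)
  have "(\<Sum>k\<in>I. cnj (c k i) * c k i) = x * (\<Sum>k\<in>I. cnj (d k i) * d k i)" if "i \<in> I" for i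
    using combo_eqD[OF assms(3)[unfolded y g combo_adj combo_mult combo_scaleC] that that] by simp
  then have "complex_of_real (coeff_norm c) = x * of_real (coeff_norm d)"
    by (simp add: sum_distrib_left flip: coeff_norm_complex)
  moreover have "coeff_norm c > 0"
    using assms(4) y coeff_norm_nonneg[of c] coeff_norm_eq_0[of c] by fastforce
  ultimately have "coeff_norm d \<noteq> 0" "x = complex_of_real (coeff_norm c / coeff_norm d)"
    by (auto simp: field_simps)
  then show ?thesis
    using that[of "coeff_norm c / coeff_norm d"] \<open>coeff_norm c > 0\<close> coeff_norm_nonneg[of d] by simp
qed

text \<open>The trace of the projection \<open>1 - u u\<^sup>*\<close> vanishes.\<close>

lemma isometry_imp_unitary:
  assumes "u \<in> units_span" "adj u * u = 1"
  shows "is_unitary u"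
proof -
  obtain c where u: "u = combo c" using assms(1) by (auto simp: units_span_def)
  define d where "d = (\<lambda>i j. of_bool (i = j) - (\<Sum>k\<in>I. c i k * cnj (c j k)))"
  have w: "1 - u * adj u = combo d"
    by (simp add: u combo_adj combo_mult combo_diff d_def flip: combo_one)
  have "adj (1 - u * adj u) * (1 - u * adj u) = 1 - u * adj u - u * adj u + u * (adj u * u) * adj u"
    by (simp add: adj_diff adj_mult adj_adj algebra_simps)
  then have "adj (combo d) * combo d = combo d"
    unfolding w[symmetric] by (simp add: assms(2))
  \<comment> \<open>For a projection \<open>d\<close> the diagonal entries are those of
    \<open>adj d * d\<close>, so the trace equals \<open>coeff_norm d\<close>; once it is zero,
    \<open>d\<close> vanishes.\<close>
  then have diag: "(\<Sum>k\<in>I. cnj (d k i) * d k i) = d i i" if "i \<in> I" for i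
    using combo_eqD[OF _ that that] by (simp add: combo_adj combo_mult)
  have iso: "(\<Sum>k\<in>I. cnj (c k i) * c k i) = 1" if "i \<in> I" for i
    using combo_eqD[OF assms(2)[unfolded u combo_adj combo_mult combo_one[symmetric]] that that] by simp
  have "(\<Sum>i\<in>I. \<Sum>k\<in>I. c i k * cnj (c i k)) = (\<Sum>k\<in>I. \<Sum>i\<in>I. cnj (c i k) * c i k)"
    by (subst sum.swap) (simp add: mult.commute)
  then have "(\<Sum>i\<in>I. d i i) = 0"
    by (simp add: d_def sum_subtractf iso)
  then have "complex_of_real (coeff_norm d) = 0"
    by (simp add: diag flip: coeff_norm_complex)
  then have "combo d = 0" by (intro coeff_norm_eq_0) simp
  then show ?thesis using assms(2) w by (simp add: is_unitary_def)
qed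

lemma unit_combo_unit:
  assumes "i \<in> I" "j \<in> I" "k \<in> I" "l \<in> I"
  shows "e k i * combo c * e j l = c i j *\<^sub>C e k l"
proof -
  have "e k i * combo c * e j l = (\<Sum>m\<in>I. if m = j then c i m *\<^sub>C e k l else 0)"
    using assms by (auto simp: unit_mult_combo sum_distrib_right mult_scaleC_left mult intro!: sum.cong)
  then show ?thesis using assms finite by simp
qed

lemma unit_nonzero:
  assumes "i \<in> I" "j \<in> I"
  shows "e i j \<noteq> 0"
proof
  assume "e i j = 0"
  then have "e k k = 0" if "k \<in> I" for k
    using mult[of k i i k] mult_assoc[of k i i j "e j k"] mult[of i j j k] that assms by auto
  then show False using sum_diag by simp
qed

text \<open>A partial isometry \<open>v\<close> from \<open>e z z\<close> into \<open>f z z\<close>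
  is transported along the units to an intertwiner \<open>w\<close> with
  \<open>w * e i j = f i j * w\<close>. It is an isometry in a matrix algebra, hence unitary. As
  \<open>conj_by\<close> puts the adjoint on the left, the required unitary is
  \<open>adj w\<close>.\<close>

theorem skolem_noether:
  assumes "matrix_units I f" and f_in: "\<And>i j. i \<in> I \<Longrightarrow> j \<in> I \<Longrightarrow> f i j \<in> units_span"
  obtains u where "u \<in> units_span" "is_unitary u"
    "\<And>i j. i \<in> I \<Longrightarrow> j \<in> I \<Longrightarrow> conj_by u (e i j) = f i j"
proof -
  interpret F: matrix_units I f by fact
  obtain z where z: "z \<in> I" using nonempty by blast
  obtain c where c: "f z z = combo c" using f_in[OF z z] by (auto simp: units_span_def)
  have ff: "f z z * (f z z * a) = f z z * a" for a using F.mult_assoc[of z z z z a] z by simp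
  have "\<exists>k\<in>I. f z z * e k z \<noteq> 0"
  proof (rule ccontr)
    assume "\<not> ?thesis"
    then have "f z z * e k k = 0" if "k \<in> I" for k
      using mult[of k z z k] z that by (metis mult.assoc mult_zero_left)
    then have "f z z * (\<Sum>k\<in>I. e k k) = 0" by (simp add: sum_distrib_left)
    then show False using F.unit_nonzero[OF z z] by (simp add: sum_diag)
  qed
  then obtain k where k: "k \<in> I" "f z z * e k z \<noteq> 0" by blast
  \<comment> \<open>The product is \<open>e z k * f z z * e k z\<close>, which is a multiple of
    \<open>e z z\<close> by a diagonal coefficient of \<open>f z z\<close>. Being of the form
    \<open>adj y * y\<close> with \<open>y\<close> nonzero forces this coefficient to be positive,
    so dividing by its root normalises the partial isometry.\<close>
  have sq: "adj (f z z * e k z) * (f z z * e k z) = c k k *\<^sub>C (adj (e z z) * e z z)"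
    using z k unit_combo_unit[of k k z z c]
    by (simp add: adj_mult adjoint F.adjoint mult mult.assoc ff) (simp add: c mult.assoc)
  moreover have "f z z * e k z \<in> units_span"
    using f_in z k unit_in_span by (intro star_subalgebraD(3)[OF star_subalgebra_units_span]) auto
  ultimately obtain r where r: "r > 0" "c k k = complex_of_real r"
    using positive_scalar k unit_in_span[OF z z] by metis
  define v where "v = complex_of_real (1 / sqrt r) *\<^sub>C (f z z * e k z)"
  have "complex_of_real (1 / sqrt r) * (complex_of_real (1 / sqrt r) * complex_of_real r) = complex_of_real (1 / sqrt r * (1 / sqrt r * r))"
    by (simp only: of_real_mult)
  also have "1 / sqrt r * (1 / sqrt r * r) = 1"
    using r(1) by (simp add: field_simps)
  finally have vv: "adj v * v = e z z"
    using z by (simp add: v_def adj_scaleC mult_scaleC_left mult_scaleC_right scaleC_scaleC sq r adjoint mult)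
  have fv: "f z z * v = v" by (simp add: v_def mult_scaleC_right ff)
  define w where "w = (\<Sum>i\<in>I. f i z * v * e z i)"
  have w_in: "w \<in> units_span"
    unfolding w_def v_def using f_in z k unit_in_span
    by (intro star_subalgebra_sum star_subalgebraD(3)[OF star_subalgebra_units_span]
        star_subalgebraD(4)[OF star_subalgebra_units_span]) (auto simp: star_subalgebra_units_span)
  have "adj w * w = (\<Sum>i\<in>I. \<Sum>j\<in>I. (e i z * adj v * f z i) * (f j z * v * e z j))"
    using z by (simp add: w_def adj_sum adj_mult adjoint F.adjoint sum_product mult.assoc)
  also have "\<dots> = (\<Sum>i\<in>I. \<Sum>j\<in>I. if i = j then e i i else 0)"
  proof (intro sum.cong refl)
    fix i j assume ij: "i \<in> I" "j \<in> I"
    have "(e i z * adj v * f z i) * (f j z * v * e z j) = e i z * adj v * (f z i * (f j z * (v * e z j)))"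
      by (simp add: mult.assoc)
    also have "\<dots> = (if i = j then e i z * (adj v * (f z z * v) * e z j) else 0)"
      using ij z by (simp add: F.mult_assoc mult.assoc)
    also have "\<dots> = (if i = j then e i i else 0)"
      unfolding fv vv using ij z by (simp add: mult)
    finally show "(e i z * adj v * f z i) * (f j z * v * e z j) = (if i = j then e i i else 0)" .
  qed
  also have "\<dots> = 1" using finite by (simp add: sum_diag)
  finally have "is_unitary w" by (rule isometry_imp_unitary[OF w_in])
  moreover have "w * e i j = f i j * w" if ij: "i \<in> I" "j \<in> I" for i j
  proof -
    have "w * e i j = (\<Sum>k\<in>I. if k = i then f i z * v * e z j else 0)"
      unfolding w_def sum_distrib_right using ij z by (intro sum.cong refl) (simp add: mult mult.assoc)
    moreover have "f i j * w = (\<Sum>k\<in>I. if j = k then f i z * v * e z j else 0)"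
      unfolding w_def sum_distrib_left using ij z by (intro sum.cong refl) (simp add: F.mult_assoc mult.assoc)
    ultimately show ?thesis using ij finite by simp
  qed
  ultimately have "conj_by (adj w) (e i j) = f i j" if "i \<in> I" "j \<in> I" for i j
    using that by (simp add: conj_by_def adj_adj is_unitary_def mult.assoc)
  then show ?thesis
    using that[of "adj w"] \<open>is_unitary w\<close> w_in star_subalgebraD(5)[OF star_subalgebra_units_span]
    by (simp add: is_unitary_adj)
qed

end

text \<open>Injectivity of multiplication: the entries of \<open>\<Sum>i<n. p i * q i\<close> with
  respect to the units of \<open>P\<close> are combinations of the \<open>q i\<close> with scalar
  entries of the \<open>p i\<close> as coefficients. Independence of the \<open>q i\<close> makes
  all these entries vanish.\<close>

lemma tensor_factorsI:
  assumes "factor P" "star_subalgebra Q" "P \<subseteq> commutant Q"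
  shows "tensor_factors (star_subalgebra hull (P \<union> Q)) P Q"
proof -
  obtain m e where e: "matrix_units {..<m::nat} e" and P: "P = matrix_units.units_span {..<m} e"
    using assms(1) by (rule factorE)
  interpret E: matrix_units "{..<m}" e by fact
  have "p i = 0" if pq: "\<forall>i<n. p i \<in> P \<and> q i \<in> Q"
    and indep: "\<forall>c. (\<Sum>i<n. c i *\<^sub>C q i) = 0 \<longrightarrow> (\<forall>i<n. c i = 0)"
    and zero: "(\<Sum>i<n. p i * q i) = 0" and "i < n" for n :: nat and p q i
  proof -
    have "\<forall>i. \<exists>c. i < n \<longrightarrow> p i = E.combo c" using pq by (auto simp: P E.units_span_def)
    then obtain c where c: "\<And>i. i < n \<Longrightarrow> p i = E.combo (c i)" by metis
    have "c i k l = 0" if kl: "k < m" "l < m" for k l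
    proof -
      have "E.component (p j * q j) k l = c j k l *\<^sub>C q j" if j: "j < n" for j
      proof -
        have "e a b * q j = q j * e a b" if "a < m" "b < m" for a b
          using assms(3) E.unit_in_span[of a b] pq j that unfolding P
          by (intro commutantD[where S = Q]) auto
        then have "E.component (p j * q j) k l = E.component (p j) k l * q j"
          using kl unfolding E.component_def sum_distrib_right
          by (intro sum.cong refl) (simp add: mult.assoc)
        then show ?thesis using kl j by (simp add: c E.component_combo mult_scaleC_left)
      qed
      moreover have "E.component (\<Sum>j<n. p j * q j) k l = (\<Sum>j<n. E.component (p j * q j) k l)"
        unfolding E.component_def by (subst sum.swap) (simp add: sum_distrib_left sum_distrib_right)
      ultimately have "(\<Sum>j<n. c j k l *\<^sub>C q j) = 0"
        using zero by (simp add: E.component_def)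
      then show ?thesis using indep[rule_format, of "\<lambda>j. c j k l"] \<open>i < n\<close> by blast
    qed
    then show ?thesis using \<open>i < n\<close> by (simp add: c E.combo_def)
  qed
  then show ?thesis
    using assms factor_star_subalgebra unfolding tensor_factors_def
    by (auto simp: commutant_def subset_iff)
qed

subsection \<open>Averaging over a matrix algebra\<close>

text \<open>Orthogonality of the characters of a cyclic group: off the diagonal this is a geometric
  sum whose ratio is an \<open>n\<close>-th root of unity different from 1.\<close>

lemma sum_power_root_of_unity:
  fixes n i j :: nat
  assumes "i < n" "j < n"
  defines "w \<equiv> \<lambda>k. cis (2 * pi * real k / real n)"
  shows "(\<Sum>k<n. (w i * cnj (w j)) ^ k) = of_bool (i = j) * of_nat n"
proof (cases "i = j")
  case True
  then show ?thesis by (simp add: w_def cis_cnj cis_mult)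
next
  case False
  have n: "n > 0" using assms by simp
  have "inj_on w {..<n}" using Complex.bij_betw_roots_unity[OF n] by (simp add: w_def bij_betw_def)
  then have ne: "w i \<noteq> w j" using assms False by (auto dest: inj_onD)
  have root: "w k ^ n = 1" if "k < n" for k
    using bij_betwE[OF Complex.bij_betw_roots_unity[OF n]] that by (auto simp: w_def)
  have "w j * cnj (w j) = 1" by (simp add: w_def cis_cnj cis_mult)
  then have "w i * cnj (w j) \<noteq> 1"
    using ne by (metis mult.assoc mult.commute mult_1_left)
  moreover have "(w i * cnj (w j)) ^ n = 1"
    by (simp only: power_mult_distrib root assms(1,2) complex_cnj_one mult_1 flip: complex_cnj_power)
  ultimately show ?thesis using False by (simp add: geometric_sum)
qed

text \<open>Up to the factor \<open>n\<close>, the average is taken over the \<open>n\<^sup>2\<close> clock-and-shift unitaries.\<close>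

lemma norm_average_le:
  fixes n :: nat
  assumes "matrix_units {..<n} e"
  shows "norm (\<Sum>i<n. \<Sum>j<n. e i j * a * e j i) \<le> real n * norm a"
proof -
  interpret matrix_units "{..<n}" e by fact
  have n: "n > 0" using nonempty by auto
  define w where "w k = cis (2 * pi * real k / real n)" for k
  \<comment> \<open>Cyclic translation by \<open>l\<close>, with addition modulo \<open>n\<close>
    written out by cases.\<close>
  define s where "s l i = (if i + l < n then i + l else i + l - n)" for l i
  define W where "W k l = (\<Sum>i<n. w i ^ k *\<^sub>C e (s l i) i)" for k l
  have s: "s l i < n" if "l < n" "i < n" for l i using that by (auto simp: s_def)
  have s_inj: "s l i = s l j \<longleftrightarrow> i = j" if "l < n" "i < n" "j < n" for l i j
    using that by (auto simp: s_def)
  have adjW: "adj (W k l) = (\<Sum>i<n. cnj (w i ^ k) *\<^sub>C e i (s l i))" if "l < n" for k l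
    using that by (simp add: W_def adj_sum adj_scaleC adjoint s)
  have ww: "cnj (w i ^ k) * w i ^ k = 1" for i k
    by (simp add: w_def cis_cnj cis_mult flip: power_mult_distrib)
  have iso: "adj (W k l) * W k l = 1" if l: "l < n" for k l
  proof -
    have "adj (W k l) * W k l = (\<Sum>i<n. \<Sum>j<n. w j ^ k *\<^sub>C (cnj (w i ^ k) *\<^sub>C (e i (s l i) * e (s l j) j)))"
      unfolding adjW[OF l] unfolding W_def sum_product mult_scaleC_left mult_scaleC_right ..
    also have "\<dots> = (\<Sum>i<n. \<Sum>j<n. if i = j then e i i else 0)"
    proof (intro sum.cong refl)
      fix i j assume "i \<in> {..<n}" "j \<in> {..<n}"
      then show "w j ^ k *\<^sub>C (cnj (w i ^ k) *\<^sub>C (e i (s l i) * e (s l j) j)) = (if i = j then e i i else 0)"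
        using s[OF l] s_inj[OF l] ww[of i k] by (auto simp: mult scaleC_scaleC mult.commute)
    qed
    finally show ?thesis by (simp add: sum_diag)
  qed
  have "(\<Sum>l<n. \<Sum>k<n. W k l * a * adj (W k l)) =
      (\<Sum>l<n. \<Sum>k<n. \<Sum>i<n. \<Sum>j<n. ((w i * cnj (w j)) ^ k) *\<^sub>C (e (s l i) i * a * e j (s l j)))"
  proof (intro sum.cong refl)
    fix l k assume "l \<in> {..<n}" "k \<in> {..<n}"
    then have "W k l * a * adj (W k l) =
        (\<Sum>i<n. \<Sum>j<n. (w i ^ k *\<^sub>C e (s l i) i) * a * (cnj (w j ^ k) *\<^sub>C e j (s l j)))"
      by (simp only: adjW lessThan_iff) (subst sum.swap, simp only: W_def sum_distrib_right sum_distrib_left)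
    also have "\<dots> = (\<Sum>i<n. \<Sum>j<n. ((w i * cnj (w j)) ^ k) *\<^sub>C (e (s l i) i * a * e j (s l j)))"
      by (intro sum.cong refl)
        (simp add: mult_scaleC_left mult_scaleC_right scaleC_scaleC power_mult_distrib mult.commute)
    finally show "W k l * a * adj (W k l) =
        (\<Sum>i<n. \<Sum>j<n. ((w i * cnj (w j)) ^ k) *\<^sub>C (e (s l i) i * a * e j (s l j)))" .
  qed
  \<comment> \<open>Summing over the clock index \<open>k\<close> first leaves only the terms with
    \<open>i = j\<close>, by orthogonality of characters.\<close>
  also have "\<dots> = (\<Sum>l<n. \<Sum>i<n. \<Sum>j<n. (\<Sum>k<n. (w i * cnj (w j)) ^ k) *\<^sub>C (e (s l i) i * a * e j (s l j)))"
  proof (rule sum.cong[OF refl])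
    fix l
    let ?t = "\<lambda>k i j. ((w i * cnj (w j)) ^ k) *\<^sub>C (e (s l i) i * a * e j (s l j))"
    have "(\<Sum>k<n. \<Sum>i<n. \<Sum>j<n. ?t k i j) = (\<Sum>i<n. \<Sum>k<n. \<Sum>j<n. ?t k i j)" by (rule sum.swap)
    also have "\<dots> = (\<Sum>i<n. \<Sum>j<n. \<Sum>k<n. ?t k i j)" by (intro sum.cong refl sum.swap)
    finally show "(\<Sum>k<n. \<Sum>i<n. \<Sum>j<n. ?t k i j) =
        (\<Sum>i<n. \<Sum>j<n. (\<Sum>k<n. (w i * cnj (w j)) ^ k) *\<^sub>C (e (s l i) i * a * e j (s l j)))"
      by (simp only: scaleC_sum_left)
  qed
  also have "\<dots> = (\<Sum>l<n. \<Sum>i<n. of_nat n *\<^sub>C (e (s l i) i * a * e i (s l i)))"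
  proof (rule sum.cong[OF refl], rule sum.cong[OF refl])
    fix l i assume "i \<in> {..<n}"
    then have "(\<Sum>j<n. (\<Sum>k<n. (w i * cnj (w j)) ^ k) *\<^sub>C (e (s l i) i * a * e j (s l j)))
      = (\<Sum>j<n. if i = j then of_nat n *\<^sub>C (e (s l i) i * a * e j (s l j)) else 0)"
      by (intro sum.cong refl) (simp add: w_def sum_power_root_of_unity)
    then show "(\<Sum>j<n. (\<Sum>k<n. (w i * cnj (w j)) ^ k) *\<^sub>C (e (s l i) i * a * e j (s l j)))
      = of_nat n *\<^sub>C (e (s l i) i * a * e i (s l i))" using \<open>i \<in> {..<n}\<close> by simp
  qed
  also have "\<dots> = of_nat n *\<^sub>C (\<Sum>i<n. \<Sum>l<n. e (s l i) i * a * e i (s l i))"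
    by (subst sum.swap) (simp add: scaleC_sum_right)
  also have "(\<Sum>i<n. \<Sum>l<n. e (s l i) i * a * e i (s l i)) = (\<Sum>i<n. \<Sum>m<n. e m i * a * e i m)"
  proof (rule sum.cong[OF refl])
    fix i assume i: "i \<in> {..<n}"
    have "inj_on (\<lambda>l. s l i) {..<n}" using i by (auto simp: inj_on_def s_def split: if_splits)
    moreover have "(\<lambda>l. s l i) ` {..<n} \<subseteq> {..<n}" using i s by auto
    ultimately have "bij_betw (\<lambda>l. s l i) {..<n} {..<n}"
      by (simp add: bij_betw_def endo_inj_surj)
    then show "(\<Sum>l<n. e (s l i) i * a * e i (s l i)) = (\<Sum>m<n. e m i * a * e i m)"
      by (rule sum.reindex_bij_betw)
  qed
  also have "\<dots> = (\<Sum>i<n. \<Sum>j<n. e i j * a * e j i)" by (rule sum.swap)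
  finally have "real n * norm (\<Sum>i<n. \<Sum>j<n. e i j * a * e j i) = norm (\<Sum>l<n. \<Sum>k<n. W k l * a * adj (W k l))"
    by (simp add: norm_scaleC)
  \<comment> \<open>Each of the \<open>n * n\<close> conjugates has norm at most
    \<open>norm a\<close>; the factor \<open>n\<close> from orthogonality cancels one
    \<open>n\<close>.\<close>
  also have "\<dots> \<le> (\<Sum>l<n. \<Sum>k<n. norm a)"
    using iso by (intro sum_norm_le norm_conj_isometry_le) auto
  also have "\<dots> = real n * (real n * norm a)" by simp
  finally show ?thesis using n by simp
qed

section \<open>Star subalgebras of matrix algebras\<close>

definition poly_act :: "'a::cstar_algebra \<Rightarrow> complex poly \<Rightarrow> 'a" where
  "poly_act w p = fold_coeffs (\<lambda>c x. c *\<^sub>C 1 + w * x) p 0"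

lemma poly_act_0 [simp]: "poly_act w 0 = 0"
  by (simp add: poly_act_def)

lemma poly_act_pCons [simp]: "poly_act w (pCons c p) = c *\<^sub>C 1 + w * poly_act w p"
  by (cases "c = 0 \<and> p = 0") (auto simp: poly_act_def)

lemma poly_act_add: "poly_act w (p + q) = poly_act w p + poly_act w q"
  by (induction p q rule: poly_induct2) (simp_all add: scaleC_add_left algebra_simps)

lemma poly_act_smult: "poly_act w (smult c p) = c *\<^sub>C poly_act w p"
  by (induction p) (simp_all add: scaleC_add_right scaleC_scaleC mult_scaleC_right)

lemma poly_act_sum: "poly_act w (\<Sum>i\<in>S. f i) = (\<Sum>i\<in>S. poly_act w (f i))"
  by (induction S rule: infinite_finite_induct) (auto simp: poly_act_add)

lemma poly_act_monom: "poly_act w (monom c i) = c *\<^sub>C w ^ i"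
  by (induction i) (simp_all add: monom_0 monom_Suc mult_scaleC_right)

lemma poly_act_commute: "w * b = b * w \<Longrightarrow> poly_act w p * b = b * poly_act w p"
  by (induction p) (simp_all add: algebra_simps mult_scaleC_left mult_scaleC_right, metis mult.assoc)

text \<open>Here \<open>span\<close> is over the reals, so each unit contributes its multiple by
  \<i> as a second generator.\<close>

lemma (in matrix_units) units_span_finite_dimensional:
  obtains F :: "'a set" where "Finite_Set.finite F" "units_span \<subseteq> span F"
proof
  define F where "F = (\<lambda>(i, j). e i j) ` (I \<times> I) \<union> (\<lambda>(i, j). \<i> *\<^sub>C e i j) ` (I \<times> I)"
  show "Finite_Set.finite F" using finite by (simp add: F_def)
  have "c *\<^sub>C e i j \<in> span F" if "i \<in> I" "j \<in> I" for c i j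
  proof -
    have "e i j \<in> F" "\<i> *\<^sub>C e i j \<in> F" using that by (auto simp: F_def)
    then have "Re c *\<^sub>R e i j + Im c *\<^sub>R (\<i> *\<^sub>C e i j) \<in> span F"
      by (intro span_add span_scale span_base)
    also have "Re c *\<^sub>R e i j + Im c *\<^sub>R (\<i> *\<^sub>C e i j) = (complex_of_real (Re c) + complex_of_real (Im c) * \<i>) *\<^sub>C e i j"
      by (simp add: scaleC_add_left scaleC_scaleC flip: scaleC_of_real)
    also have "\<dots> = c *\<^sub>C e i j" by (subst (3) complex_eq[of c]) (simp only: mult.commute)
    finally show ?thesis .
  qed
  then show "units_span \<subseteq> span F"
    unfolding units_span_def combo_def by (auto intro!: span_sum)
qed

lemma annihilating_poly:
  fixes w :: "'a::cstar_algebra"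
  assumes "finite F" "\<And>i. w ^ i \<in> span F"
  obtains p where "p \<noteq> 0" "poly_act w p = 0"
proof (cases "inj (\<lambda>i::nat. w ^ i)")
  \<comment> \<open>Linear dependence speaks of the set of powers and does not see repetitions, so
    two equal powers are treated apart, by a difference of monomials.\<close>
  case False
  then obtain i j :: nat where ij: "i \<noteq> j" "w ^ i = w ^ j" by (auto simp: inj_on_def)
  define p where "p = (monom 1 i + monom (-1) j :: complex poly)"
  have "coeff p i = 1" using ij by (simp add: p_def)
  then have "p \<noteq> 0" by auto
  moreover have "poly_act w p = 0"
    using ij by (simp add: p_def poly_act_add poly_act_monom scaleC_minus_one)
  ultimately show ?thesis using that by blast
next
  case True
  then have "infinite (range (\<lambda>i::nat. w ^ i))" by (simp add: finite_image_iff)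
  then have "dependent (range (\<lambda>i::nat. w ^ i))"
    using independent_span_bound[OF assms(1)] assms(2) by (metis image_subsetI)
  then obtain t u where t: "finite t" "t \<subseteq> range (\<lambda>i::nat. w ^ i)" "(\<Sum>v\<in>t. u v *\<^sub>R v) = 0"
      and u: "\<exists>v\<in>t. u v \<noteq> 0"
    unfolding dependent_explicit by blast
  obtain T where T: "finite T" "t = (\<lambda>i. w ^ i) ` T"
    using finite_subset_image[OF t(1,2)] by blast
  define p where "p = (\<Sum>i\<in>T. monom (complex_of_real (u (w ^ i))) i)"
  have "inj_on (\<lambda>i::nat. w ^ i) T" using True by (rule inj_on_subset) simp
  then have "poly_act w p = (\<Sum>v\<in>t. u v *\<^sub>R v)"
    by (simp add: p_def poly_act_sum poly_act_monom scaleC_of_real T(2) sum.reindex)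
  moreover obtain i where i: "i \<in> T" "u (w ^ i) \<noteq> 0" using u T by blast
  have "coeff p i = (\<Sum>j\<in>T. if i = j then complex_of_real (u (w ^ j)) else 0)"
    unfolding p_def coeff_sum by (intro sum.cong refl) simp
  then have "coeff p i = complex_of_real (u (w ^ i))" using i T(1) by simp
  then have "p \<noteq> 0" using i by auto
  ultimately show ?thesis using that t(3) by metis
qed

text \<open>Take \<open>p\<close> of least degree annihilating \<open>g\<close>. It is not constant,
  so it has a root \<open>z\<close>; the cofactor of the linear factor does not annihilate
  \<open>g\<close> by minimality, and what it produces is an eigenvector.\<close>

lemma eigenvector:
  fixes w g :: "'a::cstar_algebra"
  assumes "p \<noteq> 0" "poly_act w p = 0" "g \<noteq> 0"
  obtains z q where "poly_act w q * g \<noteq> 0" "w * (poly_act w q * g) = z *\<^sub>C (poly_act w q * g)"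
proof -
  have "\<exists>p. (p \<noteq> 0 \<and> poly_act w p * g = 0) \<and>
      (\<forall>q. q \<noteq> 0 \<and> poly_act w q * g = 0 \<longrightarrow> degree p \<le> degree q)"
    using assms by (intro ex_has_least_nat[of _ p]) simp
  then obtain p where p: "p \<noteq> 0" "poly_act w p * g = 0"
    and least: "\<And>q. q \<noteq> 0 \<Longrightarrow> poly_act w q * g = 0 \<Longrightarrow> degree p \<le> degree q" by blast
  have "degree p \<noteq> 0"
  proof
    assume "degree p = 0"
    then obtain c where "p = [:c:]" by (rule degree_eq_zeroE)
    then show False using p assms(3) by (auto simp: mult_scaleC_left scaleC_eq_0_iff)
  qed
  then have "\<not> constant (poly p)" by (simp add: constant_degree)
  then obtain z where "poly p z = 0" using fundamental_theorem_of_algebra by blast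
  then obtain q where q: "p = [:-z, 1:] * q" by (auto simp: poly_eq_0_iff_dvd dvd_def)
  have "q \<noteq> 0" using p(1) q by auto
  then have "degree q < degree p" unfolding q by (subst degree_mult_eq) auto
  then have "poly_act w q * g \<noteq> 0" using least[OF \<open>q \<noteq> 0\<close>] by auto
  moreover have "poly_act w (smult (- z) q + pCons 0 q) = w * poly_act w q - z *\<^sub>C poly_act w q"
    by (simp only: poly_act_add poly_act_smult scaleC_minus_left poly_act_pCons) simp
  then have "poly_act w p = w * poly_act w q - z *\<^sub>C poly_act w q"
    by (simp add: q)
  then have "w * (poly_act w q * g) = z *\<^sub>C (poly_act w q * g)"
    using p(2) by (simp add: left_diff_distrib mult_scaleC_left mult.assoc)
  ultimately show ?thesis using that by blast
qed

section \<open>Minimal left ideals and the Wedderburn structure\<close>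

definition left_ideal :: "'a::cstar_algebra set \<Rightarrow> 'a set \<Rightarrow> bool" where
  "left_ideal P J \<longleftrightarrow> J \<subseteq> P \<and> 0 \<in> J \<and> (\<forall>x\<in>J. \<forall>y\<in>J. x + y \<in> J) \<and> (\<forall>a\<in>P. \<forall>x\<in>J. a * x \<in> J)"

lemma left_ideal_scaleC:
  assumes "star_subalgebra P" "left_ideal P J" "x \<in> J"
  shows "c *\<^sub>C x \<in> J"
proof -
  have "(c *\<^sub>C 1) * x \<in> J"
    using assms star_subalgebraD[OF assms(1)] unfolding left_ideal_def by blast
  then show ?thesis by (simp add: mult_scaleC_left)
qed

lemma subspace_left_ideal:
  assumes "star_subalgebra P" "left_ideal P J"
  shows "subspace J"
  using assms left_ideal_scaleC[OF assms, of _ "complex_of_real _"]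
  unfolding subspace_def left_ideal_def scaleC_of_real by auto

text \<open>Take a nonzero left ideal of least real dimension. A basis of a proper nonzero subideal
  could be enlarged by an element of \<open>J\<close>, so the subideal would have smaller
  dimension.\<close>

lemma minimal_left_ideal:
  fixes P :: "'a::cstar_algebra set"
  assumes P: "star_subalgebra P" and F: "finite F" "P \<subseteq> span F"
  obtains J where "left_ideal P J" "J \<noteq> {0}"
    "\<And>K. left_ideal P K \<Longrightarrow> K \<subseteq> J \<Longrightarrow> K \<noteq> {0} \<Longrightarrow> K = J"
proof -
  have "left_ideal P P" "P \<noteq> {0}"
    using star_subalgebraD[OF P] star_subalgebra_zero[OF P] unfolding left_ideal_def by auto
  then have "\<exists>J. (left_ideal P J \<and> J \<noteq> {0}) \<and> (\<forall>K. left_ideal P K \<and> K \<noteq> {0} \<longrightarrow> dim J \<le> dim K)"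
    by (intro ex_has_least_nat[of _ P]) simp
  then obtain J where J: "left_ideal P J" "J \<noteq> {0}"
    and least: "\<And>K. left_ideal P K \<Longrightarrow> K \<noteq> {0} \<Longrightarrow> dim J \<le> dim K" by blast
  have "K = J" if K: "left_ideal P K" "K \<subseteq> J" "K \<noteq> {0}" for K
  proof (rule ccontr)
    assume "K \<noteq> J"
    then obtain x where x: "x \<in> J" "x \<notin> K" using K(2) by blast
    obtain S where S: "S \<subseteq> K" "independent S" "K \<subseteq> span S" "card S = dim K" by (rule basis_exists)
    obtain T where T: "T \<subseteq> J" "independent T" "J \<subseteq> span T" "card T = dim J" by (rule basis_exists)
    have "span S \<subseteq> K" using span_minimal[OF S(1) subspace_left_ideal[OF P K(1)]] .
    then have indep: "independent (insert x S)" using independent_insertI S(2) x by blast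
    have "J \<subseteq> span F" using J(1) F(2) unfolding left_ideal_def by blast
    then have "finite T" using independent_span_bound[OF F(1) T(2)] T(1) by blast
    moreover have "insert x S \<subseteq> span T" using x S(1) K(2) T(3) by blast
    ultimately have "finite (insert x S)" "card (insert x S) \<le> card T"
      using independent_span_bound[OF _ indep] by auto
    moreover have "x \<notin> S" using x S(1) by blast
    ultimately show False using least[OF K(1,3)] S(4) T(4) by simp
  qed
  then show ?thesis using that J by blast
qed

text \<open>A minimal left ideal is generated by a minimal projection \<open>g\<close>, and is a Hilbert space
  with the inner product \<open>v\<^sup>* w \<in> \<complex> g\<close>; an orthonormal basis yields the matrix units
  \<open>v w\<^sup>*\<close>.\<close>

theorem factor_if_trivial_centre:
  fixes P B :: "'a::cstar_algebra set"
  assumes B: "factor B" and P: "star_subalgebra P" "P \<subseteq> B"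
    and centre: "\<And>z. z \<in> P \<Longrightarrow> z \<in> commutant P \<Longrightarrow> \<exists>c. z = c *\<^sub>C 1"
  shows "factor P"
proof -
  obtain m e where e: "matrix_units {..<m::nat} e" and B_eq: "B = matrix_units.units_span {..<m} e"
    using B by (rule factorE)
  interpret E: matrix_units "{..<m}" e by fact
  obtain F where F: "finite F" "B \<subseteq> span F" using E.units_span_finite_dimensional B_eq by metis
  note PD = star_subalgebraD[OF P(1)]
  obtain J where J: "left_ideal P J" "J \<noteq> {0}"
    and minimal: "\<And>K. left_ideal P K \<Longrightarrow> K \<subseteq> J \<Longrightarrow> K \<noteq> {0} \<Longrightarrow> K = J"
    using minimal_left_ideal[OF P(1) F(1)] F(2) P(2) by (metis subset_trans)
  have JP: "x \<in> J \<Longrightarrow> x \<in> P" and J0: "0 \<in> J" and Jadd: "x \<in> J \<Longrightarrow> y \<in> J \<Longrightarrow> x + y \<in> J"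
    and Jmult: "a \<in> P \<Longrightarrow> x \<in> J \<Longrightarrow> a * x \<in> J" for a x y
    using J(1) unfolding left_ideal_def by auto
  have Jscale: "x \<in> J \<Longrightarrow> c *\<^sub>C x \<in> J" for c x using left_ideal_scaleC[OF P(1) J(1)] .
  have Jdiff: "x \<in> J \<Longrightarrow> y \<in> J \<Longrightarrow> x - y \<in> J" for x y
    using Jadd[of x "(-1) *\<^sub>C y"] Jscale[of y "-1"] by (simp add: scaleC_minus_one)
  have Jsum: "(\<And>i. i \<in> S \<Longrightarrow> f i \<in> J) \<Longrightarrow> (\<Sum>i\<in>S. f i) \<in> J" for S :: "'a set" and f
    by (induction S rule: infinite_finite_induct) (auto simp: J0 Jadd)
  \<comment> \<open>Schur's lemma: the kernel in \<open>J\<close> of right multiplication by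
    \<open>h\<close> is a left ideal, so by minimality it is zero unless it is all of
    \<open>J\<close>.\<close>
  have kernel: "x = 0" if "h \<in> J" "y \<in> J" "y * h \<noteq> 0" "x \<in> J" "x * h = 0" for h x y
  proof (rule ccontr)
    assume "x \<noteq> 0"
    have "left_ideal P {x \<in> J. x * h = 0}"
      unfolding left_ideal_def using JP J0 Jadd Jmult by (auto simp: distrib_right mult.assoc)
    then have "{x \<in> J. x * h = 0} = J" using minimal \<open>x \<noteq> 0\<close> that by blast
    then show False using that by blast
  qed

  obtain x where x: "x \<in> J" "x \<noteq> 0" using J J0 by blast
  \<comment> \<open>A self-adjoint element of \<open>J\<close> with nonzero square, so that
    \<open>J h\<close> is a nonzero left ideal inside \<open>J\<close> and hence equal to
    \<open>J\<close>.\<close>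
  define h where "h = adj x * x"
  have h: "h \<in> J" "adj h = h" "h * h \<noteq> 0"
    using Jmult[OF PD(5)[OF JP]] x adj_mult_self_eq_0[of h] adj_mult_self_eq_0[of x]
    by (auto simp: h_def adj_mult adj_adj)
  have "left_ideal P ((\<lambda>y. y * h) ` J)"
    unfolding left_ideal_def
  proof (intro conjI ballI)
    show "(\<lambda>y. y * h) ` J \<subseteq> P" using JP h PD(3) by auto
    show "0 \<in> (\<lambda>y. y * h) ` J" using J0 by (auto intro: image_eqI[of _ _ 0])
    show "x + y \<in> (\<lambda>y. y * h) ` J" if "x \<in> (\<lambda>y. y * h) ` J" "y \<in> (\<lambda>y. y * h) ` J" for x y
      using that Jadd by (auto simp flip: distrib_right)
    show "a * x \<in> (\<lambda>y. y * h) ` J" if "a \<in> P" "x \<in> (\<lambda>y. y * h) ` J" for a x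
      using that Jmult by (auto simp flip: mult.assoc)
  qed
  moreover have "(\<lambda>y. y * h) ` J \<subseteq> J" using JP Jmult h by auto
  ultimately have "(\<lambda>y. y * h) ` J = J" using minimal h by blast
  \<comment> \<open>As \<open>J h = J\<close>, some \<open>g\<close> satisfies
    \<open>g * h = h\<close>. Cancelling \<open>h\<close> with \<open>kernel\<close> shows first
    that \<open>g\<close> is a right unit of \<open>J\<close>, then that it is a projection.\<close>
  then obtain g where g: "g \<in> J" "g * h = h" using h(1) by (metis imageE)
  have g_right: "y * g = y" if "y \<in> J" for y
  proof -
    have "(y * g - y) * h = 0" by (simp add: left_diff_distrib mult.assoc g)
    then show ?thesis
      using kernel[OF h(1) h(1) h(3), of "y * g - y"] that JP Jmult g Jdiff by simp
  qed
  have "adj g * h = h" using g_right[OF h(1)] h(2) by (metis adj_mult)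
  then have "(adj g * g - g) * h = 0" by (simp add: left_diff_distrib mult.assoc g)
  then have gg: "adj g * g = g"
    using kernel[OF h(1) h(1) h(3), of "adj g * g - g"] Jdiff Jmult PD(5)[OF JP] g by simp
  then have g_adj: "adj g = g" by (metis adj_adj adj_mult)
  have g_nz: "g \<noteq> 0" using g h(3) by auto

  \<comment> \<open>The corner \<open>g P g\<close> consists of scalars: take an eigenvector
    \<open>v\<close> in \<open>J\<close> of the corner element \<open>w\<close>, with eigenvalue
    \<open>z\<close>. Then \<open>v\<close> annihilates \<open>w - z g\<close> from the left, which
    by \<open>kernel\<close> is possible only if \<open>g * (w - z g)\<close> is zero.\<close>
  have corner: "\<exists>c. g * y * g = c *\<^sub>C g" if y: "y \<in> P" for y
  proof -
    define w where "w = g * y * g"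
    have wJ: "w \<in> J" unfolding w_def using y g JP Jmult PD(3) by blast
    have gw: "g * w = w" "w * g = w"
      unfolding w_def using g_right[OF g(1)] by (metis mult.assoc)+
    have "w ^ i \<in> B" for i
      by (induction i) (use star_subalgebraD[OF factor_star_subalgebra[OF B]] JP[OF wJ] P(2) in auto)
    then obtain p where "p \<noteq> 0" "poly_act w p = 0"
      using annihilating_poly[OF F(1), of w] F(2) by (metis subsetD)
    then obtain z q where q: "poly_act w q * g \<noteq> 0" "w * (poly_act w q * g) = z *\<^sub>C (poly_act w q * g)"
      using eigenvector g_nz by metis
    have act_P: "poly_act w q \<in> P" for q
      by (induction q) (use PD JP[OF wJ] star_subalgebra_zero[OF P(1)] in auto)
    define v where "v = poly_act w q * g"
    have v: "v \<in> J" "v \<noteq> 0" "w * v = z *\<^sub>C v"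
      using q act_P g Jmult by (auto simp: v_def)
    have "v * w = w * v"
      unfolding v_def using gw poly_act_commute[of w w q] by (metis mult.assoc)
    then have "v * (w - z *\<^sub>C g) = 0"
      using v g_right by (simp add: right_diff_distrib mult_scaleC_right)
    moreover have "w - z *\<^sub>C g \<in> J" using wJ g Jdiff Jscale by simp
    ultimately have "g * (w - z *\<^sub>C g) = 0"
      using kernel[of "w - z *\<^sub>C g" g v] g v(1,2) by blast
    then show ?thesis
      using gw g_right[OF g(1)]
      by (intro exI[of _ z]) (simp add: right_diff_distrib mult_scaleC_right w_def)
  qed
  have inner: "\<exists>c. adj v * w = c *\<^sub>C g" if "v \<in> J" "w \<in> J" for v w
  proof -
    have "adj v * w = g * (adj v * w) * g"
      using g_right[OF that(1)] g_right[OF that(2)] g_adj by (metis adj_mult mult.assoc)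
    then show ?thesis using corner[of "adj v * w"] that JP PD by metis
  qed
  have normalise: "\<exists>c. adj (c *\<^sub>C v) * (c *\<^sub>C v) = g" if v: "v \<in> J" "v \<noteq> 0" for v
  proof -
    obtain c where c: "adj v * v = c *\<^sub>C g" using inner v by blast
    then obtain r where r: "r > 0" "c = complex_of_real r"
      using E.positive_scalar[of v g c] v g JP P(2) gg B_eq by auto
    have "complex_of_real (1 / sqrt r) * (complex_of_real (1 / sqrt r) * complex_of_real r) = complex_of_real (1 / sqrt r * (1 / sqrt r * r))"
      by (simp only: of_real_mult)
    also have "1 / sqrt r * (1 / sqrt r * r) = 1" using r(1) by (simp add: field_simps)
    finally have "adj (complex_of_real (1 / sqrt r) *\<^sub>C v) * (complex_of_real (1 / sqrt r) *\<^sub>C v) = g"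
      by (simp add: adj_scaleC mult_scaleC_left mult_scaleC_right scaleC_scaleC c r)
    then show ?thesis by blast
  qed

  define orthonormal where
    "orthonormal S \<longleftrightarrow> S \<subseteq> J \<and> (\<forall>v\<in>S. \<forall>w\<in>S. adj v * w = (if v = w then g else 0))" for S
  \<comment> \<open>Orthonormal sets are linearly independent, so their sizes are bounded and one of
    greatest size exists.\<close>
  have bound: "finite S \<and> card S \<le> card F" if S: "orthonormal S" for S
  proof (rule independent_span_bound[OF F(1)])
    show "S \<subseteq> span F" using S JP P(2) F(2) unfolding orthonormal_def by blast
    show "independent S"
      unfolding independent_explicit_finite_subsets
    proof (intro allI impI ballI)
      fix T u v assume T: "T \<subseteq> S" "finite T" "(\<Sum>v\<in>T. u v *\<^sub>R v) = 0" "v \<in> T"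
      have "0 = adj v * (\<Sum>w\<in>T. u w *\<^sub>R w)" using T by simp
      also have "\<dots> = (\<Sum>w\<in>T. if v = w then u w *\<^sub>R g else 0)"
        unfolding sum_distrib_left using S T unfolding orthonormal_def
        by (intro sum.cong refl) (auto simp: subset_iff)
      finally show "u v = 0" using T g_nz by simp
    qed
  qed
  have "\<exists>S. orthonormal S \<and> (\<forall>T. orthonormal T \<longrightarrow> card T \<le> card S)"
    using bound by (intro ex_has_greatest_nat[of _ "{}" _ "Suc (card F)"])
      (auto simp: orthonormal_def le_imp_less_Suc)
  then obtain S where S: "orthonormal S" and maximal: "\<And>T. orthonormal T \<Longrightarrow> card T \<le> card S" by blast
  have SJ: "v \<in> S \<Longrightarrow> v \<in> J" and ortho: "v \<in> S \<Longrightarrow> w \<in> S \<Longrightarrow> adj v * w = (if v = w then g else 0)" for v w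
    using S unfolding orthonormal_def by auto
  have finS: "finite S" using bound[OF S] by simp
  define z where "z = (\<Sum>v\<in>S. v * adj v)"
  \<comment> \<open>The remainder \<open>x - z * x\<close> is orthogonal to \<open>S\<close>, as in
    the Gram-Schmidt process; if it were nonzero, its normalisation would enlarge
    \<open>S\<close>.\<close>
  have zx: "z * x = x" if x: "x \<in> J" for x
  proof (rule ccontr)
    assume "z * x \<noteq> x"
    define y where "y = x - z * x"
    have "z \<in> P" unfolding z_def using SJ JP PD by (intro star_subalgebra_sum[OF P(1)]) auto
    then have y: "y \<in> J" "y \<noteq> 0" using x Jmult Jdiff \<open>z * x \<noteq> x\<close> by (auto simp: y_def)
    have vy: "adj v * y = 0" if "v \<in> S" for v
    proof -
      have "adj v * z = (\<Sum>w\<in>S. if v = w then g * adj w else 0)"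
        unfolding z_def sum_distrib_left using that
        by (intro sum.cong refl) (simp add: ortho flip: mult.assoc)
      also have "\<dots> = adj (v * g)" using that finS by (simp add: adj_mult g_adj)
      finally have "adj v * z = adj v" using g_right SJ that by simp
      then show ?thesis by (simp add: y_def right_diff_distrib flip: mult.assoc)
    qed
    obtain c where c: "adj (c *\<^sub>C y) * (c *\<^sub>C y) = g" using normalise[OF y] by blast
    have vy': "adj v * (c *\<^sub>C y) = 0" "adj (c *\<^sub>C y) * v = 0" if "v \<in> S" for v
    proof -
      show "adj v * (c *\<^sub>C y) = 0" using vy[OF that] by (simp add: mult_scaleC_right)
      then have "adj (adj v * (c *\<^sub>C y)) = 0" by simp
      then show "adj (c *\<^sub>C y) * v = 0" by (simp add: adj_mult adj_adj)
    qed
    have "c *\<^sub>C y \<notin> S" using vy'(1) c g_nz by auto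
    moreover have "orthonormal (insert (c *\<^sub>C y) S)"
      unfolding orthonormal_def using c vy' ortho SJ Jscale y(1) \<open>c *\<^sub>C y \<notin> S\<close> by auto
    ultimately show False using maximal[of "insert (c *\<^sub>C y) S"] finS by simp
  qed
  have zP: "z \<in> P" unfolding z_def using SJ JP PD by (intro star_subalgebra_sum[OF P(1)]) auto
  have z_adj: "adj z = z" by (simp add: z_def adj_sum adj_mult adj_adj)
  \<comment> \<open>Each \<open>a * v\<close> lies in \<open>J\<close>, where \<open>z\<close> acts
    as the identity. With the adjoint relation this makes \<open>z\<close> central in
    \<open>P\<close>; trivial centre then turns it into 1, so the units \<open>v * adj w\<close> are
    complete.\<close>
  have zaz: "z * a * z = a * z" if "a \<in> P" for a
  proof -
    have "z * (a * v) * adj v = a * v * adj v" if "v \<in> S" for v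
      using zx Jmult SJ that \<open>a \<in> P\<close> by simp
    then show ?thesis by (simp add: z_def[of] sum_distrib_left mult.assoc cong: sum.cong)
  qed
  have "z \<in> commutant P"
  proof -
    have "z * a = a * z" if "a \<in> P" for a
    proof -
      have "adj (z * adj a * z) = adj (adj a * z)" using zaz PD(5) that by simp
      then have "z * a * z = z * a" by (simp add: adj_mult adj_adj z_adj mult.assoc)
      then show ?thesis using zaz that by simp
    qed
    then show ?thesis by (simp add: commutant_def)
  qed
  then obtain c where "z = c *\<^sub>C 1" using centre zP by blast
  moreover have "z * g = g" using zx g by simp
  ultimately have "(c - 1) *\<^sub>C g = 0" by (simp add: mult_scaleC_left scaleC_diff_left)
  then have z1: "z = 1" using g_nz \<open>z = c *\<^sub>C 1\<close> by (simp add: scaleC_eq_0_iff)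

  interpret U: matrix_units S "\<lambda>v w. v * adj w"
  proof
    show "(\<Sum>v\<in>S. v * adj v) = 1" using z1 by (simp add: z_def)
    show "v * adj w * (v' * adj w') = (if w = v' then v * adj w' else 0)"
      if "v \<in> S" "w \<in> S" "v' \<in> S" "w' \<in> S" for v w v' w'
    proof -
      have "v * adj w * (v' * adj w') = v * (adj w * v') * adj w'" by (simp add: mult.assoc)
      then show ?thesis using ortho[of w v'] g_right[OF SJ] that by simp
    qed
  qed (simp_all add: finS adj_mult adj_adj)
  have "a \<in> U.units_span" if a: "a \<in> P" for a
  proof -
    have "a = z * a * z" using z1 by simp
    also have "\<dots> = (\<Sum>v\<in>S. \<Sum>w\<in>S. v * adj v * a * (w * adj w))"
      by (simp only: z_def sum_distrib_right sum_distrib_left) (rule sum.swap)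
    also have "\<dots> \<in> U.units_span"
    proof (intro star_subalgebra_sum U.star_subalgebra_units_span)
      fix v w assume vw: "v \<in> S" "w \<in> S"
      then obtain c where "adj v * (a * w) = c *\<^sub>C g" using inner SJ Jmult a by blast
      then have "v * adj v * a * (w * adj w) = v * (c *\<^sub>C g) * adj w" by (metis mult.assoc)
      also have "\<dots> = c *\<^sub>C (v * adj w)"
        using g_right[OF SJ[OF vw(1)]] by (simp add: mult_scaleC_left mult_scaleC_right)
      also have "\<dots> \<in> U.units_span"
        using U.unit_in_span[OF vw] U.star_subalgebra_units_span star_subalgebraD(4) by blast
      finally show "v * adj v * a * (w * adj w) \<in> U.units_span" .
    qed
    finally show ?thesis .
  qed
  moreover have "U.units_span \<subseteq> P"
    using SJ JP PD by (intro U.units_span_subset P(1)) auto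
  ultimately have "P = U.units_span" by blast
  then show ?thesis using U.factor by simp
qed

text \<open>A central element can be pulled out of its diagonal entry, so it equals that entry,
  which is a scalar.\<close>

lemma factor_centre:
  assumes "factor B" "z \<in> B" "z \<in> commutant B"
  shows "\<exists>c. z = c *\<^sub>C 1"
proof -
  obtain n e where e: "matrix_units {..<n::nat} e" and B: "B = matrix_units.units_span {..<n} e"
    using assms(1) by (rule factorE)
  interpret matrix_units "{..<n}" e by fact
  obtain o' where o': "o' < n" using nonempty by auto
  obtain c where c: "z = combo c" using assms(2) B by (auto simp: units_span_def)
  have "component z o' o' = (\<Sum>k<n. z * (e k o' * e o' k))"
    unfolding component_def
  proof (intro sum.cong refl)
    fix k assume "k \<in> {..<n}"
    then have "z * e k o' = e k o' * z"
      using o' B by (intro commutantD[OF assms(3)]) (auto intro: unit_in_span)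
    then show "e k o' * z * e o' k = z * (e k o' * e o' k)" by (metis mult.assoc)
  qed
  also have "\<dots> = z" using o' sum_diag by (simp add: mult flip: sum_distrib_left)
  finally show ?thesis using component_combo[of o' o' c] o' c by (intro exI[of _ "c o' o'"]) simp
qed

text \<open>The elements commuting with both \<open>z\<close> and \<open>adj z\<close> form a star
  subalgebra, which contains \<open>S\<close> and therefore the hull.\<close>

lemma commutant_hull:
  assumes "\<And>b. b \<in> S \<Longrightarrow> adj b \<in> S" "z \<in> commutant S"
  shows "z \<in> commutant (star_subalgebra hull S)"
proof -
  have "star_subalgebra hull S \<subseteq> commutant {z, adj z}"
  proof (rule hull_subset_commutant)
    have "b * adj z = adj z * b" if "b \<in> S" for b
      using commutantD[OF assms(2) assms(1)[OF that]] by (metis adj_adj adj_mult)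
    then show "S \<subseteq> commutant {z, adj z}"
      using commutantD[OF assms(2)] by (auto simp: commutant_def)
  qed (auto simp: adj_adj)
  then show ?thesis by (auto simp: commutant_def)
qed

lemma (in matrix_units) automorphism_eqI:
  assumes "star_automorphism \<phi>" "star_automorphism \<psi>"
    and "\<And>i j. i \<in> I \<Longrightarrow> j \<in> I \<Longrightarrow> \<phi> (e i j) = \<psi> (e i j)" "a \<in> units_span"
  shows "\<phi> a = \<psi> a"
  using assms(3,4) unfolding units_span_def combo_def
  by (auto simp: star_automorphism_sum[OF assms(1)] star_automorphism_sum[OF assms(2)]
      star_automorphismD(5)[OF assms(1)] star_automorphismD(5)[OF assms(2)])

lemma factor_scalars: "factor (star_subalgebra hull ({}::'a::cstar_algebra set))"
proof -
  interpret matrix_units "{()}" "\<lambda>_ _. 1::'a" by unfold_locales auto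
  have "units_span = star_subalgebra hull {}"
    using star_subalgebraD(1)[OF star_subalgebra_hull]
    by (intro antisym units_span_subset hull_minimal star_subalgebra_units_span) auto
  then show ?thesis using factor by simp
qed

lemma hull_Un_hull: "star_subalgebra hull (S \<union> (star_subalgebra hull R)) = star_subalgebra hull (S \<union> R)"
  by (intro antisym hull_minimal star_subalgebra_hull Un_least hull_mono Un_upper2)
    (auto intro: hull_inc)

lemma bounded_linear_scaleC_right: "bounded_linear (\<lambda>a::'a::cstar_algebra. c *\<^sub>C a)"
  by (rule bounded_linear_intro[where K = "cmod c"])
    (simp_all add: scaleC_add_right scaleC_scaleC norm_scaleC mult.commute flip: scaleC_of_real)

lemma bounded_linear_scaleC_left: "bounded_linear (\<lambda>c. c *\<^sub>C (a::'a::cstar_algebra))"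
proof (rule bounded_linear_intro[where K = "norm a"])
  show "(r *\<^sub>R c) *\<^sub>C a = r *\<^sub>R c *\<^sub>C a" for r c
    by (simp only: scaleC_scaleC scaleR_conv_of_real[of r c] scaleC_of_real[symmetric])
qed (simp_all add: scaleC_add_left norm_scaleC)

lemma bounded_linear_adj: "bounded_linear (adj :: 'a::cstar_algebra \<Rightarrow> 'a)"
proof (rule bounded_linear_intro[where K = 1])
  show "adj (r *\<^sub>R a) = r *\<^sub>R adj a" for r and a :: 'a
    using adj_scaleC[of "complex_of_real r" a] by (simp add: scaleC_of_real)
qed (simp_all add: adj_add)

lemma complete_scalars: "complete (range (\<lambda>c. c *\<^sub>C (1::'a::cstar_algebra)))"
  by (rule complete_isometric_image[where e = 1])
    (auto simp: norm_scaleC complete_UNIV bounded_linear_scaleC_left)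

section \<open>Chains of matrix algebras\<close>

text \<open>This includes \<open>K = 0\<close>, where congruence is equality; the line and the rings
  can thus be treated together.\<close>

lemma periodic_mod_eq:
  fixes f :: "int \<Rightarrow> 'b"
  assumes "\<And>x. f (x + int K) = f x" "x mod int K = y mod int K"
  shows "f x = f y"
proof -
  have nat: "f (x + int n * int K) = f x" for x n
  proof (induction n)
    case (Suc n)
    then show ?case using assms(1)[of "x + int n * int K"] by (simp add: algebra_simps)
  qed simp
  obtain k where k: "x = y + k * int K"
    using assms(2) by (metis add.commute mod_eqE mult.commute diff_add_cancel uminus_add_conv_diff)
  show ?thesis
  proof (cases "k \<ge> 0")
    case True
    then show ?thesis using nat[of y "nat k"] k by simp
  next
    case False
    then show ?thesis using nat[of x "nat (- k)"] k by simp
  qed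
qed


text \<open>The common form of the chain of sites and the chain of regrouped sites. As
  \<open>x mod 0 = x\<close>, the value \<open>K = 0\<close> describes the infinite line.\<close>

locale factor_chain =
  fixes K :: nat and A :: "int \<Rightarrow> 'a::cstar_algebra set" and T :: "'a \<Rightarrow> 'a"
  assumes factor: "factor (A x)"
    and periodic: "A (x + int K) = A x"
    and commuting: "x mod int K \<noteq> y mod int K \<Longrightarrow> A x \<subseteq> commutant (A y)"
    and dense: "closure (star_subalgebra hull (\<Union>x. A x)) = UNIV"
    and aut: "star_automorphism T"
    and shift: "T ` A x = A (x + 1)"
    and shift_periodic: "a \<in> A x \<Longrightarrow> (T ^^ K) a = a"
begin

definition alg :: "int set \<Rightarrow> 'a set" where
  "alg X = star_subalgebra hull (\<Union>x\<in>X. A x)"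

lemma star_A: "star_subalgebra (A x)"
  by (rule factor_star_subalgebra[OF factor])

lemma alg_single [simp]: "alg {x} = A x"
  by (simp add: alg_def hull_same star_A)

lemma star_alg [simp]: "star_subalgebra (alg X)"
  by (simp add: alg_def)

lemma A_subset_alg: "x \<in> X \<Longrightarrow> A x \<subseteq> alg X"
  unfolding alg_def by (auto intro: hull_inc)

lemma A_cong: "x mod int K = y mod int K \<Longrightarrow> A x = A y"
  using periodic by (rule periodic_mod_eq)

lemma alg_commute:
  assumes "\<And>x y. x \<in> X \<Longrightarrow> y \<in> Y \<Longrightarrow> x mod int K \<noteq> y mod int K"
  shows "alg X \<subseteq> commutant (alg Y)"
  unfolding alg_def
proof (rule hull_subset_commutant)
  have "b \<in> commutant (\<Union>y\<in>Y. A y)" if "b \<in> (\<Union>x\<in>X. A x)" for b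
    using that commuting assms by (fastforce simp: commutant_def subset_iff)
  then show "(\<Union>x\<in>X. A x) \<subseteq> commutant (star_subalgebra hull (\<Union>y\<in>Y. A y))"
    using star_subalgebraD(5)[OF star_A] by (blast intro: commutant_hull)
qed (rule star_subalgebraD(5)[OF star_subalgebra_hull])

text \<open>Distinct integers may name the same site of a ring, so a new index either adds nothing
  or contributes a commuting matrix algebra.\<close>

lemma factor_alg: "finite X \<Longrightarrow> factor (alg X)"
proof (induction X rule: finite_induct)
  case empty
  then show ?case by (simp add: alg_def factor_scalars)
next
  case (insert x X)
  show ?case
  proof (cases "\<exists>y\<in>X. x mod int K = y mod int K")
    case True
    then obtain y where "y \<in> X" "A x = A y" using A_cong by blast
    then have "(\<Union>x\<in>insert x X. A x) = (\<Union>x\<in>X. A x)" by blast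
    then have "alg (insert x X) = alg X" by (simp only: alg_def)
    then show ?thesis using insert by simp
  next
    case False
    then have "A x \<subseteq> commutant (alg X)" using alg_commute[of "{x}" X] by auto
    then have "factor (star_subalgebra hull (A x \<union> alg X))"
      by (intro factor_hull_Un factor insert)
    then show ?thesis by (simp add: alg_def hull_Un_hull)
  qed
qed

text \<open>The algebras of finite regions are directed under inclusion, so their union is already a
  star subalgebra.\<close>

lemma alg_UNIV_finite:
  assumes "a \<in> alg UNIV"
  obtains X where "finite X" "a \<in> alg X"
proof -
  have mono: "X \<subseteq> Y \<Longrightarrow> alg X \<subseteq> alg Y" for X Y
    unfolding alg_def by (intro hull_mono) auto
  have common: "\<exists>Z. finite Z \<and> a \<in> alg Z \<and> b \<in> alg Z"
    if "finite X" "a \<in> alg X" "finite Y" "b \<in> alg Y" for X Y a b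
    using that mono[of X "X \<union> Y"] mono[of Y "X \<union> Y"] by (intro exI[of _ "X \<union> Y"]) auto
  have "star_subalgebra {a. \<exists>X. finite X \<and> a \<in> alg X}"
    unfolding star_subalgebra_def
  proof (intro conjI ballI allI)
    show "1 \<in> {a. \<exists>X. finite X \<and> a \<in> alg X}"
      using star_subalgebraD(1)[OF star_alg] finite.emptyI by blast
    show "a + b \<in> {a. \<exists>X. finite X \<and> a \<in> alg X}" "a * b \<in> {a. \<exists>X. finite X \<and> a \<in> alg X}"
      if ab: "a \<in> {a. \<exists>X. finite X \<and> a \<in> alg X}" "b \<in> {a. \<exists>X. finite X \<and> a \<in> alg X}" for a b
    proof -
      obtain Z where "finite Z" "a \<in> alg Z" "b \<in> alg Z" using ab common by blast
      then show "a + b \<in> {a. \<exists>X. finite X \<and> a \<in> alg X}" "a * b \<in> {a. \<exists>X. finite X \<and> a \<in> alg X}"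
        using star_subalgebraD(2,3)[OF star_alg] by blast+
    qed
  qed (use star_subalgebraD(4,5)[OF star_alg] in blast)+
  moreover have "(\<Union>x. A x) \<subseteq> {a. \<exists>X. finite X \<and> a \<in> alg X}"
  proof
    fix b assume "b \<in> (\<Union>x. A x)"
    then obtain x where "b \<in> alg {x}" by auto
    then show "b \<in> {a. \<exists>X. finite X \<and> a \<in> alg X}" by blast
  qed
  ultimately have "alg UNIV \<subseteq> {a. \<exists>X. finite X \<and> a \<in> alg X}"
    unfolding alg_def by (intro hull_minimal)
  then show ?thesis using assms that by auto
qed

text \<open>Approximate \<open>a\<close> by an element \<open>a'\<close> of a finite region and
  average over the matrix algebra of that region. Up to normalisation, the average fixes
  \<open>a\<close>, sends \<open>a'\<close> to a scalar and does not increase norms, so scalars come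
  arbitrarily close to \<open>a\<close>; they form a closed set.\<close>

lemma scalar_if_central:
  assumes "\<And>x. a \<in> commutant (A x)"
  shows "\<exists>c. a = c *\<^sub>C 1"
proof -
  have "\<exists>c. dist (c *\<^sub>C 1) a < \<epsilon>" if "\<epsilon> > 0" for \<epsilon>
  proof -
    obtain a' where a': "a' \<in> alg UNIV" "dist a' a < \<epsilon>"
      using dense \<open>\<epsilon> > 0\<close> closure_approachable unfolding alg_def by (metis UNIV_I)
    obtain X where X: "finite X" "a' \<in> alg X" using alg_UNIV_finite a'(1) by blast
    obtain n e where e: "matrix_units {..<n::nat} e" and B: "alg X = matrix_units.units_span {..<n} e"
      using factor_alg[OF X(1)] by (rule factorE)
    interpret matrix_units "{..<n}" e by fact
    have n: "n > 0" using nonempty by auto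
    define avg where "avg b = (\<Sum>i<n. \<Sum>j<n. e i j * b * e j i)" for b
    obtain c where c: "a' = combo c" using X(2) B by (auto simp: units_span_def)
    have "avg a' = (\<Sum>i<n. \<Sum>j<n. c j j *\<^sub>C e i i)"
      unfolding avg_def c by (intro sum.cong refl unit_combo_unit) auto
    then have avg_a': "avg a' = (\<Sum>j<n. c j j) *\<^sub>C 1"
      by (simp add: sum_diag flip: scaleC_sum_left scaleC_sum_right)
    have comm: "a \<in> commutant (alg X)"
      unfolding alg_def
    proof (rule commutant_hull)
      show "a \<in> commutant (\<Union>x\<in>X. A x)" using assms by (auto simp: commutant_def)
    qed (use star_subalgebraD(5)[OF star_A] in blast)
    have "avg a = (\<Sum>i<n. \<Sum>j<n. a * e i i)"
      unfolding avg_def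
    proof (intro sum.cong refl)
      fix i j assume "i \<in> {..<n}" "j \<in> {..<n}"
      then show "e i j * a * e j i = a * e i i"
        using commutantD[OF comm, of "e i j"] unit_in_span[of i j] mult[of i j j i]
        by (simp add: B) (metis mult.assoc)
    qed
    then have "avg a = of_nat n *\<^sub>C a"
      using scaleC_of_real[of "real n" a]
      by (simp add: sum_diag scaleR_conv_of_real flip: sum_distrib_left)
    then have "real n * norm ((1 / of_nat n) *\<^sub>C avg a' - a) = norm (avg a' - avg a)"
      using n norm_scaleC[of "of_nat n" "(1 / of_nat n) *\<^sub>C avg a' - a"]
      by (simp add: scaleC_diff_right scaleC_scaleC)
    also have "avg a' - avg a = avg (a' - a)"
      by (simp add: avg_def algebra_simps sum_subtractf)
    also have "norm (avg (a' - a)) \<le> real n * norm (a' - a)"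
      unfolding avg_def by (rule norm_average_le) fact
    finally have "norm ((1 / of_nat n) *\<^sub>C avg a' - a) \<le> norm (a' - a)" using n by simp
    then show ?thesis using a'(2) avg_a' by (auto simp: dist_norm scaleC_scaleC intro: le_less_trans)
  qed
  then have "a \<in> closure (range (\<lambda>c. c *\<^sub>C 1))"
    unfolding closure_approachable by auto
  then show ?thesis
    using complete_scalars complete_imp_closed closure_closed by (metis imageE)
qed

text \<open>Haag duality for finite regions. Entries with respect to units of \<open>alg X\<close>
  commute with the region by construction and with its complement by assumption, so they are
  scalars.\<close>

lemma in_alg_if_commutes:
  assumes "finite X" "\<And>y. (\<And>x. x \<in> X \<Longrightarrow> y mod int K \<noteq> x mod int K) \<Longrightarrow> a \<in> commutant (A y)"
  shows "a \<in> alg X"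
proof -
  obtain n e where e: "matrix_units {..<n::nat} e" and B: "alg X = matrix_units.units_span {..<n} e"
    using factor_alg[OF assms(1)] by (rule factorE)
  interpret matrix_units "{..<n}" e by fact
  have "\<exists>c. component a i j = c *\<^sub>C 1" if ij: "i < n" "j < n" for i j
  proof (rule scalar_if_central)
    fix y
    show "component a i j \<in> commutant (A y)"
    proof (cases "\<exists>x\<in>X. y mod int K = x mod int K")
      case True
      then have "A y \<subseteq> units_span" using A_cong A_subset_alg B by metis
      then show ?thesis using component_commutant_units[of i j a] ij by (auto simp: commutant_def)
    next
      case False
      then have "alg X \<subseteq> commutant (A y)" using alg_commute[of X "{y}"] by fastforce
      then show ?thesis
        using False assms(2) ij by (intro component_commutant) (auto simp: B)
    qed
  qed
  then have "e i j * component a i j \<in> alg X" if "i < n" "j < n" for i j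
    using that unit_in_span[of i j] B star_subalgebraD(4)[OF star_alg, of "e i j" X]
    by (fastforce simp: mult_scaleC_right)
  then have "(\<Sum>i<n. \<Sum>j<n. e i j * component a i j) \<in> alg X"
    by (intro star_subalgebra_sum star_alg) auto
  then show ?thesis by (simp only: expansion)
qed

subsection \<open>Integer powers of the translation\<close>

definition shift_by :: "int \<Rightarrow> 'a \<Rightarrow> 'a" where
  "shift_by x = (if x \<ge> 0 then T ^^ nat x else inv T ^^ nat (- x))"

lemma T_inv [simp]: "T (inv T a) = a" "inv T (T a) = a"
  using star_automorphismD(1)[OF aut] by (auto simp: bij_is_inj bij_is_surj surj_f_inv_f)

lemma shift_by_0 [simp]: "shift_by 0 a = a"
  by (simp add: shift_by_def)

lemma shift_by_1 [simp]: "shift_by 1 a = T a"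
  by (simp add: shift_by_def)

lemma shift_by_Suc: "shift_by (x + 1) a = T (shift_by x a)"
proof (cases "x \<ge> 0")
  case True
  then show ?thesis by (simp add: shift_by_def nat_add_distrib)
next
  case False
  then have "nat (- x) = Suc (nat (- (x + 1)))" by simp
  then show ?thesis using False by (auto simp: shift_by_def)
qed

lemma shift_by_pred: "shift_by (x - 1) a = inv T (shift_by x a)"
  using shift_by_Suc[of "x - 1" a] by simp

lemma shift_by_add: "shift_by (x + y) a = shift_by x (shift_by y a)"
proof (induction x rule: int_induct[where k = 0])
  case (step1 x)
  have "shift_by (x + 1 + y) a = shift_by ((x + y) + 1) a" by (simp add: algebra_simps)
  then show ?case using step1 by (simp only: shift_by_Suc)
next
  case (step2 x)
  have "shift_by (x - 1 + y) a = shift_by ((x + y) - 1) a" by (simp add: algebra_simps)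
  then show ?case using step2 by (simp only: shift_by_pred)
qed simp

lemma aut_shift_by: "star_automorphism (shift_by x)"
  unfolding shift_by_def by (auto intro: star_automorphism_funpow star_automorphism_inv aut)

lemma shift_by_image: "shift_by y ` A x = A (x + y)"
proof (induction y rule: int_induct[where k = 0])
  case (step1 y)
  have "shift_by (y + 1) ` A x = T ` (shift_by y ` A x)"
    by (simp add: shift_by_Suc image_image)
  then show ?case using step1 shift by (simp add: algebra_simps)
next
  case (step2 y)
  have "inv T ` A z = A (z - 1)" for z
  proof -
    have "inv T ` (T ` A (z - 1)) = A (z - 1)" by (simp add: image_image)
    then show ?thesis by (simp add: shift)
  qed
  moreover have "shift_by (y - 1) ` A x = inv T ` (shift_by y ` A x)"
    by (simp add: shift_by_pred image_image)
  ultimately show ?case using step2 by (simp add: algebra_simps)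
qed simp

lemma shift_by_mem_iff: "shift_by y a \<in> A (x + y) \<longleftrightarrow> a \<in> A x"
  using inj_image_mem_iff[OF bij_is_inj[OF star_automorphismD(1)[OF aut_shift_by[of y]]], of a "A x"]
  by (simp add: shift_by_image)

lemma shift_by_commute:
  assumes "\<gamma> \<circ> T = T \<circ> \<gamma>"
  shows "\<gamma> (shift_by x a) = shift_by x (\<gamma> a)"
proof (induction x rule: int_induct[where k = 0])
  case (step1 x)
  then show ?case using fun_cong[OF assms] by (simp add: shift_by_Suc)
next
  case (step2 x)
  have "\<gamma> (inv T b) = inv T (\<gamma> b)" for b
    using fun_cong[OF assms, of "inv T b"] by (metis T_inv comp_apply)
  then show ?case using step2 by (simp add: shift_by_pred)
qed simp

end

text \<open>Conjugations are isometries, so convergence spreads from the dense algebra generated by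
  \<open>S\<close> to everything. The limit is again isometric; its range is complete, hence closed,
  and contains \<open>S\<close> by \<open>onto\<close>, so it is everything.\<close>

lemma limit_automorphism:
  fixes U :: "nat \<Rightarrow> 'a::cstar_algebra"
  assumes unitary: "\<And>n. is_unitary (U n)"
    and dense: "closure (star_subalgebra hull S) = UNIV"
    and eventually_const: "\<And>a. a \<in> S \<Longrightarrow> \<exists>b. \<forall>\<^sub>F n in sequentially. conj_by (U n) a = b"
    and onto: "\<And>b. b \<in> S \<Longrightarrow> \<exists>a. \<forall>\<^sub>F n in sequentially. conj_by (U n) a = b"
  obtains \<beta> where "star_automorphism \<beta>"
    "\<And>a b. \<forall>\<^sub>F n in sequentially. conj_by (U n) a = b \<Longrightarrow> \<beta> a = b"
proof -
  define f where "f n = conj_by (U n)" for n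
  have f: "f n 1 = 1" "f n (a + b) = f n a + f n b" "f n (a * b) = f n a * f n b"
    "f n (c *\<^sub>C a) = c *\<^sub>C f n a" "f n (adj a) = adj (f n a)" for n a b c
    using star_automorphismD[OF conj_by_star_automorphism[OF unitary]] by (simp_all add: f_def)
  have dist_f: "dist (f n a) (f n b) = dist a b" for n a b
  proof -
    have "f n a - f n b = f n (a - b)" by (simp add: f_def conj_by_def algebra_simps)
    then show ?thesis using norm_conj_by[OF unitary] by (simp add: dist_norm f_def)
  qed
  define C where "C = {a. convergent (\<lambda>n. f n a)}"
  have star: "star_subalgebra C"
    unfolding star_subalgebra_def C_def mem_Collect_eq f
    by (auto simp: convergent_const intro: convergent_add convergent_mult)
      (auto simp: convergent_def intro: bounded_linear.tendsto[OF bounded_linear_scaleC_right]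
        bounded_linear.tendsto[OF bounded_linear_adj])
  have conv: "convergent (\<lambda>n. f n a)" for a
  proof -
    have "star_subalgebra hull S \<subseteq> C"
    proof (rule hull_minimal[where S = star_subalgebra], rule subsetI)
      fix a assume "a \<in> S"
      then obtain b where "\<forall>\<^sub>F n in sequentially. f n a = b"
        using eventually_const unfolding f_def by blast
      then have "(\<lambda>n. f n a) \<longlonglongrightarrow> b" by (rule tendsto_eventually)
      then show "a \<in> C" by (auto simp: C_def convergent_def)
    qed (rule star)
    have "Cauchy (\<lambda>n. f n a)"
    proof (rule metric_CauchyI)
      fix \<epsilon> :: real assume "\<epsilon> > 0"
      then obtain b where b: "b \<in> star_subalgebra hull S" "dist b a < \<epsilon> / 3"
        using dense closure_approachable[of a "star_subalgebra hull S"] by (auto dest!: spec[of _ "\<epsilon> / 3"])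
      then have "Cauchy (\<lambda>n. f n b)"
        using \<open>star_subalgebra hull S \<subseteq> C\<close> by (auto simp: C_def Cauchy_convergent_iff)
      then obtain M where M: "\<And>m n. m \<ge> M \<Longrightarrow> n \<ge> M \<Longrightarrow> dist (f m b) (f n b) < \<epsilon> / 3"
        using metric_CauchyD \<open>\<epsilon> > 0\<close> by (metis divide_pos_pos zero_less_numeral)
      have "dist (f m a) (f n a) < \<epsilon>" if "m \<ge> M" "n \<ge> M" for m n
      proof -
        have "dist (f m a) (f n a) \<le> dist (f m a) (f m b) + dist (f m b) (f n b) + dist (f n b) (f n a)"
          using dist_triangle[of "f m a" "f n a" "f m b"] dist_triangle[of "f m b" "f n a" "f n b"] by linarith
        then show ?thesis
          using M[OF that] b(2) by (simp add: dist_f dist_commute)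
      qed
      then show "\<exists>M. \<forall>m\<ge>M. \<forall>n\<ge>M. dist (f m a) (f n a) < \<epsilon>" by blast
    qed
    then show ?thesis by (simp add: Cauchy_convergent_iff)
  qed
  define \<beta> where "\<beta> a = lim (\<lambda>n. f n a)" for a
  have lim: "(\<lambda>n. f n a) \<longlonglongrightarrow> \<beta> a" for a
    using conv by (simp add: \<beta>_def convergent_LIMSEQ_iff)
  have \<beta>_eq: "\<beta> a = b" if "(\<lambda>n. f n a) \<longlonglongrightarrow> b" for a b
    using LIMSEQ_unique[OF lim that] .
  have hom: "\<beta> 1 = 1" "\<beta> (a + b) = \<beta> a + \<beta> b" "\<beta> (a * b) = \<beta> a * \<beta> b"
    "\<beta> (c *\<^sub>C a) = c *\<^sub>C \<beta> a" "\<beta> (adj a) = adj (\<beta> a)" for a b c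
    using lim[of a] lim[of b]
    by (auto intro!: \<beta>_eq simp: f intro: tendsto_add tendsto_mult
        bounded_linear.tendsto[OF bounded_linear_scaleC_right] bounded_linear.tendsto[OF bounded_linear_adj])
  have norm: "norm (\<beta> a) = norm a" for a
  proof -
    have "(\<lambda>n. norm (f n a)) \<longlonglongrightarrow> norm (\<beta> a)" by (intro tendsto_norm lim)
    then show ?thesis
      using norm_conj_by[OF unitary] by (simp add: f_def LIMSEQ_const_iff)
  qed
  have bl: "bounded_linear \<beta>"
  proof (rule bounded_linear_intro[where K = 1])
    show "\<beta> (r *\<^sub>R a) = r *\<^sub>R \<beta> a" for r a
      using hom(4)[of "complex_of_real r" a] by (simp add: scaleC_of_real)
  qed (simp_all add: hom norm)
  have "inj \<beta>"
  proof (rule injI)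
    fix a b assume "\<beta> a = \<beta> b"
    then have "\<beta> (a - b) = 0" by (simp add: bounded_linear.linear[OF bl] linear_diff)
    then show "a = b" using norm[of "a - b"] by simp
  qed
  have "complete (range \<beta>)"
    by (rule complete_isometric_image[where e = 1]) (auto simp: norm bl complete_UNIV)
  then have "closed (range \<beta>)" by (rule complete_imp_closed)
  have "star_subalgebra (range \<beta>)"
    unfolding star_subalgebra_def
    by (intro conjI ballI allI; (elim rangeE)?; metis hom rangeI)
  moreover have "S \<subseteq> range \<beta>"
  proof
    fix b assume "b \<in> S"
    then obtain a where "\<forall>\<^sub>F n in sequentially. f n a = b" using onto unfolding f_def by blast
    then show "b \<in> range \<beta>" using \<beta>_eq[OF tendsto_eventually] by blast
  qed
  ultimately have "star_subalgebra hull S \<subseteq> range \<beta>" by (intro hull_minimal)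
  then have "range \<beta> = UNIV"
    using closure_minimal[OF _ \<open>closed (range \<beta>)\<close>] dense by blast
  then have "star_automorphism \<beta>"
    using \<open>inj \<beta>\<close> hom by (simp add: star_automorphism_def bij_def)
  moreover have "\<beta> a = b" if "\<forall>\<^sub>F n in sequentially. conj_by (U n) a = b" for a b
    using that by (intro \<beta>_eq tendsto_eventually) (simp add: f_def)
  ultimately show ?thesis using that by blast
qed

context factor_chain
begin

subsection \<open>On-site automorphisms and partial shifts\<close>

definition onsite_family :: "(int \<Rightarrow> 'a) \<Rightarrow> bool" where
  "onsite_family u \<longleftrightarrow> (\<forall>x. u x \<in> A x \<and> is_unitary (u x) \<and> T (u x) = u (x + 1))"

text \<open>On a ring the layer has to come with a specific implementing unitary, namely the ordered
  product over one period; the last conjunct records it.\<close>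

definition onsite :: "('a \<Rightarrow> 'a) \<Rightarrow> bool" where
  "onsite \<beta> \<longleftrightarrow> star_automorphism \<beta> \<and>
     (\<exists>u. onsite_family u \<and> (\<forall>x. \<forall>a\<in>A x. \<beta> a = conj_by (u x) a) \<and>
       (K > 0 \<longrightarrow> \<beta> = conj_by (prod_list (map u [0..int K - 1]))))"

definition pshift :: "('a \<Rightarrow> 'a) \<Rightarrow> bool" where
  "pshift \<sigma> \<longleftrightarrow> star_automorphism \<sigma> \<and>
     (\<exists>P Q. (\<forall>x. tensor_factors (A x) (P x) (Q x) \<and> T ` P x = P (x + 1) \<and> T ` Q x = Q (x + 1)) \<and>
            (\<forall>x. \<forall>b\<in>Q x. \<sigma> b = b) \<and>
            ((\<forall>x. \<forall>a\<in>P x. \<sigma> a = T a) \<or> (\<forall>x. \<forall>a\<in>P x. T (\<sigma> a) = a)))"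

lemma onsite_family_cong:
  assumes "onsite_family u" "x mod int K = y mod int K"
  shows "u x = u y"
proof -
  have "u (x + int n) = (T ^^ n) (u x)" for n x
  proof (induction n)
    case (Suc n)
    have "u (x + int n + 1) = T (u (x + int n))" using assms(1) by (simp add: onsite_family_def)
    then show ?case using Suc by (simp add: ac_simps)
  qed simp
  moreover have "u x \<in> A x" for x using assms(1) by (simp add: onsite_family_def)
  ultimately have "u (x + int K) = u x" for x
    using shift_periodic by metis
  then show ?thesis using assms(2) by (rule periodic_mod_eq)
qed

text \<open>With distinct residues at most one factor lives on the block of \<open>a\<close>; the
  others commute with \<open>a\<close> and cancel.\<close>

lemma conj_by_prod_list:
  assumes u: "onsite_family u" and "a \<in> A y" "distinct (map (\<lambda>x. x mod int K) xs)"
  shows "conj_by (prod_list (map u xs)) a =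
    (if \<exists>x\<in>set xs. x mod int K = y mod int K then conj_by (u y) a else a)"
  using assms(2,3)
proof (induction xs arbitrary: a)
  case Nil
  then show ?case by (simp add: conj_by_def)
next
  case (Cons x xs)
  have eq: "conj_by (prod_list (map u (x # xs))) a = conj_by (prod_list (map u xs)) (conj_by (u x) a)"
    by (simp add: conj_by_mult)
  have ux: "u x \<in> A x" "is_unitary (u x)" for x using u by (simp_all add: onsite_family_def)
  show ?case
  proof (cases "x mod int K = y mod int K")
    case True
    then have "u x = u y" using onsite_family_cong[OF u] by blast
    moreover have "conj_by (u y) a \<in> A y"
      using Cons.prems(1) ux star_subalgebraD[OF star_A] by (simp add: conj_by_def)
    moreover have "\<not> (\<exists>z\<in>set xs. z mod int K = y mod int K)"
    proof
      assume "\<exists>z\<in>set xs. z mod int K = y mod int K"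
      then have "x mod int K \<in> (\<lambda>x. x mod int K) ` set xs" unfolding True by (metis image_eqI)
      then show False using Cons.prems(2) by auto
    qed
    ultimately show ?thesis unfolding eq using Cons True by simp
  next
    case False
    then have "a * u x = u x * a"
      using commuting[of y x] Cons.prems(1) ux by (metis commutantD subsetD)
    then have "conj_by (u x) a = a"
      using ux(2)[of x] by (simp add: conj_by_def is_unitary_def mult.assoc) (metis mult.assoc mult_1_left)
    then show ?thesis unfolding eq using Cons False by simp
  qed
qed

lemma is_unitary_prod_list: "onsite_family u \<Longrightarrow> is_unitary (prod_list (map u xs))"
  by (induction xs) (auto simp: onsite_family_def is_unitary_mult)

lemma onsite_exists:
  assumes u: "onsite_family u"
  obtains \<beta> where "onsite \<beta>" "\<And>x a. a \<in> A x \<Longrightarrow> \<beta> a = conj_by (u x) a"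
proof (cases "K > 0")
  case True
  define \<beta> where "\<beta> = conj_by (prod_list (map u [0..int K - 1]))"
  have "distinct (map (\<lambda>x. x mod int K) [0..int K - 1])"
    using True by (auto simp: distinct_map inj_on_def)
  moreover have "y mod int K \<in> set [0..int K - 1]" for y using True by simp
  ultimately have act: "\<beta> a = conj_by (u y) a" if "a \<in> A y" for a y
    using conj_by_prod_list[OF u that, of "[0..int K - 1]"] unfolding \<beta>_def
    by (metis mod_mod_trivial)
  moreover have "star_automorphism \<beta>"
    unfolding \<beta>_def by (intro conj_by_star_automorphism is_unitary_prod_list u)
  ultimately have "onsite \<beta>" unfolding onsite_def using u \<beta>_def by blast
  then show ?thesis using act that by blast
next
  case False
  \<comment> \<open>On the line, the product over \<open>[- int n..int n]\<close> acts on a given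
    block in the same way as soon as it includes that block.\<close>
  define U where "U n = prod_list (map u [- int n..int n])" for n
  have ev: "\<forall>\<^sub>F n in sequentially. conj_by (U n) a = conj_by (u y) a" if "a \<in> A y" for a y
  proof (rule eventually_sequentiallyI)
    fix n assume "nat \<bar>y\<bar> \<le> n"
    then have "y \<in> set [- int n..int n]" by auto
    then show "conj_by (U n) a = conj_by (u y) a"
      unfolding U_def using conj_by_prod_list[OF u that, of "[- int n..int n]"] False by (auto simp: distinct_map)
  qed
  have uy: "u y \<in> A y" "is_unitary (u y)" for y using u by (simp_all add: onsite_family_def)
  obtain \<beta> where \<beta>: "star_automorphism \<beta>"
    "\<And>a b. \<forall>\<^sub>F n in sequentially. conj_by (U n) a = b \<Longrightarrow> \<beta> a = b"
  proof (rule limit_automorphism[of U "\<Union>x. A x"])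
    show "is_unitary (U n)" for n unfolding U_def by (intro is_unitary_prod_list u)
    show "\<exists>b. \<forall>\<^sub>F n in sequentially. conj_by (U n) a = b" if "a \<in> (\<Union>x. A x)" for a
      using that ev by blast
    show "\<exists>a. \<forall>\<^sub>F n in sequentially. conj_by (U n) a = b" if b: "b \<in> (\<Union>x. A x)" for b
    proof -
      obtain y where y: "b \<in> A y" using b by blast
      have "conj_by (adj (u y)) b \<in> A y"
        using y uy star_subalgebraD[OF star_A] by (simp add: conj_by_def)
      moreover have "conj_by (u y) (conj_by (adj (u y)) b) = b"
        using uy(2)[of y] by (simp add: conj_by_def is_unitary_def adj_adj mult.assoc) (metis mult.assoc mult_1_left)
      ultimately show ?thesis using ev by metis
    qed
  qed (use dense in auto)
  then have act: "\<beta> a = conj_by (u y) a" if "a \<in> A y" for a y using ev[OF that] by blast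
  then have "onsite \<beta>" unfolding onsite_def using u \<beta>(1) False by blast
  then show ?thesis using act that by blast
qed

text \<open>This is where three blocks are needed: neither 1 nor 2 may be a multiple of the number
  of blocks.\<close>

lemma mod_neq:
  assumes "K = 0 \<or> K \<ge> 3" "s \<in> {1, - 1 :: int}"
  shows "(x + s) mod int K \<noteq> x mod int K" "(x + s + s) mod int K \<noteq> x mod int K"
    "x mod int K \<noteq> (x + s) mod int K" "x mod int K \<noteq> (x + s + s) mod int K"
proof -
  have "\<not> int K dvd d" if "d \<noteq> 0" "\<bar>d\<bar> \<le> 2" for d
  proof
    assume "int K dvd d"
    then have "int K dvd \<bar>d\<bar>" by simp
    then have "K \<noteq> 0" "int K \<le> \<bar>d\<bar>" using that zdvd_imp_le[of "int K" "\<bar>d\<bar>"] by auto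
    then show False using that assms(1) by simp
  qed
  from this[of s] this[of "s + s"]
  show "(x + s) mod int K \<noteq> x mod int K" "(x + s + s) mod int K \<noteq> x mod int K"
    "x mod int K \<noteq> (x + s) mod int K" "x mod int K \<noteq> (x + s + s) mod int K"
    using assms(2) by (auto simp: mod_eq_dvd_iff algebra_simps)
qed

end

section \<open>Splitting the image of a block\<close>

text \<open>The image \<open>B x\<close> of \<open>A x\<close> overlaps only \<open>A x\<close> and \<open>A (x + s)\<close>. Commuting with the
  neighbouring images forces it to split along this overlap.\<close>

locale neighbour_automorphism = factor_chain K A T
  for K and A :: "int \<Rightarrow> 'a::cstar_algebra set" and T +
  fixes \<gamma> :: "'a \<Rightarrow> 'a" and s :: int
  assumes K: "K = 0 \<or> K \<ge> 3" and s: "s \<in> {1, -1}"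
    and aut_\<gamma>: "star_automorphism \<gamma>" and \<gamma>_T: "\<gamma> \<circ> T = T \<circ> \<gamma>"
    and range: "\<gamma> ` A x \<subseteq> alg {x, x + s}"
begin

definition B :: "int \<Rightarrow> 'a set" where "B x = \<gamma> ` A x"
definition stay :: "int \<Rightarrow> 'a set" where "stay x = B x \<inter> A x"
definition move :: "int \<Rightarrow> 'a set" where "move x = B x \<inter> A (x + s)"

lemma factor_B: "factor (B x)"
  unfolding B_def by (intro factor_image aut_\<gamma> factor)

lemma star_B: "star_subalgebra (B x)"
  by (rule factor_star_subalgebra[OF factor_B])

lemma star_stay: "star_subalgebra (stay x)" and star_move: "star_subalgebra (move x)"
  unfolding stay_def move_def by (intro star_subalgebra_Int star_B star_A)+

lemma B_cong: "x mod int K = y mod int K \<Longrightarrow> B x = B y"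
  unfolding B_def using A_cong by metis

lemma B_commute:
  assumes "x mod int K \<noteq> y mod int K"
  shows "B x \<subseteq> commutant (B y)"
proof -
  have "\<gamma> a * \<gamma> b = \<gamma> b * \<gamma> a" if "a \<in> A x" "b \<in> A y" for a b
    using commuting[OF assms] that by (metis commutantD star_automorphismD(4)[OF aut_\<gamma>] subsetD)
  then show ?thesis by (auto simp: B_def commutant_def)
qed

lemma A_B_commute:
  assumes "y mod int K \<noteq> x mod int K" "y mod int K \<noteq> (x + s) mod int K"
  shows "A y \<subseteq> commutant (B x)"
  using alg_commute[of "{y}" "{x, x + s}"] assms range[of x] by (fastforce simp: commutant_def B_def)

lemma in_A_if_commutes:
  assumes "\<And>y. y mod int K \<noteq> x mod int K \<Longrightarrow> a \<in> commutant (A y)"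
  shows "a \<in> A x"
  using in_alg_if_commutes[of "{x}" a] assms by simp

lemma in_B_if_commutes:
  assumes "\<And>y. y mod int K \<noteq> x mod int K \<Longrightarrow> a \<in> commutant (B y)"
  shows "a \<in> B x"
proof -
  have bij: "bij \<gamma>" by (rule star_automorphismD(1)[OF aut_\<gamma>])
  obtain b where b: "a = \<gamma> b" using bij by (metis bij_pointE)
  have "b \<in> A x"
  proof (rule in_A_if_commutes)
    fix y assume "y mod int K \<noteq> x mod int K"
    then have "\<gamma> (b * c) = \<gamma> (c * b)" if "c \<in> A y" for c
      using assms that by (simp add: b B_def commutant_def star_automorphismD(4)[OF aut_\<gamma>])
    then show "b \<in> commutant (A y)"
      using bij by (auto simp: commutant_def dest: bij_is_inj injD)
  qed
  then show ?thesis by (simp add: b B_def)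
qed

text \<open>Both memberships use duality. Taking entries removes the part on \<open>x + s\<close>,
  which leaves \<open>A x\<close>. For \<open>B x\<close>, the entry commutes with
  \<open>B (x + s)\<close> because that image lives on \<open>x + s\<close> and
  \<open>x + s + s\<close>, away from \<open>A x\<close>; it commutes with any other
  \<open>B y\<close> because both \<open>b\<close> and the units of \<open>A (x + s)\<close>
  do.\<close>

lemma component_stay:
  assumes "matrix_units I e" and e: "matrix_units.units_span I e = A (x + s)"
    and b: "b \<in> B x" and ij: "i \<in> I" "j \<in> I"
  shows "matrix_units.component I e b i j \<in> stay x"
proof -
  interpret matrix_units I e by fact
  note neq = mod_neq[OF K s, of x]
  have "component b i j \<in> A x"
  proof (rule in_A_if_commutes)
    fix y assume y: "y mod int K \<noteq> x mod int K"
    show "component b i j \<in> commutant (A y)"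
    proof (cases "y mod int K = (x + s) mod int K")
      case True
      then show ?thesis using component_commutant_units[OF ij] e A_cong by metis
    next
      case False
      then show ?thesis
        using A_B_commute[OF y False] b commuting[of "x + s" y] e
        by (intro component_commutant ij) (auto simp: commutant_def)
    qed
  qed
  moreover have "component b i j \<in> B x"
  proof (rule in_B_if_commutes)
    fix y assume y: "y mod int K \<noteq> x mod int K"
    show "component b i j \<in> commutant (B y)"
    proof (cases "y mod int K = (x + s) mod int K")
      case True
      then have "B y = B (x + s)" by (rule B_cong)
      then show ?thesis
        using A_B_commute[of x "x + s"] neq \<open>component b i j \<in> A x\<close> by auto
    next
      case False
      have "(x + s) mod int K \<noteq> (y + s) mod int K"
        using y by (metis add_diff_cancel_right' mod_diff_left_eq)
      then show ?thesis
        using B_commute[of x y] A_B_commute[of "x + s" y] y False b e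
        by (intro component_commutant ij) auto
    qed
  qed
  ultimately show ?thesis by (simp add: stay_def)
qed

lemma stay_move_commute: "stay x \<subseteq> commutant (move x)"
  using commuting[OF mod_neq(3)[OF K s, of x]] by (auto simp: stay_def move_def commutant_def)

text \<open>Every element of \<open>B x\<close> is a combination of elements of
  \<open>A (x + s)\<close> with entries in \<open>stay x\<close>. A central \<open>z\<close> of
  \<open>stay x\<close> commutes with both, so it is central in the matrix algebra
  \<open>B x\<close>.\<close>

lemma stay_centre:
  assumes "z \<in> stay x" "z \<in> commutant (stay x)"
  shows "\<exists>c. z = c *\<^sub>C 1"
proof (rule factor_centre[OF factor_B])
  show "z \<in> B x" using assms(1) by (simp add: stay_def)
  obtain n e where e: "matrix_units {..<n::nat} e" and A_eq: "A (x + s) = matrix_units.units_span {..<n} e"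
    using factor by (rule factorE)
  interpret matrix_units "{..<n}" e by fact
  have "z \<in> commutant {b}" if b: "b \<in> B x" for b
  proof -
    have star: "star_subalgebra (commutant {z, adj z})"
      by (rule star_subalgebra_commutant) (auto simp: adj_adj)
    have "A (x + s) \<subseteq> commutant {z, adj z}"
      using commuting[OF mod_neq(1)[OF K s, of x]] assms(1) star_subalgebraD(5)[OF star_A, of z x]
      by (auto simp: stay_def commutant_def)
    moreover have "stay x \<subseteq> commutant {z, adj z}"
      using star_subalgebraD(5)[OF star_subalgebra_commutant assms(2)] assms(2) star_subalgebraD(5)[OF star_stay]
      by (auto simp: commutant_def)
    moreover have "e i j \<in> A (x + s)" "component b i j \<in> stay x" if "i < n" "j < n" for i j
      using that component_stay[OF e A_eq[symmetric] b] unit_in_span A_eq by auto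
    ultimately have "(\<Sum>i<n. \<Sum>j<n. e i j * component b i j) \<in> commutant {z, adj z}"
      by (intro star_subalgebra_sum[OF star] star_subalgebraD(3)[OF star]) auto
    then show ?thesis unfolding expansion by (auto simp: commutant_def)
  qed
  then show "z \<in> commutant (B x)" by (auto simp: commutant_def)
qed

lemma factor_stay: "factor (stay x)"
  by (rule factor_if_trivial_centre[OF factor[of x] star_stay _ stay_centre]) (auto simp: stay_def)

text \<open>The entries of \<open>h\<close> lie in \<open>stay x\<close> and commute with it, so
  they are scalars; what remains is a combination of units of \<open>A (x + s)\<close>.\<close>

lemma in_move_if_commutes:
  assumes h: "h \<in> B x" "h \<in> commutant (stay x)"
  shows "h \<in> move x"
proof -
  obtain n e where e: "matrix_units {..<n::nat} e" and A_eq: "A (x + s) = matrix_units.units_span {..<n} e"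
    using factor by (rule factorE)
  interpret matrix_units "{..<n}" e by fact
  have "e i j * component h i j \<in> A (x + s)" if ij: "i < n" "j < n" for i j
  proof -
    have "component h i j \<in> commutant (stay x)"
      using commuting[OF mod_neq(1)[OF K s, of x]] ij A_eq
      by (intro component_commutant h) (auto simp: commutant_def stay_def)
    then obtain c where "component h i j = c *\<^sub>C 1"
      using stay_centre[of "component h i j" x] component_stay[OF e A_eq[symmetric] h(1), of i j] ij by auto
    then show ?thesis
      using unit_in_span[of i j] ij star_subalgebraD(4)[OF star_A, of "e i j" "x + s" c]
      by (simp add: mult_scaleC_right A_eq)
  qed
  then have "(\<Sum>i<n. \<Sum>j<n. e i j * component h i j) \<in> A (x + s)"
    by (intro star_subalgebra_sum star_A) auto
  then show ?thesis using h(1) unfolding expansion by (simp add: move_def)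
qed

text \<open>Now expand with respect to units of \<open>stay x\<close>: the entries lie in
  \<open>B x\<close> and commute with \<open>stay x\<close>, so they belong to
  \<open>move x\<close>.\<close>

lemma B_eq_hull: "B x = star_subalgebra hull (move x \<union> stay x)"
proof
  show "star_subalgebra hull (move x \<union> stay x) \<subseteq> B x"
    by (intro hull_minimal star_B) (auto simp: move_def stay_def)
  obtain n g where g: "matrix_units {..<n::nat} g" and stay_eq: "stay x = matrix_units.units_span {..<n} g"
    using factor_stay by (rule factorE)
  interpret matrix_units "{..<n}" g by fact
  show "B x \<subseteq> star_subalgebra hull (move x \<union> stay x)"
  proof
    fix b assume b: "b \<in> B x"
    have "component b i j \<in> move x" if "i < n" "j < n" for i j
    proof (rule in_move_if_commutes)
      show "component b i j \<in> B x"
        using unit_in_span stay_eq b that by (intro component_in star_B) (auto simp: stay_def)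
      show "component b i j \<in> commutant (stay x)"
        using component_commutant_units[of i j b] that stay_eq by simp
    qed
    moreover have "g i j \<in> stay x" if "i < n" "j < n" for i j using that unit_in_span stay_eq by simp
    ultimately have "(\<Sum>i<n. \<Sum>j<n. g i j * component b i j) \<in> star_subalgebra hull (move x \<union> stay x)"
      by (intro star_subalgebra_sum star_subalgebraD(3)[OF star_subalgebra_hull] star_subalgebra_hull)
        (auto intro: hull_inc)
    then show "b \<in> star_subalgebra hull (move x \<union> stay x)" by (simp only: expansion)
  qed
qed

lemma factor_move: "factor (move x)"
proof (rule factor_if_trivial_centre[OF factor[of "x + s"] star_move])
  show "move x \<subseteq> A (x + s)" by (simp add: move_def)
  fix z assume z: "z \<in> move x" "z \<in> commutant (move x)"
  show "\<exists>c. z = c *\<^sub>C 1"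
  proof (rule factor_centre[OF factor_B])
    show "z \<in> B x" using z(1) by (simp add: move_def)
    have "z \<in> commutant (move x \<union> stay x)"
      using z stay_move_commute[of x] by (auto simp: commutant_def)
    then show "z \<in> commutant (B x)"
      unfolding B_eq_hull using star_subalgebraD(5)[OF star_move] star_subalgebraD(5)[OF star_stay]
      by (intro commutant_hull) auto
  qed
qed

section \<open>Pulling the splitting back to the original blocks\<close>

definition P :: "int \<Rightarrow> 'a set" where "P x = inv \<gamma> ` move x"
definition Q :: "int \<Rightarrow> 'a set" where "Q x = inv \<gamma> ` stay x"

lemma \<gamma>_inv [simp]: "\<gamma> (inv \<gamma> a) = a" "inv \<gamma> (\<gamma> a) = a"
  using star_automorphismD(1)[OF aut_\<gamma>] by (auto simp: bij_is_inj bij_is_surj surj_f_inv_f)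

text \<open>In this form translation invariance of the family is immediate, since
  \<open>\<gamma>\<close> commutes with translations.\<close>

lemma mem_P_iff: "a \<in> P x \<longleftrightarrow> a \<in> A x \<and> \<gamma> a \<in> A (x + s)"
  unfolding P_def move_def B_def by (force intro: image_eqI[of _ _ "\<gamma> a"])

lemma mem_Q_iff: "a \<in> Q x \<longleftrightarrow> a \<in> A x \<and> \<gamma> a \<in> A x"
  unfolding Q_def stay_def B_def by (force intro: image_eqI[of _ _ "\<gamma> a"])

lemma factor_P: "factor (P x)" and factor_Q: "factor (Q x)"
  unfolding P_def Q_def
  by (intro factor_image star_automorphism_inv aut_\<gamma> factor_move factor_stay)+

lemma P_Q_commute: "P x \<subseteq> commutant (Q x)"
proof -
  have "a * b = b * a" if "a \<in> P x" "b \<in> Q x" for a b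
  proof -
    have "\<gamma> (a * b) = \<gamma> (b * a)"
      using that commuting[OF mod_neq(1)[OF K s, of x]]
      by (auto simp: mem_P_iff mem_Q_iff star_automorphismD(4)[OF aut_\<gamma>] commutant_def)
    then show ?thesis by (metis \<gamma>_inv(2))
  qed
  then show ?thesis by (auto simp: commutant_def)
qed

lemma A_eq_hull: "A x = star_subalgebra hull (P x \<union> Q x)"
proof -
  have "A x = inv \<gamma> ` B x" by (simp add: B_def image_image)
  then show ?thesis
    unfolding B_eq_hull P_def Q_def
    by (simp only: hull_image[OF star_automorphism_inv[OF aut_\<gamma>]] image_Un)
qed

lemma tensor_P_Q: "tensor_factors (A x) (P x) (Q x)"
  by (subst A_eq_hull) (intro tensor_factorsI factor_P factor_star_subalgebra factor_Q P_Q_commute)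

lemma shift_by_P: "shift_by y a \<in> P (x + y) \<longleftrightarrow> a \<in> P x"
  using shift_by_mem_iff[of y a x] shift_by_mem_iff[of y "\<gamma> a" "x + s"]
  by (simp add: mem_P_iff shift_by_commute[OF \<gamma>_T] algebra_simps)

lemma shift_by_Q: "shift_by y a \<in> Q (x + y) \<longleftrightarrow> a \<in> Q x"
  using shift_by_mem_iff[of y a x] shift_by_mem_iff[of y "\<gamma> a" x]
  by (simp add: mem_Q_iff shift_by_commute[OF \<gamma>_T] algebra_simps)

lemma onsite_unitary:
  obtains u where "u \<in> A 0" "is_unitary u"
    "\<And>a. a \<in> P 0 \<Longrightarrow> conj_by u a = shift_by (- s) (\<gamma> a)" "\<And>a. a \<in> Q 0 \<Longrightarrow> conj_by u a = \<gamma> a"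
proof -
  obtain m f where f: "matrix_units {..<m::nat} f" and P_eq: "P 0 = matrix_units.units_span {..<m} f"
    using factor_P by (rule factorE)
  obtain n g where g: "matrix_units {..<n::nat} g" and Q_eq: "Q 0 = matrix_units.units_span {..<n} g"
    using factor_Q by (rule factorE)
  interpret F: matrix_units "{..<m}" f by fact
  interpret G: matrix_units "{..<n}" g by fact
  have fP: "f i j \<in> P 0" if "i \<in> {..<m}" "j \<in> {..<m}" for i j using F.unit_in_span[OF that] P_eq by simp
  have gQ: "g i j \<in> Q 0" if "i \<in> {..<n}" "j \<in> {..<n}" for i j using G.unit_in_span[OF that] Q_eq by simp
  define \<gamma>' where "\<gamma>' = shift_by (- s) \<circ> \<gamma>"
  have aut': "star_automorphism \<gamma>'"
    unfolding \<gamma>'_def by (intro star_automorphism_comp aut_shift_by aut_\<gamma>)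
  have P': "\<gamma>' a \<in> A 0" if "a \<in> P 0" for a
    using shift_by_mem_iff[of "- s" "\<gamma> a" s] that by (simp add: \<gamma>'_def mem_P_iff)
  have comm: "f i j * g k l = g k l * f i j" if "i \<in> {..<m}" "j \<in> {..<m}" "k \<in> {..<n}" "l \<in> {..<n}" for i j k l
    using P_Q_commute[of 0] fP gQ that by (metis commutantD subsetD)
  \<comment> \<open>Translate before applying \<open>\<gamma>\<close>: the shifted
    \<open>P 0\<close> sits in the neighbouring block \<open>A (- s)\<close> and commutes with
    \<open>Q 0\<close>, and \<open>\<gamma>\<close> preserves this.\<close>
  have comm': "\<gamma>' (f i j) * \<gamma> (g k l) = \<gamma> (g k l) * \<gamma>' (f i j)"
    if "i \<in> {..<m}" "j \<in> {..<m}" "k \<in> {..<n}" "l \<in> {..<n}" for i j k l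
  proof -
    have "shift_by (- s) (f i j) \<in> A (- s)" "g k l \<in> A 0"
      using fP gQ that shift_by_mem_iff[of "- s" "f i j" 0] by (auto simp: mem_P_iff mem_Q_iff)
    moreover have "A (- s) \<subseteq> commutant (A 0)"
      using commuting[OF mod_neq(3)[OF K s, of "- s"]] by simp
    ultimately have "shift_by (- s) (f i j) * g k l = g k l * shift_by (- s) (f i j)"
      by (metis commutantD subsetD)
    then have "\<gamma> (shift_by (- s) (f i j)) * \<gamma> (g k l) = \<gamma> (g k l) * \<gamma> (shift_by (- s) (f i j))"
      by (metis star_automorphismD(4)[OF aut_\<gamma>])
    then show ?thesis by (simp add: \<gamma>'_def shift_by_commute[OF \<gamma>_T])
  qed
  interpret E: matrix_units "{..<m} \<times> {..<n}" "\<lambda>p q. f (fst p) (fst q) * g (snd p) (snd q)"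
    by (rule matrix_units_prod[OF f g comm])
  have span: "E.units_span = A 0"
    using units_span_prod[OF f g comm] P_eq Q_eq A_eq_hull[of 0] by simp
  have F': "matrix_units {..<m} (\<lambda>i j. \<gamma>' (f i j))" and G': "matrix_units {..<n} (\<lambda>i j. \<gamma> (g i j))"
    by (intro F.image G.image aut' aut_\<gamma>)+
  interpret G': matrix_units "{..<n}" "\<lambda>i j. \<gamma> (g i j)" by fact
  interpret F': matrix_units "{..<m}" "\<lambda>i j. \<gamma>' (f i j)" by fact
  have in_span: "\<gamma>' (f (fst p) (fst q)) * \<gamma> (g (snd p) (snd q)) \<in> E.units_span"
    if "p \<in> {..<m} \<times> {..<n}" "q \<in> {..<m} \<times> {..<n}" for p q
    unfolding span using that P' fP gQ by (intro star_subalgebraD(3)[OF star_A]) (auto simp: mem_Q_iff)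
  obtain u where u: "u \<in> E.units_span" "is_unitary u"
    and conj: "\<And>p q. p \<in> {..<m} \<times> {..<n} \<Longrightarrow> q \<in> {..<m} \<times> {..<n} \<Longrightarrow>
      conj_by u (f (fst p) (fst q) * g (snd p) (snd q)) = \<gamma>' (f (fst p) (fst q)) * \<gamma> (g (snd p) (snd q))"
    using E.skolem_noether[OF matrix_units_prod[OF F' G' comm'] in_span] by blast
  have aut_u: "star_automorphism (conj_by u)" by (rule conj_by_star_automorphism[OF u(2)])
  \<comment> \<open>Summing the product units over the diagonal of the second factor recovers the
    action on the first one alone.\<close>
  have "conj_by u (f i j) = \<gamma>' (f i j)" if "i \<in> {..<m}" "j \<in> {..<m}" for i j
  proof -
    have "conj_by u (f i j * (\<Sum>k<n. g k k)) = (\<Sum>k<n. \<gamma>' (f i j) * \<gamma> (g k k))"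
      using conj[of "(i, _)" "(j, _)"] that
      by (simp add: sum_distrib_left star_automorphism_sum[OF aut_u])
    then show ?thesis by (simp add: G.sum_diag G'.sum_diag flip: sum_distrib_left)
  qed
  then have "conj_by u a = \<gamma>' a" if "a \<in> P 0" for a
    using F.automorphism_eqI[OF aut_u aut'] that P_eq by blast
  moreover have "conj_by u (g k l) = \<gamma> (g k l)" if "k \<in> {..<n}" "l \<in> {..<n}" for k l
  proof -
    have "conj_by u ((\<Sum>i<m. f i i) * g k l) = (\<Sum>i<m. \<gamma>' (f i i) * \<gamma> (g k l))"
      using conj[of "(_, k)" "(_, l)"] that
      by (simp add: sum_distrib_right star_automorphism_sum[OF aut_u])
    then show ?thesis by (simp add: F.sum_diag F'.sum_diag flip: sum_distrib_right)
  qed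
  then have "conj_by u a = \<gamma> a" if "a \<in> Q 0" for a
    using G.automorphism_eqI[OF aut_u aut_\<gamma>] that Q_eq by blast
  ultimately show ?thesis
    using u by (intro that[of u]) (simp_all add: \<gamma>'_def span)
qed

theorem onsite_pshift_decomposition:
  obtains \<beta> \<sigma> where "onsite \<beta>" "pshift \<sigma>" "\<gamma> = \<beta> \<circ> \<sigma>"
proof -
  obtain u0 where u0: "u0 \<in> A 0" "is_unitary u0"
    and conj_P: "\<And>a. a \<in> P 0 \<Longrightarrow> conj_by u0 a = shift_by (- s) (\<gamma> a)"
    and conj_Q: "\<And>a. a \<in> Q 0 \<Longrightarrow> conj_by u0 a = \<gamma> a"
    using onsite_unitary by blast
  define u where "u x = shift_by x u0" for x
  note auts = star_automorphismD[OF aut_shift_by]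
  have "onsite_family u"
    unfolding onsite_family_def
  proof (intro allI conjI)
    fix x
    show "u x \<in> A x" using shift_by_mem_iff[of x u0 0] u0 by (simp add: u_def)
    show "T (u x) = u (x + 1)" by (simp add: u_def shift_by_Suc)
    show "is_unitary (u x)"
      using u0(2) by (simp add: is_unitary_def u_def auts(2) flip: auts(4,6))
  qed
  then obtain \<beta> where \<beta>: "onsite \<beta>" and act: "\<And>x a. a \<in> A x \<Longrightarrow> \<beta> a = conj_by (u x) a"
    using onsite_exists by blast
  have aut_\<beta>: "star_automorphism \<beta>" using \<beta> by (simp add: onsite_def)
  then have \<beta>_inv: "inv \<beta> (\<beta> a) = a" "\<beta> (inv \<beta> a) = a" for a
    using star_automorphismD(1)[of \<beta>] by (simp_all add: bij_is_inj bij_is_surj surj_f_inv_f)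
  have act_shift: "\<beta> (shift_by x a) = shift_by x (conj_by u0 a)" if "a \<in> A 0" for x a
    using act[of "shift_by x a" x] shift_by_mem_iff[of x a 0] that
    by (simp add: u_def conj_by_def auts(4,6))
  define \<sigma> where "\<sigma> = inv \<beta> \<circ> \<gamma>"
  have aut_\<sigma>: "star_automorphism \<sigma>"
    unfolding \<sigma>_def by (intro star_automorphism_comp star_automorphism_inv aut_\<beta> aut_\<gamma>)
  have Q_fixed: "\<sigma> b = b" if "b \<in> Q x" for x b
  proof -
    define b0 where "b0 = shift_by (- x) b"
    have b: "b = shift_by x b0" by (simp add: b0_def flip: shift_by_add)
    have b0: "b0 \<in> Q 0" using shift_by_Q[of x b0 0] that by (simp add: b)
    then have "\<beta> b = \<gamma> b"
      using act_shift[of b0 x] conj_Q by (simp add: b mem_Q_iff shift_by_commute[OF \<gamma>_T])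
    then show ?thesis unfolding \<sigma>_def by (metis \<beta>_inv(1) comp_apply)
  qed
  have P_shift: "\<sigma> a = shift_by s a" if "a \<in> P x" for x a
  proof -
    define a0 where "a0 = shift_by (- x) a"
    have a: "a = shift_by x a0" by (simp add: a0_def flip: shift_by_add)
    have a0: "a0 \<in> P 0" using shift_by_P[of x a0 0] that by (simp add: a)
    \<comment> \<open>The element \<open>shift_by s a\<close> lies in block \<open>x + s\<close>.
      There \<open>\<beta>\<close> is the translate of \<open>conj_by u0\<close>, whose built-in
      shift by \<open>- s\<close> cancels the extra shift by \<open>s\<close>.\<close>
    then have "\<beta> (shift_by s a) = \<gamma> a"
      using act_shift[of a0 "s + x"] conj_P[OF a0]
      by (simp add: a mem_P_iff shift_by_commute[OF \<gamma>_T] flip: shift_by_add)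
    then show ?thesis unfolding \<sigma>_def by (metis \<beta>_inv(1) comp_apply)
  qed
  have image: "T ` R x = R (x + 1)"
    if "\<And>x y a. shift_by y a \<in> R (x + y) \<longleftrightarrow> a \<in> R x" for R x
  proof
    show "T ` R x \<subseteq> R (x + 1)" using that[of 1] by auto
    show "R (x + 1) \<subseteq> T ` R x"
    proof
      fix a assume "a \<in> R (x + 1)"
      then have "inv T a \<in> R x" using that[of 1 "inv T a" x] by simp
      then show "a \<in> T ` R x" by (metis T_inv(1) image_eqI)
    qed
  qed
  have "(\<forall>x. \<forall>a\<in>P x. \<sigma> a = T a) \<or> (\<forall>x. \<forall>a\<in>P x. T (\<sigma> a) = a)"
    using s
  proof (elim insertE)
    assume "s = 1"
    then show ?thesis using P_shift by auto
  next
    assume "s = - 1"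
    moreover have "T (shift_by (- 1) a) = a" for a using shift_by_Suc[of "- 1" a] by simp
    ultimately show ?thesis using P_shift by auto
  qed simp
  then have "pshift \<sigma>"
    unfolding pshift_def
    using aut_\<sigma> tensor_P_Q image[of P, OF shift_by_P] image[of Q, OF shift_by_Q] Q_fixed by blast
  moreover have "\<gamma> = \<beta> \<circ> \<sigma>" by (simp add: \<sigma>_def fun_eq_iff \<beta>_inv)
  ultimately show ?thesis using that \<beta> by blast
qed

end

section \<open>Sites and blocks of a spin chain\<close>

lemma (in factor_chain) UNIV_eq_alg:
  assumes "finite X" "\<And>y. \<exists>x\<in>X. y mod int K = x mod int K"
  shows "alg X = UNIV"
  using in_alg_if_commutes[OF assms(1)] assms(2) by blast

text \<open>For \<open>K > 0\<close> finitely many blocks make up the whole algebra, which is then a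
  single matrix algebra, and Skolem-Noether applies to the image of its units.\<close>

lemma (in factor_chain) automorphism_inner:
  fixes \<sigma> :: "'a \<Rightarrow> 'a"
  assumes "K > 0" "star_automorphism \<sigma>"
  obtains W where "is_unitary W" "\<sigma> = conj_by W"
proof -
  have "\<exists>x\<in>{0..<int K}. y mod int K = x mod int K" for y
    using assms(1) by (intro bexI[of _ "y mod int K"]) auto
  then have "factor (UNIV :: 'a set)"
    using factor_alg[of "{0..<int K}"] UNIV_eq_alg[of "{0..<int K}"] by simp
  then obtain n e where e: "matrix_units {..<n::nat} e" and UNIV_eq: "(UNIV :: 'a set) = matrix_units.units_span {..<n} e"
    by (rule factorE)
  interpret matrix_units "{..<n}" e by fact
  have in_span: "\<sigma> (e i j) \<in> units_span" for i j by (simp flip: UNIV_eq)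
  obtain W where W: "is_unitary W" "\<And>i j. i \<in> {..<n} \<Longrightarrow> j \<in> {..<n} \<Longrightarrow> conj_by W (e i j) = \<sigma> (e i j)"
    by (rule skolem_noether[OF image[OF assms(2)] in_span]) (rule that; simp)
  have "\<sigma> a = conj_by W a" for a
    by (rule automorphism_eqI[OF assms(2) conj_by_star_automorphism[OF W(1)]])
      (simp_all add: W(2) flip: UNIV_eq)
  then show ?thesis using that W(1) by blast
qed

section \<open>Single-site matrix algebras as factors\<close>

definition matrix_unit :: "'d::finite \<Rightarrow> 'd \<Rightarrow> complex^'d^'d" where
  "matrix_unit i j = (\<chi> a b. if a = i \<and> b = j then 1 else 0)"

lemma matrix_expansion:
  "(\<Sum>i\<in>UNIV. \<Sum>j\<in>UNIV. map_matrix ((*) (M $ i $ j)) (matrix_unit i j)) = M"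
proof -
  have "(\<Sum>i\<in>UNIV. \<Sum>j\<in>UNIV. map_matrix ((*) (M $ i $ j)) (matrix_unit i j)) $ a $ b = M $ a $ b" for a b
  proof -
    have "(\<Sum>i\<in>UNIV. \<Sum>j\<in>UNIV. map_matrix ((*) (M $ i $ j)) (matrix_unit i j)) $ a $ b
        = (\<Sum>i\<in>UNIV. \<Sum>j\<in>UNIV. if b = j then if a = i then M $ i $ j else 0 else 0)"
      by (simp only: sum_component nth_map_matrix matrix_unit_def vec_lambda_beta) (intro sum.cong refl; auto)
    then show ?thesis by simp
  qed
  then show ?thesis by (simp add: vec_eq_iff)
qed

lemma factor_range_matrix_star_hom:
  fixes \<phi> :: "complex^'d^'d \<Rightarrow> 'a::cstar_algebra"
  assumes "matrix_star_hom \<phi>"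
  shows "factor (range \<phi>)"
proof -
  have \<phi>: "\<phi> (mat 1) = 1" "\<phi> (M + N) = \<phi> M + \<phi> N" "\<phi> (M ** N) = \<phi> M * \<phi> N"
    "\<phi> (map_matrix ((*) c) M) = c *\<^sub>C \<phi> M" "\<phi> (map_matrix cnj (transpose M)) = adj (\<phi> M)" for M N c
    using assms by (auto simp: matrix_star_hom_def)
  have zero: "\<phi> 0 = 0" using \<phi>(2)[of 0 0] by simp
  have sum: "\<phi> (\<Sum>i\<in>I. M i) = (\<Sum>i\<in>I. \<phi> (M i))" for M and I :: "'d set"
    by (induction I rule: infinite_finite_induct) (auto simp: zero \<phi>(2))
  interpret matrix_units UNIV "\<lambda>i j. \<phi> (matrix_unit i j)"
  proof
    fix i j k l :: 'd
    have "(\<Sum>c\<in>UNIV. (if a = i \<and> c = j then 1 else 0) * (if c = k \<and> b = l then 1 else 0)) =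
        (\<Sum>c\<in>UNIV. if c = j then if j = k \<and> a = i \<and> b = l then 1 else 0 else (0::complex))" for a b
      by (intro sum.cong) auto
    then have "matrix_unit i j ** matrix_unit k l = (if j = k then matrix_unit i l else 0)"
      by (simp add: matrix_unit_def matrix_matrix_mult_def vec_eq_iff)
    then show "\<phi> (matrix_unit i j) * \<phi> (matrix_unit k l) = (if j = k then \<phi> (matrix_unit i l) else 0)"
      by (simp add: zero flip: \<phi>(3))
    have "map_matrix cnj (transpose (matrix_unit i j)) = matrix_unit j i"
      by (auto simp: matrix_unit_def map_matrix_def transpose_def vec_eq_iff)
    then show "adj (\<phi> (matrix_unit i j)) = \<phi> (matrix_unit j i)"
      by (simp flip: \<phi>(5))
  next
    have "(\<Sum>i\<in>UNIV. matrix_unit i i) $ a $ b = (mat 1 :: complex^'d^'d) $ a $ b" for a b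
    proof -
      have "(\<Sum>i\<in>UNIV. matrix_unit i i) $ a $ b = (\<Sum>i\<in>UNIV. if i = a then if a = b then 1 else 0 else (0::complex))"
        by (simp only: sum_component matrix_unit_def vec_lambda_beta) (intro sum.cong refl; auto)
      then show ?thesis by (simp add: mat_def)
    qed
    then have "(\<Sum>i\<in>UNIV. matrix_unit i i) = (mat 1 :: complex^'d^'d)" by (simp add: vec_eq_iff)
    then show "(\<Sum>i\<in>UNIV. \<phi> (matrix_unit i i)) = 1" by (simp add: \<phi>(1) flip: sum)
  qed simp
  have "\<phi> M = combo (\<lambda>i j. M $ i $ j)" for M
    unfolding combo_def by (subst (1) matrix_expansion[of M, symmetric]) (simp only: sum \<phi>(4))
  moreover have "combo c = \<phi> (\<Sum>i\<in>UNIV. \<Sum>j\<in>UNIV. map_matrix ((*) (c i j)) (matrix_unit i j))" for c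
    unfolding combo_def by (simp only: sum \<phi>(4))
  ultimately have "range \<phi> = units_span" unfolding units_span_def by blast
  then show ?thesis using factor by simp
qed

section \<open>Single sites and regrouped sites as chains of factors\<close>

locale spin_chain_locale =
  fixes N :: nat and \<iota> :: "int \<Rightarrow> complex^'d^'d \<Rightarrow> 'a::cstar_algebra" and \<tau> :: "'a \<Rightarrow> 'a"
  assumes chain: "spin_chain N \<iota> \<tau>"
begin

lemma translate: "(\<tau> ^^ m) (\<iota> n M) = \<iota> (n + int m) M"
  using chain by (induction m) (simp_all add: spin_chain_def ac_simps)

sublocale sites: factor_chain N "\<lambda>n. range (\<iota> n)" \<tau>
proof
  fix x y a
  show "factor (range (\<iota> x))"
    using chain by (intro factor_range_matrix_star_hom) (simp add: spin_chain_def)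
  show "range (\<iota> (x + int N)) = range (\<iota> x)" using chain by (simp add: spin_chain_def)
  show "range (\<iota> x) \<subseteq> commutant (range (\<iota> y))" if "x mod int N \<noteq> y mod int N"
    using chain that by (auto simp: spin_chain_def commutant_def)
  show "closure (star_subalgebra hull (\<Union>n. range (\<iota> n))) = UNIV"
    using chain by (simp add: spin_chain_def loc_alg_def)
  show "star_automorphism \<tau>" using chain by (simp add: spin_chain_def)
  show "\<tau> ` range (\<iota> x) = range (\<iota> (x + 1))" using chain by (simp add: spin_chain_def image_image)
  show "(\<tau> ^^ N) a = a" if "a \<in> range (\<iota> x)"
    using chain that by (auto simp: translate spin_chain_def)
qed

lemma loc_alg_eq: "loc_alg \<iota> X = sites.alg X"
  by (simp add: loc_alg_def sites.alg_def)

lemma site_in_loc_alg: "n \<in> X \<Longrightarrow> \<iota> n M \<in> loc_alg \<iota> X"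
  unfolding loc_alg_def by (auto intro: hull_inc)

lemma loc_alg_subset:
  "star_subalgebra C \<Longrightarrow> (\<And>n M. n \<in> X \<Longrightarrow> \<iota> n M \<in> C) \<Longrightarrow> loc_alg \<iota> X \<subseteq> C"
  unfolding loc_alg_def by (intro hull_minimal) auto

lemma translate_loc_alg: "(\<tau> ^^ m) ` loc_alg \<iota> X = loc_alg \<iota> ((\<lambda>n. n + int m) ` X)"
  unfolding loc_alg_def hull_image[OF star_automorphism_funpow[OF sites.aut]]
  by (simp add: image_UN image_image translate)

lemma translate_period: "(\<tau> ^^ N) a = a" if "a \<in> loc_alg \<iota> X"
proof -
  have "star_subalgebra {a. (\<tau> ^^ N) a = a}"
    unfolding star_subalgebra_def
    by (simp add: star_automorphismD[OF star_automorphism_funpow[OF sites.aut]])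
  then have "loc_alg \<iota> X \<subseteq> {a. (\<tau> ^^ N) a = a}"
    using sites.shift_periodic by (intro loc_alg_subset) blast+
  then show ?thesis using that by blast
qed

end

locale block_chain = spin_chain_locale N \<iota> \<tau>
  for N \<iota> and \<tau> :: "'a::cstar_algebra \<Rightarrow> 'a" +
  fixes k :: nat
  assumes k_pos: "k \<ge> 1" and k_dvd: "k dvd N"
begin

lemma mem_block_iff: "n \<in> {int k * x..<int k * (x + 1)} \<longleftrightarrow> n div int k = x"
proof -
  have "n div int k = x \<longleftrightarrow> int k * x \<le> n \<and> n < int k * x + int k"
  proof
    assume x: "n div int k = x"
    have "int k > 0" using k_pos by simp
    then show "int k * x \<le> n \<and> n < int k * x + int k"
      using mult_div_mod_eq[of "int k" n] pos_mod_bound[of "int k" n] pos_mod_sign[of "int k" n]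
      unfolding x by linarith
  next
    assume n: "int k * x \<le> n \<and> n < int k * x + int k"
    show "n div int k = x"
      by (rule int_div_pos_eq[of _ _ _ "n - int k * x"]) (use n in auto)
  qed
  then show ?thesis by (auto simp: algebra_simps)
qed

lemma N_eq: "int N = int k * int (N div k)"
  using k_dvd by (simp flip: of_nat_mult)

sublocale blocks: factor_chain "N div k" "block_alg \<iota> k" "\<tau> ^^ k"
proof
  fix x y a
  show "factor (block_alg \<iota> k x)"
    unfolding block_alg_def loc_alg_eq by (intro sites.factor_alg) simp
  have "(\<Union>n\<in>{int k * (x + int (N div k))..<int k * (x + int (N div k) + 1)}. range (\<iota> n)) =
      (\<Union>n\<in>(\<lambda>n. n + int N) ` {int k * x..<int k * (x + 1)}. range (\<iota> n))"
    by (simp add: N_eq algebra_simps)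
  also have "\<dots> = (\<Union>n\<in>{int k * x..<int k * (x + 1)}. range (\<iota> n))"
    by (simp only: image_image sites.periodic)
  finally show "block_alg \<iota> k (x + int (N div k)) = block_alg \<iota> k x"
    by (simp add: block_alg_def loc_alg_def)
  show "block_alg \<iota> k x \<subseteq> commutant (block_alg \<iota> k y)" if "x mod int (N div k) \<noteq> y mod int (N div k)"
    unfolding block_alg_def loc_alg_eq
  proof (rule sites.alg_commute)
    fix m n assume m: "m \<in> {int k * x..<int k * (x + 1)}" and n: "n \<in> {int k * y..<int k * (y + 1)}"
    show "m mod int N \<noteq> n mod int N"
    proof
      assume "m mod int N = n mod int N"
      then obtain j where "m = n + int N * j" by (metis mod_eqE add.commute diff_add_cancel uminus_add_conv_diff)
      then have "m = n + int k * (int (N div k) * j)" using N_eq by (simp add: mult.assoc)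
      then have "m div int k = n div int k + int (N div k) * j" using k_pos by simp
      then have "x = y + int (N div k) * j" using m n unfolding mem_block_iff by simp
      then show False using that by simp
    qed
  qed
  have "star_subalgebra hull (\<Union>n. range (\<iota> n)) \<subseteq> star_subalgebra hull (\<Union>x. block_alg \<iota> k x)"
  proof (rule hull_mono, rule subsetI)
    fix a assume "a \<in> (\<Union>n. range (\<iota> n))"
    then obtain n M where a: "a = \<iota> n M" by blast
    have "a \<in> block_alg \<iota> k (n div int k)"
      unfolding block_alg_def a by (rule site_in_loc_alg) (subst mem_block_iff, rule refl)
    then show "a \<in> (\<Union>x. block_alg \<iota> k x)" by blast
  qed
  then show "closure (star_subalgebra hull (\<Union>x. block_alg \<iota> k x)) = UNIV"
    using closure_mono sites.dense by blast
  show "star_automorphism (\<tau> ^^ k)" by (rule star_automorphism_funpow[OF sites.aut])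
  show "(\<tau> ^^ k) ` block_alg \<iota> k x = block_alg \<iota> k (x + 1)"
    by (simp add: block_alg_def translate_loc_alg algebra_simps)
  show "((\<tau> ^^ k) ^^ (N div k)) a = a" if "a \<in> block_alg \<iota> k x"
    using translate_period that k_dvd by (simp add: block_alg_def funpow_mult mult.commute)
qed

lemma loc_alg_subset_blocks:
  assumes "\<And>n. n \<in> X \<Longrightarrow> n div int k \<in> Y"
  shows "loc_alg \<iota> X \<subseteq> blocks.alg Y"
proof (rule loc_alg_subset)
  fix n M assume n: "n \<in> X"
  have "\<iota> n M \<in> block_alg \<iota> k (n div int k)"
    unfolding block_alg_def by (rule site_in_loc_alg) (subst mem_block_iff, rule refl)
  then show "\<iota> n M \<in> blocks.alg Y" using blocks.A_subset_alg assms n by blast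
qed simp

lemma partial_shift_iff: "partial_shift \<iota> \<tau> k = blocks.pshift"
  by (simp add: fun_eq_iff partial_shift_def blocks.pshift_def)

lemma onsite_unitaries_iff: "onsite_unitaries \<iota> \<tau> k = blocks.onsite_family"
  by (simp add: fun_eq_iff onsite_unitaries_def blocks.onsite_family_def)

lemma onsite_automorphismI: "blocks.onsite \<beta> \<Longrightarrow> onsite_automorphism \<iota> \<tau> k \<beta>"
  unfolding onsite_automorphism_def blocks.onsite_def onsite_unitaries_iff by blast

lemma onsite_layerE:
  assumes "blocks.onsite \<beta>" "N > 0"
  obtains V where "is_unitary V" "onsite_layer_unitary N \<iota> \<tau> k V" "\<beta> = conj_by V"
proof -
  have "N div k > 0" using k_pos k_dvd assms(2) by (simp add: dvd_imp_le div_greater_zero_iff)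
  then show ?thesis
    using assms(1) that blocks.is_unitary_prod_list
    unfolding blocks.onsite_def onsite_layer_unitary_def onsite_unitaries_iff by blast
qed

text \<open>The automorphism \<open>\<tau>\<^sup>-\<^sup>L \<alpha>\<close> has a one-sided neighbourhood, and so has \<open>\<tau>\<^sup>L\<close>.\<close>

theorem decomposition:
  assumes size: "2 * L \<le> k" "N = 0 \<or> 3 * k \<le> N"
    and \<alpha>: "star_automorphism \<alpha>" "\<alpha> \<circ> \<tau> = \<tau> \<circ> \<alpha>" "causal \<iota> L \<alpha>"
  obtains \<beta>1 \<sigma>1 \<beta>2 \<sigma>2 where "blocks.onsite \<beta>1" "blocks.pshift \<sigma>1" "blocks.onsite \<beta>2" "blocks.pshift \<sigma>2"
    "\<alpha> = \<beta>1 \<circ> \<sigma>1 \<circ> (\<beta>2 \<circ> \<sigma>2)"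
proof -
  have K: "N div k = 0 \<or> N div k \<ge> 3"
    using size(2) k_pos by (auto simp: less_eq_div_iff_mult_less_eq)
  have aut_L: "star_automorphism (\<tau> ^^ m)" for m by (rule star_automorphism_funpow[OF sites.aut])
  have inv_L: "inv (\<tau> ^^ L) ((\<tau> ^^ L) a) = a" "(\<tau> ^^ L) (inv (\<tau> ^^ L) a) = a" for a
    using star_automorphismD(1)[OF aut_L[of L]] by (simp_all add: bij_is_inj bij_is_surj surj_f_inv_f)
  have comm: "(\<tau> ^^ m) ((\<tau> ^^ n) a) = (\<tau> ^^ n) ((\<tau> ^^ m) a)" for m n a
    by (metis add.commute comp_apply funpow_add)
  have \<alpha>_comm: "\<alpha> ((\<tau> ^^ m) a) = (\<tau> ^^ m) (\<alpha> a)" for m a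
    using fun_cong[OF \<alpha>(2)] by (induction m) simp_all
  have right: "neighbour_automorphism (N div k) (block_alg \<iota> k) (\<tau> ^^ k) (\<tau> ^^ L) 1"
  proof
    show "\<tau> ^^ L \<circ> \<tau> ^^ k = \<tau> ^^ k \<circ> \<tau> ^^ L" by (simp add: fun_eq_iff comm)
    fix x
    \<comment> \<open>The translated block still meets only one neighbour because
      \<open>L \<le> k\<close>.\<close>
    have "n div int k \<in> {x, x + 1}" if "int k * x + int L \<le> n" "n < int k * (x + 1) + int L" for n
      using that size(1) mem_block_iff[of n x] mem_block_iff[of n "x + 1"] by (auto simp: algebra_simps)
    then show "(\<tau> ^^ L) ` block_alg \<iota> k x \<subseteq> blocks.alg {x, x + 1}"
      unfolding block_alg_def[of \<iota> k x] translate_loc_alg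
      by (intro loc_alg_subset_blocks) (auto simp: algebra_simps)
  qed (use K aut_L in auto)
  have left: "neighbour_automorphism (N div k) (block_alg \<iota> k) (\<tau> ^^ k) (inv (\<tau> ^^ L) \<circ> \<alpha>) (- 1)"
  proof
    show aut: "star_automorphism (inv (\<tau> ^^ L) \<circ> \<alpha>)"
      by (intro star_automorphism_comp star_automorphism_inv aut_L \<alpha>(1))
    have "inv (\<tau> ^^ L) ((\<tau> ^^ k) a) = (\<tau> ^^ k) (inv (\<tau> ^^ L) a)" for a
      using comm[of k L "inv (\<tau> ^^ L) a"] by (metis inv_L)
    then show "inv (\<tau> ^^ L) \<circ> \<alpha> \<circ> \<tau> ^^ k = \<tau> ^^ k \<circ> (inv (\<tau> ^^ L) \<circ> \<alpha>)"
      by (simp add: fun_eq_iff \<alpha>_comm)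
    fix x
    have "block_alg \<iota> k x \<subseteq> (inv (\<tau> ^^ L) \<circ> \<alpha>) -` blocks.alg {x, x + - 1}"
      unfolding block_alg_def[of \<iota> k x]
    proof (rule loc_alg_subset)
      show "star_subalgebra ((inv (\<tau> ^^ L) \<circ> \<alpha>) -` blocks.alg {x, x + - 1})"
        by (intro star_subalgebra_vimage aut blocks.star_alg)
      fix n M assume n: "n \<in> {int k * x..<int k * (x + 1)}"
      have "\<alpha> (\<iota> n M) \<in> loc_alg \<iota> {n - int L..n + int L}" using \<alpha>(3) by (simp add: causal_def)
      \<comment> \<open>Undoing the translation moves the right end of the window back to
        \<open>n\<close>; its left end stays within one block of \<open>x\<close> because
        \<open>2 * L \<le> k\<close>.\<close>
      also have "{n - int L..n + int L} = (\<lambda>m. m + int L) ` {n - 2 * int L..n}" by simp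
      finally have "\<alpha> (\<iota> n M) \<in> (\<tau> ^^ L) ` loc_alg \<iota> {n - 2 * int L..n}"
        unfolding translate_loc_alg .
      then have "inv (\<tau> ^^ L) (\<alpha> (\<iota> n M)) \<in> loc_alg \<iota> {n - 2 * int L..n}"
        by (auto simp: inv_L)
      moreover have "m div int k \<in> {x, x + - 1}" if "m \<in> {n - 2 * int L..n}" for m
        using that n size(1) mem_block_iff[of m x] mem_block_iff[of m "x - 1"] by (auto simp: algebra_simps)
      then have "loc_alg \<iota> {n - 2 * int L..n} \<subseteq> blocks.alg {x, x + - 1}"
        by (rule loc_alg_subset_blocks)
      ultimately show "\<iota> n M \<in> (inv (\<tau> ^^ L) \<circ> \<alpha>) -` blocks.alg {x, x + - 1}" by auto
    qed
    then show "(inv (\<tau> ^^ L) \<circ> \<alpha>) ` block_alg \<iota> k x \<subseteq> blocks.alg {x, x + - 1}" by blast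
  qed (use K in auto)
  obtain \<beta>1 \<sigma>1 where 1: "blocks.onsite \<beta>1" "blocks.pshift \<sigma>1" "\<tau> ^^ L = \<beta>1 \<circ> \<sigma>1"
    using neighbour_automorphism.onsite_pshift_decomposition[OF right] by blast
  obtain \<beta>2 \<sigma>2 where 2: "blocks.onsite \<beta>2" "blocks.pshift \<sigma>2" "inv (\<tau> ^^ L) \<circ> \<alpha> = \<beta>2 \<circ> \<sigma>2"
    using neighbour_automorphism.onsite_pshift_decomposition[OF left] by blast
  have "\<alpha> = \<beta>1 \<circ> \<sigma>1 \<circ> (\<beta>2 \<circ> \<sigma>2)"
    unfolding 1(3)[symmetric] 2(3)[symmetric] by (simp add: fun_eq_iff inv_L)
  then show ?thesis using that 1 2 by blast
qed

end

section \<open>Conclusion for the line and for rings\<close>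

lemma infinite_qca_decomposition:
  assumes "infinite_qca \<iota> \<tau> L \<alpha>"
  shows "infinite_decomposition \<iota> \<tau> (max 1 (2 * L)) \<alpha>"
proof -
  \<comment> \<open>The maximum with 1 keeps blocks nonempty for \<open>L = 0\<close>. Every size
    divides 0, and \<open>0 div k = 0\<close> makes the chain of blocks a line again.\<close>
  interpret block_chain 0 \<iota> \<tau> "max 1 (2 * L)"
    using assms by unfold_locales (auto simp: infinite_qca_def)
  obtain \<beta>1 \<sigma>1 \<beta>2 \<sigma>2 where d: "blocks.onsite \<beta>1" "blocks.pshift \<sigma>1" "blocks.onsite \<beta>2" "blocks.pshift \<sigma>2"
    "\<alpha> = \<beta>1 \<circ> \<sigma>1 \<circ> (\<beta>2 \<circ> \<sigma>2)"
    using decomposition[of L \<alpha>] assms unfolding infinite_qca_def by (metis max.cobounded2)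
  show ?thesis
    unfolding infinite_decomposition_def
    using d onsite_automorphismI partial_shift_iff
    by (intro exI[of _ "[\<beta>1, \<sigma>1, \<beta>2, \<sigma>2]"]) (auto simp: comp_assoc)
qed

text \<open>Equal conjugations make \<open>U * adj W\<close> central, hence a scalar, and unitarity
  makes that scalar a phase.\<close>

lemma scalar_multiple_if_conj_by_eq:
  fixes U W :: "'a::cstar_algebra"
  assumes U: "is_unitary U" and W: "is_unitary W" and eq: "conj_by U = conj_by W"
    and central: "\<And>z::'a. (\<And>a. z * a = a * z) \<Longrightarrow> \<exists>c. z = c *\<^sub>C 1"
  obtains c where "U = c *\<^sub>C W" "cnj c * c = 1"
proof -
  have u: "adj U * U = 1" "U * adj U = 1" and w: "adj W * W = 1" "W * adj W = 1"
    using U W by (simp_all add: is_unitary_def)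
  have "U * adj W * a = a * (U * adj W)" for a
  proof -
    have "adj U * a * U = adj W * a * W" using fun_cong[OF eq, of a] by (simp add: conj_by_def)
    then have "U * (adj U * a * U) * adj W = U * (adj W * a * W) * adj W" by simp
    moreover have "U * (adj U * a * U) * adj W = (U * adj U) * a * (U * adj W)" by (simp only: mult.assoc)
    moreover have "U * (adj W * a * W) * adj W = U * adj W * a * (W * adj W)" by (simp only: mult.assoc)
    ultimately show ?thesis using u w by simp
  qed
  then obtain c where c: "U * adj W = c *\<^sub>C 1" using central[of "U * adj W"] by blast
  have "U = (U * adj W) * W" using w by (simp add: mult.assoc)
  then have U_eq: "U = c *\<^sub>C W" by (simp add: c mult_scaleC_left)
  have "(cnj c * c) *\<^sub>C 1 = (1::'a)"
    using u(1) w(1) by (simp add: U_eq adj_scaleC mult_scaleC_left mult_scaleC_right scaleC_scaleC mult.commute)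
  then have "(cnj c * c - 1) *\<^sub>C (1::'a) = 0" by (simp add: scaleC_diff_left)
  then have "cnj c * c = 1" by (simp add: scaleC_eq_0_iff)
  then show ?thesis using that U_eq by blast
qed

lemma ring_qca_decomposition:
  fixes U :: "'a::cstar_algebra"
  assumes "ring_qca N \<iota> \<tau> L U" "ring_block_size N L k"
  shows "ring_decomposition N \<iota> \<tau> k U"
proof -
  have N: "N \<ge> 1" and U: "is_unitary U" "\<tau> U = U" and causal: "causal \<iota> L (conj_by U)"
    and chain: "spin_chain N \<iota> \<tau>"
    using assms(1) by (auto simp: ring_qca_def)
  interpret block_chain N \<iota> \<tau> k
    using assms(2) chain by unfold_locales (auto simp: ring_block_size_def)
  show ?thesis
  proof (cases "k = N")
    case True
    have "block_alg \<iota> N x = UNIV" for x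
      unfolding block_alg_def loc_alg_eq
    proof (rule sites.UNIV_eq_alg)
      fix y
      have "int N * x + y mod int N \<in> {int N * x..<int N * (x + 1)}"
        using N by (auto simp: algebra_simps)
      then show "\<exists>z\<in>{int N * x..<int N * (x + 1)}. y mod int N = z mod int N"
        by (rule bexI[rotated]) simp
    qed simp
    moreover have "(\<tau> ^^ n) U = U" for n using U(2) by (induction n) simp_all
    ultimately have "onsite_unitaries \<iota> \<tau> N (\<lambda>_. U)"
      using U(1) by (simp add: onsite_unitaries_def)
    moreover have "prod_list (map (\<lambda>_. U) [0..int (N div N) - 1]) = U" using N by simp
    ultimately have "onsite_layer_unitary N \<iota> \<tau> k U"
      unfolding onsite_layer_unitary_def True by metis
    then show ?thesis
      unfolding ring_decomposition_def by (intro exI[of _ "[U]"]) simp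
  next
    case False
    then have size: "2 * L \<le> k" "N = 0 \<or> 3 * k \<le> N"
      using assms(2) by (auto simp: ring_block_size_def)
    have aut: "star_automorphism (conj_by U)" by (rule conj_by_star_automorphism[OF U(1)])
    have comm: "conj_by U \<circ> \<tau> = \<tau> \<circ> conj_by U"
      using U(2) star_automorphismD(4,6)[OF sites.aut] by (simp add: fun_eq_iff conj_by_def)
    obtain \<beta>1 \<sigma>1 \<beta>2 \<sigma>2 where d: "blocks.onsite \<beta>1" "blocks.pshift \<sigma>1" "blocks.onsite \<beta>2" "blocks.pshift \<sigma>2"
      "conj_by U = \<beta>1 \<circ> \<sigma>1 \<circ> (\<beta>2 \<circ> \<sigma>2)"
      using decomposition[OF size aut comm causal] by blast
    obtain V1 where V1: "is_unitary V1" "onsite_layer_unitary N \<iota> \<tau> k V1" "\<beta>1 = conj_by V1"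
      using onsite_layerE[OF d(1)] N by auto
    obtain V2 where V2: "is_unitary V2" "onsite_layer_unitary N \<iota> \<tau> k V2" "\<beta>2 = conj_by V2"
      using onsite_layerE[OF d(3)] N by auto
    have inner: "\<exists>W. is_unitary W \<and> \<sigma> = conj_by W" if "blocks.pshift \<sigma>" for \<sigma>
      using sites.automorphism_inner[of \<sigma>] N that unfolding blocks.pshift_def by (metis less_le_trans zero_less_one)
    obtain W1 where W1: "is_unitary W1" "\<sigma>1 = conj_by W1" using inner d(2) by blast
    obtain W2 where W2: "is_unitary W2" "\<sigma>2 = conj_by W2" using inner d(4) by blast
    \<comment> \<open>The automorphism applied first supplies the leftmost unitary, since
      \<open>conj_by\<close> reverses products.\<close>
    have "conj_by U = conj_by (W2 * V2 * (W1 * V1))"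
      unfolding d(5) V1 V2 W1 W2 by (simp only: conj_by_mult)
    moreover have "is_unitary (W2 * V2 * (W1 * V1))"
      by (intro is_unitary_mult V1 V2 W1 W2)
    moreover have "\<exists>c. z = c *\<^sub>C 1" if "\<And>a. z * a = a * z" for z :: 'a
      using sites.scalar_if_central[of z] that by (simp add: commutant_def)
    \<comment> \<open>The phase goes into \<open>W2\<close>, since a partial shift is specified only
      through its conjugation. An on-site layer is a product of translates of one unitary, so
      placing the phase there would require a root of it.\<close>
    ultimately obtain c where c: "U = c *\<^sub>C (W2 * V2 * (W1 * V1))" "cnj c * c = 1"
      using scalar_multiple_if_conj_by_eq[OF U(1)] by metis
    have "is_unitary (c *\<^sub>C W2)"
      using W2(1) c(2) by (simp add: is_unitary_def adj_scaleC mult_scaleC_left mult_scaleC_right scaleC_scaleC mult.commute)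
    moreover have "conj_by (c *\<^sub>C W2) = \<sigma>2"
      using c(2) unfolding W2(2)
      by (simp add: fun_eq_iff conj_by_def adj_scaleC mult_scaleC_left mult_scaleC_right scaleC_scaleC mult.commute)
    moreover have "U = prod_list [c *\<^sub>C W2, V2, W1, V1]"
      by (simp add: c(1) mult_scaleC_left mult.assoc)
    ultimately show ?thesis
      unfolding ring_decomposition_def
      using V1 V2 W1 d(2,4) by (intro exI[of _ "[c *\<^sub>C W2, V2, W1, V1]"]) (simp add: partial_shift_iff)
  qed
qed

theorem theorem4p10:
  fixes \<iota> :: "int \<Rightarrow> complex^'d^'d \<Rightarrow> 'a::cstar_algebra"
    and \<tau> :: "'a \<Rightarrow> 'a"
    and L :: nat
  shows "(\<forall>\<alpha>. infinite_qca \<iota> \<tau> L \<alpha> \<longrightarrow> (\<exists>k\<ge>1. infinite_decomposition \<iota> \<tau> k \<alpha>)) \<and>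
    (\<forall>N U. ring_qca N \<iota> \<tau> L U \<longrightarrow>
       (\<forall>k. ring_block_size N L k \<longrightarrow> ring_decomposition N \<iota> \<tau> k U))"
  using infinite_qca_decomposition ring_qca_decomposition by (metis max.cobounded1)

end
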